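(* Let $\mathcal A$ be a basic algebra and let the monomial ordering on $E$ be a negative degree ordering. If $G$ is an interreduced signed standard basis of $M$, then the elements of $G$ whose signatures are of degree zero (that is, their unsigned elements $\mathrm{poly}(g)$) form a minimal generating set of $M$.
   Context: Algebra. Let $K$ be a field and $\mathcal P$ the path algebra over $K$ of a finite quiver $Q$. Its monomials $\mathrm{Mon}(\mathcal P)$ are the directed paths in $Q$ (including the trivial path $1_v$ at each vertex $v$); they form a $K$-basis of $\mathcal P$; $b\cdot c$ is the concatenation if $b$ ends where $c$ starts, and $0$ otherwise; $\deg$ is path length. A monomial ordering of $\mathcal P$ is a total ordering $>$ on $\mathrm{Mon}(\mathcal P)$ such that $b_1>b_2$ implies $b_1b>b_2b$ and $b'b_1>b'b_2$ for all monomials $b_1,b_2,b,b'$ such that $b_1b$, $b_2b$, $b'b_1$ and $b'b_2$ are all non-zero; fix one. The leading monomial $\mathrm{lm}(p)$ of $p\ne0$ is the greatest monomial occurring in $p$. Let $\psi:\mathcal P\to\mathcal A$ be the quotient map onto a quotient algebra $\mathcal A$. That $\mathcal A$ is a basic algebra means that it is finite-dimensional over $K$ and that the relations are at least quadratic: every element of $\ker\psi$ is a linear combination of paths of length at least $2$. Let $\mathrm{stdMon}$ be the set of monomials of $\mathcal P$ that are not leading monomials of elements of $\ker\psi$. Then $\psi$ is injective on $\mathrm{stdMon}$ and $\mathcal B_>(\mathcal A)=\psi(\mathrm{stdMon})$ is a $K$-basis of $\mathcal A$, whose elements are called the monomials of $\mathcal A$. For $b\in\mathcal B_>(\mathcal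 A)$, $\lambda(b)$ is the unique element of $\mathrm{stdMon}$ with $\psi(\lambda(b))=b$; $b>b'$ iff $\lambda(b)>\lambda(b')$. Leading monomials of non-zero elements of $\mathcal A$ are taken with respect to this basis. For $b,b'\in\mathcal B_>(\mathcal A)$, $b\parallel b'$ ($b$ strictly divides $b'$) means $\lambda(b')=\lambda(b)\cdot d$ for some $d\in\mathrm{Mon}(\mathcal P)$. Let $b\in\mathcal B_>(\mathcal A)$, $t\in\mathcal B_>(\mathcal A)\cup\{0\}$. If there is $c\in\mathcal B_>(\mathcal A)$ such that either $\mathrm{lm}(b\cdot c)=t\neq0$ and $b\not\parallel t$, or $b\cdot c=0=t$, then $t$ is a toppling of $b$ with cofactor $c$. If $c\in\mathcal B_>(\mathcal A)$ is not a cofactor of a toppling of $b$, then $c$ is a small cofactor of $b$. Modules. $F=\mathcal A^r$ is the free right-$\mathcal A$ module with free generators $\mathfrak v_1,\dots,\mathfrak v_r$ and monomials $\mathfrak v_i\cdot b$ ($b\in\mathcal B_>(\mathcal A)$), with a fixed total ordering on its monomials compatible with $>$: $b_1>b_2$ implies $\mathfrak v_ib_1>\mathfrak v_ib_2$; and $\mathfrak v_ib_1>\mathfrak v_jb_2$ implies $\mathfrak v_ib_1b>\mathfrak v_j\mathrm{lm}(b_2b)$ or $b_2b=0$, for all $i,j$ and all monomials $b_1,b_2,b$ of $\mathcal A$ such that $b$ is a small cofactor of $b_1$. $\mathrm{lm}$ is defined accordingly for non-zero elements of $F$. Small cofactors of $\mathfrak v_ib$ are those of $b$. Signatures. $M\subseteq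 F$ is a submodule with a fixed finite ordered generating set $\hat g_1,\dots,\hat g_m$. $E=\mathcal P^m$ is the free right-$\mathcal P$ module with free generators $\mathfrak e_1,\dots,\mathfrak e_m$, monomials $\mathrm{Mon}(E)=\{\mathfrak e_i\cdot b: b\in\mathrm{Mon}(\mathcal P)\}$ with $\deg(\mathfrak e_i\cdot b)=\deg b$ (the generators $\mathfrak e_i$ themselves are also used as monomials of degree zero), and a fixed monomial ordering compatible with that of $\mathcal P$: $b_1>b_2$ implies $\mathfrak e_ib_1>\mathfrak e_ib_2$; and $\mathfrak e_ib_1>\mathfrak e_jb_2$ implies $\mathfrak e_ib_1b>\mathfrak e_jb_2b$ whenever both products are non-zero. It is a negative degree ordering if $\deg(s)>\deg(t)$ implies $t>s$ for $s,t\in\mathrm{Mon}(E)$. $ev:E\to M$ is the $K$-linear map with $ev(\mathfrak e_i\cdot c)=\hat g_i\cdot\psi(c)$. A signed element of $M$ is a pair $f=(f_u,s)$ with $f_u\in M$, $s\in\mathrm{Mon}(E)$ such that some $\tilde f\in E$ has $\mathrm{lm}(\tilde f)=s$ and $ev(\tilde f)=f_u$; write $\mathrm{poly}(f)=f_u$ (unsigned element), $\sigma(f)=s$ (signature), $\mathrm{lm}(f)=\mathrm{lm}(f_u)$. It is a signed element of $M\setminus\{0\}$ if $f_u\neq0$; a signed subset is a set of signed elements. For $f\in F$, $s\in\mathrm{Mon}(E)$ and a signed subset $G$ of $M\setminus\{0\}$: $f$ is $s$-reducible (resp. weakly $s$-reducible) with respect to $G$ if there are $g\in G$ and a small cofactor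 $c$ of $\mathrm{lm}(g)$ with $\mathrm{lm}(g)\cdot c=\mathrm{lm}(f)$ and $\sigma(g)\cdot\lambda(c)<s$ (resp. $\le s$); with respect to $M\setminus\{0\}$ means with respect to $\{g\}$ for some signed element $g$ of $M\setminus\{0\}$. $f$ is $s$-irreducible if $f=0$ or $f$ is not $s$-reducible. For a signed element $f$, (weakly) reducible/irreducible means that $\mathrm{poly}(f)$ is so with $s=\sigma(f)$. A finite signed subset $G$ of $M\setminus\{0\}$ is interreduced if every $g\in G$ is irreducible with respect to $G$ and there are no distinct $g,g'\in G$ with a small cofactor $c$ of $\mathrm{lm}(g')$ such that $\mathrm{lm}(g')\cdot c=\mathrm{lm}(g)$ and $\sigma(g')\cdot\lambda(c)=\sigma(g)$. $G$ is a signed standard basis of $M$ if each signed element $f$ of $M\setminus\{0\}$ that is $\sigma(f)$-irreducible with respect to $M\setminus\{0\}$ is weakly $\sigma(f)$-reducible with respect to $G$. $\mathrm{Rad}(M)$ is the intersection of all maximal submodules of $M$, and the head of $M$ is $M/\mathrm{Rad}(M)$; in the paper's convention, a minimal generating set of $M$ as a right-$\mathcal A$ module corresponds to a $K$-vector space basis of $M/\mathrm{Rad}(M)$. *)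

theory Defs
  imports
    "Graph_Theory.Arc_Walk"
    "HOL-Library.Poly_Mapping"
    "HOL-Algebra.Embedded_Algebras"
    "HOL-Algebra.Module"
begin

section \<open>Total orders and greatest elements\<close>

definition strict_total_order_on :: "'x set \<Rightarrow> ('x \<Rightarrow> 'x \<Rightarrow> bool) \<Rightarrow> bool" where
  "strict_total_order_on S lt \<longleftrightarrow> irreflp_on S lt \<and> transp_on S lt \<and> totalp_on S lt"

definition greatest_wrt :: "('x \<Rightarrow> 'x \<Rightarrow> bool) \<Rightarrow> 'x set \<Rightarrow> 'x" where
  "greatest_wrt lt S = (THE x. x \<in> S \<and> (\<forall>y\<in>S. y = x \<or> lt y x))"


section \<open>Paths and the path algebra of a quiver\<close>

text \<open>
  A path is its start vertex together with its list of arrows, so that \<open>(v, [])\<close> is the trivial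
  path at \<open>v\<close>.
\<close>

type_synonym ('v, 'e) path = "'v \<times> 'e list"

definition paths :: "('v, 'e) pre_digraph \<Rightarrow> ('v, 'e) path set" where
  "paths Q = {(u, p). \<exists>v. pre_digraph.awalk Q u p v}"

definition path_deg :: "('v, 'e) path \<Rightarrow> nat" where
  "path_deg b = length (snd b)"

definition path_end :: "('v, 'e) pre_digraph \<Rightarrow> ('v, 'e) path \<Rightarrow> 'v" where
  "path_end Q b = pre_digraph.awlast Q (fst b) (snd b)"

text \<open>The product of two paths in the path algebra is non-zero iff they are composable.\<close>

definition composable :: "('v, 'e) pre_digraph \<Rightarrow> ('v, 'e) path \<Rightarrow> ('v, 'e) path \<Rightarrow> bool" where
  "composable Q b c \<longleftrightarrow> path_end Q b = fst c"

definition path_concat :: "('v, 'e) path \<Rightarrow> ('v, 'e) path \<Rightarrow> ('v, 'e) path" where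
  "path_concat b c = (fst b, snd b @ snd c)"

definition path_mult ::
  "('v, 'e) pre_digraph \<Rightarrow> (('v, 'e) path \<Rightarrow>\<^sub>0 'k::field) \<Rightarrow> (('v, 'e) path \<Rightarrow>\<^sub>0 'k)
    \<Rightarrow> (('v, 'e) path \<Rightarrow>\<^sub>0 'k)" where
  "path_mult Q p q =
    (\<Sum>b\<in>Poly_Mapping.keys p. \<Sum>c\<in>Poly_Mapping.keys q.
      if composable Q b c then Poly_Mapping.single (path_concat b c) (Poly_Mapping.lookup p b * Poly_Mapping.lookup q c) else 0)"

definition path_scalar :: "('v, 'e) pre_digraph \<Rightarrow> 'k::field \<Rightarrow> (('v, 'e) path \<Rightarrow>\<^sub>0 'k)" where
  "path_scalar Q k = (\<Sum>v\<in>verts Q. Poly_Mapping.single (v, []) k)"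

definition path_algebra :: "('v, 'e) pre_digraph \<Rightarrow> (('v, 'e) path \<Rightarrow>\<^sub>0 'k::field) ring" where
  "path_algebra Q =
    \<lparr>carrier = {p. Poly_Mapping.keys p \<subseteq> paths Q}, mult = path_mult Q, one = path_scalar Q 1,
     zero = 0, add = (+)\<rparr>"

lemma path_mult_superset:
  assumes "finite S" "finite T" "Poly_Mapping.keys p \<subseteq> S" "Poly_Mapping.keys q \<subseteq> T"
  shows "path_mult Q p q = (\<Sum>b\<in>S. \<Sum>c\<in>T.
      if composable Q b c
      then Poly_Mapping.single (path_concat b c) (Poly_Mapping.lookup p b * Poly_Mapping.lookup q c) else 0)"
proof -
  have "(\<Sum>c\<in>Poly_Mapping.keys q. if composable Q b c
      then Poly_Mapping.single (path_concat b c) (Poly_Mapping.lookup p b * Poly_Mapping.lookup q c) else 0)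
    = (\<Sum>c\<in>T. if composable Q b c
      then Poly_Mapping.single (path_concat b c) (Poly_Mapping.lookup p b * Poly_Mapping.lookup q c) else 0)" for b
    using assms by (intro sum.mono_neutral_left) (auto simp: in_keys_iff)
  then show ?thesis unfolding path_mult_def using assms
    by (simp only:) (intro sum.mono_neutral_left, auto simp: in_keys_iff intro!: sum.neutral)
qed

lemma path_mult_add_left: "path_mult Q (p + p') q = path_mult Q p q + path_mult Q p' q"
proof -
  let ?S = "Poly_Mapping.keys p \<union> Poly_Mapping.keys p'"
  have k: "Poly_Mapping.keys (p + p') \<subseteq> ?S" by (rule Poly_Mapping.keys_add)
  show ?thesis
    using k by (subst (1 2 3) path_mult_superset[where S = ?S and T = "Poly_Mapping.keys q"])
      (auto simp: lookup_add single_add ring_distribs sum.distrib[symmetric] intro!: sum.cong)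
qed

lemma path_mult_add_right: "path_mult Q p (q + q') = path_mult Q p q + path_mult Q p q'"
proof -
  let ?S = "Poly_Mapping.keys q \<union> Poly_Mapping.keys q'"
  have k: "Poly_Mapping.keys (q + q') \<subseteq> ?S" by (rule Poly_Mapping.keys_add)
  show ?thesis
    using k by (subst (1 2 3) path_mult_superset[where T = ?S and S = "Poly_Mapping.keys p"])
      (auto simp: lookup_add single_add ring_distribs sum.distrib[symmetric] intro!: sum.cong)
qed

lemma path_mult_single: "path_mult Q (Poly_Mapping.single b k) (Poly_Mapping.single c l)
   = (if composable Q b c then Poly_Mapping.single (path_concat b c) (k * l) else 0)"
  by (subst path_mult_superset[where S = "{b}" and T = "{c}"]) auto

lemma path_mult_zero [simp]: "path_mult Q 0 q = 0" "path_mult Q p 0 = 0"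
  by (simp_all add: path_mult_def)

lemma path_mult_sum_left: "path_mult Q (sum f I) q = (\<Sum>i\<in>I. path_mult Q (f i) q)"
  by (induction I rule: infinite_finite_induct) (simp_all add: path_mult_add_left)
lemma path_mult_sum_right: "path_mult Q p (sum f I) = (\<Sum>i\<in>I. path_mult Q p (f i))"
  by (induction I rule: infinite_finite_induct) (simp_all add: path_mult_add_right)

lemma path_end_concat: "composable Q b c \<Longrightarrow> path_end Q (path_concat b c) = path_end Q c"
  by (auto simp: path_end_def path_concat_def composable_def pre_digraph.awalk_verts_conv)

lemma poly_eq: "(p :: _ \<Rightarrow>\<^sub>0 'k::field) = (\<Sum>b\<in>Poly_Mapping.keys p. Poly_Mapping.single b (Poly_Mapping.lookup p b))"
  by (rule poly_mapping_eqI) (auto simp: lookup_sum lookup_single when_def in_keys_iff)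

lemma path_mult_assoc: "path_mult Q (path_mult Q p q) s = path_mult Q p (path_mult Q q s)"
proof -
  have 1: "path_mult Q (path_mult Q (Poly_Mapping.single b k) (Poly_Mapping.single c l)) (Poly_Mapping.single d n)
     = path_mult Q (Poly_Mapping.single b k) (path_mult Q (Poly_Mapping.single c l) (Poly_Mapping.single d n))" for b c d k l n
    by (auto simp: path_mult_single path_end_concat) 
      (auto simp: composable_def path_concat_def path_mult_single path_end_concat[unfolded composable_def path_concat_def] mult.assoc)
  show ?thesis
    apply (subst (1 2) poly_eq[of p], subst (1 2) poly_eq[of q], subst (1 2) poly_eq[of s])
    apply (simp add: path_mult_sum_left path_mult_sum_right 1)
    done
qed

lemma path_concat_paths: "wf_digraph Q \<Longrightarrow> b \<in> paths Q \<Longrightarrow> c \<in> paths Q \<Longrightarrow> composable Q b c \<Longrightarrow> path_concat b c \<in> paths Q"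
  by (auto simp: paths_def path_concat_def composable_def path_end_def wf_digraph.awalk_append_iff wf_digraph.awends_of_awalk)

lemma ring_path_algebra:
  assumes "fin_digraph Q"
  shows "ring (path_algebra Q :: (('v,'e) path \<Rightarrow>\<^sub>0 'k::field) ring)"
proof -
  interpret fin_digraph Q by fact
  note pm = path_algebra_def
  have triv: "(v, []) \<in> paths Q \<longleftrightarrow> v \<in> verts Q" for v
    by (auto simp: paths_def awalk_def)
  have l1: "path_mult Q (path_scalar Q 1) p = p" if "Poly_Mapping.keys p \<subseteq> paths Q" for p :: "('v,'e) path \<Rightarrow>\<^sub>0 'k"
  proof -
    have "path_mult Q (path_scalar Q 1) (Poly_Mapping.single b k) = Poly_Mapping.single b k" if "b \<in> paths Q" for b and k :: 'k
    proof -
      have "fst b \<in> verts Q" using that by (auto simp: paths_def)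
      moreover have "\<And>v. composable Q (v, []) b \<longleftrightarrow> fst b = v" by (auto simp: composable_def path_end_def)
      ultimately show ?thesis
        by (auto simp: path_scalar_def path_mult_sum_left path_mult_single path_concat_def if_distrib sum.delta)
    qed
    then show ?thesis using that
      by (subst (1 2) poly_eq[of p]) (auto simp: path_mult_sum_right intro!: sum.cong)
  qed
  have r1: "path_mult Q p (path_scalar Q 1) = p" if "Poly_Mapping.keys p \<subseteq> paths Q" for p :: "('v,'e) path \<Rightarrow>\<^sub>0 'k"
  proof -
    have "path_mult Q (Poly_Mapping.single b k) (path_scalar Q 1) = Poly_Mapping.single b k" if "b \<in> paths Q" for b and k :: 'k
    proof -
      have "path_end Q b \<in> verts Q" using that by (auto simp: paths_def path_end_def)
      moreover have "\<And>v. composable Q b (v, []) \<longleftrightarrow> path_end Q b = v" by (auto simp: composable_def)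
      ultimately show ?thesis
        by (auto simp: path_scalar_def path_mult_sum_right path_mult_single path_concat_def if_distrib sum.delta)
    qed
    then show ?thesis using that
      by (subst (1 2) poly_eq[of p]) (auto simp: path_mult_sum_left intro!: sum.cong)
  qed
  have cl: "Poly_Mapping.keys (path_mult Q p q) \<subseteq> paths Q"
    if "Poly_Mapping.keys p \<subseteq> paths Q" "Poly_Mapping.keys q \<subseteq> paths Q" for p q :: "('v,'e) path \<Rightarrow>\<^sub>0 'k"
  proof
    fix d assume "d \<in> Poly_Mapping.keys (path_mult Q p q)"
    then have "Poly_Mapping.lookup (path_mult Q p q) d \<noteq> 0" by (simp add: in_keys_iff)
    then obtain b c where "b \<in> Poly_Mapping.keys p" "c \<in> Poly_Mapping.keys q"
      "Poly_Mapping.lookup (if composable Q b c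
      then Poly_Mapping.single (path_concat b c) (Poly_Mapping.lookup p b * Poly_Mapping.lookup q c) else 0) d \<noteq> 0"
      unfolding path_mult_def lookup_sum by (meson sum.not_neutral_contains_not_neutral)
    then show "d \<in> paths Q" using that
      by (auto split: if_splits simp: lookup_single when_def intro!: path_concat_paths wf_digraph)
  qed
  have sc: "Poly_Mapping.keys (path_scalar Q (1::'k)) \<subseteq> paths Q"
  proof
    fix d assume "d \<in> Poly_Mapping.keys (path_scalar Q (1::'k))"
    then have "Poly_Mapping.lookup (path_scalar Q (1::'k)) d \<noteq> 0" by (simp add: in_keys_iff)
    then obtain v where "v \<in> verts Q" "Poly_Mapping.lookup (Poly_Mapping.single (v, []) (1::'k)) d \<noteq> 0"
      unfolding path_scalar_def lookup_sum by (meson sum.not_neutral_contains_not_neutral)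
    then show "d \<in> paths Q" using triv by (auto simp: lookup_single when_def split: if_splits)
  qed
  show ?thesis
  proof (intro ringI abelian_groupI monoidI)
    fix x y assume "x \<in> carrier (path_algebra Q :: (('v,'e) path \<Rightarrow>\<^sub>0 'k) ring)" "y \<in> carrier (path_algebra Q:: (('v,'e) path \<Rightarrow>\<^sub>0 'k) ring)"
    then show "x \<oplus>\<^bsub>path_algebra Q\<^esub> y \<in> carrier (path_algebra Q)"
      using Poly_Mapping.keys_add[of x y] by (auto simp: pm)
  next
    fix x assume "x \<in> carrier (path_algebra Q :: (('v,'e) path \<Rightarrow>\<^sub>0 'k) ring)"
    then show "\<exists>y\<in>carrier (path_algebra Q). y \<oplus>\<^bsub>path_algebra Q\<^esub> x = \<zero>\<^bsub>path_algebra Q\<^esub>"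
      by (intro bexI[of _ "-x"]) (auto simp: pm in_keys_iff)
  qed (auto simp: pm l1 r1 path_mult_assoc path_mult_add_left path_mult_add_right ac_simps dest: subsetD[OF cl] subsetD[OF sc])
qed

definition monomial_ordering ::
  "('v, 'e) pre_digraph \<Rightarrow> (('v, 'e) path \<Rightarrow> ('v, 'e) path \<Rightarrow> bool) \<Rightarrow> bool" where
  "monomial_ordering Q lt \<longleftrightarrow>
    strict_total_order_on (paths Q) lt \<and>
    (\<forall>b1\<in>paths Q. \<forall>b2\<in>paths Q. \<forall>b\<in>paths Q. \<forall>b'\<in>paths Q.
      composable Q b1 b \<and> composable Q b2 b \<and> composable Q b' b1 \<and> composable Q b' b2 \<and>
      lt b2 b1 \<longrightarrow>
      lt (path_concat b2 b) (path_concat b1 b) \<and> lt (path_concat b' b2) (path_concat b' b1))"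


section \<open>Quotients of path algebras and their monomials\<close>

text \<open>
  A quotient algebra is given by a surjective ring homomorphism \<open>psi\<close> out of the path algebra;
  its \<open>'k\<close>-algebra structure is the one induced by \<open>psi\<close>, see \<open>scalar\<close> below.
\<close>

locale path_algebra_quotient = fin_digraph Q + alg: ring A
  for Q :: "('v, 'e) pre_digraph" and A :: "('a, 'c) ring_scheme" (structure) +
  fixes psi :: "(('v, 'e) path \<Rightarrow>\<^sub>0 'k::field) \<Rightarrow> 'a"
    and lt :: "('v, 'e) path \<Rightarrow> ('v, 'e) path \<Rightarrow> bool"
  assumes psi_hom: "psi \<in> ring_hom (path_algebra Q) A"
    and psi_surj: "psi ` carrier (path_algebra Q) = carrier A"
    and monomial_ordering: "monomial_ordering Q lt"
begin

definition scalar :: "'k \<Rightarrow> 'a" where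
  "scalar k = psi (path_scalar Q k)"

abbreviation Ker :: "(('v, 'e) path \<Rightarrow>\<^sub>0 'k) set" where
  "Ker \<equiv> a_kernel (path_algebra Q) A psi"

definition basic_algebra :: bool where
  "basic_algebra \<longleftrightarrow>
    ring.finite_dimension A (range scalar) (carrier A) \<and>
    (\<forall>p\<in>Ker. \<forall>b\<in>Poly_Mapping.keys p. 2 \<le> path_deg b)"

definition lm_path :: "(('v, 'e) path \<Rightarrow>\<^sub>0 'k) \<Rightarrow> ('v, 'e) path" where
  "lm_path p = greatest_wrt lt (Poly_Mapping.keys p)"

definition std_mon :: "('v, 'e) path set" where
  "std_mon = paths Q - {lm_path p |p. p \<in> Ker \<and> p \<noteq> 0}"

definition path_image :: "('v, 'e) path \<Rightarrow> 'a" where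
  "path_image b = psi (Poly_Mapping.single b 1)"

text \<open>The monomials of the algebra are kept as elements of the algebra; \<open>lam\<close> is the map
  usually written \<open>\<lambda>\<close>.\<close>

definition monomials :: "'a set" where
  "monomials = path_image ` std_mon"

definition lam :: "'a \<Rightarrow> ('v, 'e) path" where
  "lam = the_inv_into std_mon path_image"

definition lt_alg :: "'a \<Rightarrow> 'a \<Rightarrow> bool" where
  "lt_alg b b' \<longleftrightarrow> lt (lam b) (lam b')"

text \<open>\<open>normal_form a\<close> records the coordinates of \<open>a\<close> with respect to the monomials.\<close>

definition normal_form :: "'a \<Rightarrow> (('v, 'e) path \<Rightarrow>\<^sub>0 'k)" where
  "normal_form a = (THE p. Poly_Mapping.keys p \<subseteq> std_mon \<and> psi p = a)"

definition support :: "'a \<Rightarrow> 'a set" where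
  "support a = path_image ` Poly_Mapping.keys (normal_form a)"

definition lm_alg :: "'a \<Rightarrow> 'a" where
  "lm_alg a = greatest_wrt lt_alg (support a)"

definition strictly_divides :: "'a \<Rightarrow> 'a \<Rightarrow> bool" where
  "strictly_divides b b' \<longleftrightarrow>
    (\<exists>d\<in>paths Q. composable Q (lam b) d \<and> lam b' = path_concat (lam b) d)"

definition toppling :: "'a \<Rightarrow> 'a \<Rightarrow> 'a \<Rightarrow> bool" where
  "toppling b c t \<longleftrightarrow>
    b \<in> monomials \<and> c \<in> monomials \<and> t \<in> monomials \<union> {\<zero>} \<and>
    (b \<otimes> c \<noteq> \<zero> \<and> lm_alg (b \<otimes> c) = t \<and> t \<noteq> \<zero> \<and> \<not> strictly_divides b t \<or>
     b \<otimes> c = \<zero> \<and> t = \<zero>)"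

definition small_cofactor :: "'a \<Rightarrow> 'a \<Rightarrow> bool" where
  "small_cofactor b c \<longleftrightarrow> b \<in> monomials \<and> c \<in> monomials \<and> \<not> (\<exists>t. toppling b c t)"

lemma psi_add: "p \<in> carrier (path_algebra Q) \<Longrightarrow> q \<in> carrier (path_algebra Q) \<Longrightarrow> psi (p + q) = psi p \<oplus> psi q"
  using ring_hom_add[OF psi_hom, of p q] by (simp add: path_algebra_def)

lemma greatest_in: 
  assumes "finite S" "S \<noteq> {}" "S \<subseteq> paths Q" shows "greatest_wrt lt S \<in> S"
proof -
  have o: "irreflp_on (paths Q) lt" "transp_on (paths Q) lt" "totalp_on (paths Q) lt"
    using monomial_ordering by (auto simp: monomial_ordering_def strict_total_order_on_def)
  have ex: "\<exists>x\<in>S. \<forall>y\<in>S. y = x \<or> lt y x" using assms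
  proof (induction S rule: finite_ne_induct)
    case (insert a S)
    then obtain x where x: "x \<in> S" "\<forall>y\<in>S. y = x \<or> lt y x" by auto
    consider "lt a x" | "lt x a" | "a = x" using o(3) insert.prems x unfolding totalp_on_def by blast
    then show ?case
    proof cases
      case 2
      have "lt y a" if "y \<in> S" for y
      proof (cases "y = x")
        case False
        then have "lt y x" using x that by auto
        moreover have "y \<in> paths Q" "x \<in> paths Q" "a \<in> paths Q" using that x insert.prems by auto
        ultimately show ?thesis using o(2) 2 unfolding transp_on_def by blast
      qed (use 2 in simp)
      then show ?thesis by auto
    qed (use x in auto)
  qed auto
  then obtain x where x: "x \<in> S" "\<forall>y\<in>S. y = x \<or> lt y x" by auto
  have "greatest_wrt lt S = x" unfolding greatest_wrt_def
  proof (rule the_equality)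
    show "x \<in> S \<and> (\<forall>y\<in>S. y = x \<or> lt y x)" using x by blast
  next
    fix z assume z: "z \<in> S \<and> (\<forall>y\<in>S. y = z \<or> lt y z)"
    show "z = x"
    proof (rule ccontr)
      assume "z \<noteq> x"
      then have "lt z x" "lt x z" using x z by auto
      moreover have "z \<in> paths Q" "x \<in> paths Q" using x z assms(3) by auto
      ultimately show False using o(1,2) unfolding transp_on_def irreflp_on_def by blast
    qed
  qed
  then show ?thesis using x by simp
qed

lemma std_unique:
  assumes "Poly_Mapping.keys p \<subseteq> std_mon" "Poly_Mapping.keys q \<subseteq> std_mon" "psi p = psi q"
  shows "p = q"
proof (rule ccontr)
  assume "p \<noteq> q"
  then have ne: "p - q \<noteq> 0" by simp
  interpret P: ring "path_algebra Q :: (('v,'e) path \<Rightarrow>\<^sub>0 'k) ring" by (rule ring_path_algebra) unfold_locales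
  have sub: "std_mon \<subseteq> paths Q" by (auto simp: std_mon_def)
  have k: "Poly_Mapping.keys (p - q) \<subseteq> std_mon" using assms
    by (meson Un_least keys_diff subset_trans)
  have c: "p \<in> carrier (path_algebra Q)" "q \<in> carrier (path_algebra Q)" "p - q \<in> carrier (path_algebra Q)"
    using assms k sub by (auto simp: path_algebra_def)
  have cl: "psi x \<in> carrier A" if "x \<in> carrier (path_algebra Q)" for x using ring_hom_closed[OF psi_hom that] .
  have "psi p = psi (p - q) \<oplus> psi q" using psi_add[OF c(3) c(2)] by simp
  then have "psi (p - q) \<oplus> psi q = \<zero> \<oplus> psi q" using assms(3) cl[OF c(2)] by simp
  then have "psi (p - q) = \<zero>" using cl[OF c(2)] cl[OF c(3)] alg.zero_closed alg.add.right_cancel by blast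
  then have "p - q \<in> Ker" using c by (simp add: a_kernel_def')
  moreover have "lm_path (p - q) \<in> Poly_Mapping.keys (p - q)"
    unfolding lm_path_def using k sub ne by (intro greatest_in) auto
  ultimately show False using k ne unfolding std_mon_def by blast
qed

end

text \<open>
  The standing fact that the monomials form a \<open>'k\<close>-basis of the algebra. That \<open>psi\<close> is injective
  on \<open>std_mon\<close> and that the monomials are linearly independent is the lemma \<open>std_unique\<close>. That they span needs to be required: it can fail if the monomial ordering is not a
  well-ordering, as for the relation \<open>x\<^sup>2 = x\<^sup>3\<close> on one loop \<open>x\<close> with \<open>x\<^sup>2 > x\<^sup>3\<close>,
  where \<open>1\<close> and \<open>x\<close> are the only standard monomials of a three-dimensional algebra.
\<close>

locale path_algebra_quotient_basis = path_algebra_quotient +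
  assumes monomials_span:
    "a \<in> carrier A \<Longrightarrow> \<exists>p. Poly_Mapping.keys p \<subseteq> std_mon \<and> psi p = a"


section \<open>The free right module over the quotient algebra\<close>

text \<open>
  The scalar multiplication of this record is the right action: \<open>smult a x\<close> stands for
  \<open>x \<cdot> a\<close>. Hence \<open>submodule N A (free_right_module A r)\<close> expresses that \<open>N\<close> is a right
  submodule. The ring operations \<open>mult\<close> and \<open>one\<close> of the record play no role.
\<close>

definition free_right_module :: "('a, 'c) ring_scheme \<Rightarrow> nat \<Rightarrow> ('a, nat \<Rightarrow> 'a) module" where
  "free_right_module A r =
    \<lparr>carrier = {..<r} \<rightarrow>\<^sub>E carrier A, mult = undefined, one = undefined,
     zero = (\<lambda>i\<in>{..<r}. \<zero>\<^bsub>A\<^esub>), add = (\<lambda>x y. \<lambda>i\<in>{..<r}. x i \<oplus>\<^bsub>A\<^esub> y i),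
     smult = (\<lambda>a x. \<lambda>i\<in>{..<r}. x i \<otimes>\<^bsub>A\<^esub> a)\<rparr>"

text \<open>
  A pair \<open>(i, b)\<close> stands for the monomial \<open>\<vv>\<^sub>i \<cdot> b\<close>. For a small cofactor \<open>b\<close> of \<open>b1\<close>, the product
  \<open>b1 \<otimes> b\<close> need not be a monomial; the compatibility condition speaks only about the case in
  which the two sides can be compared as monomials.
\<close>

context path_algebra_quotient
begin

definition module_monomials :: "nat \<Rightarrow> (nat \<times> 'a) set" where
  "module_monomials r = {..<r} \<times> monomials"

definition module_ordering :: "nat \<Rightarrow> (nat \<times> 'a \<Rightarrow> nat \<times> 'a \<Rightarrow> bool) \<Rightarrow> bool" where
  "module_ordering r lt_F \<longleftrightarrow>
    strict_total_order_on (module_monomials r) lt_F \<and>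
    (\<forall>i<r. \<forall>b1\<in>monomials. \<forall>b2\<in>monomials.
      lt_alg b2 b1 \<longrightarrow> lt_F (i, b2) (i, b1)) \<and>
    (\<forall>i<r. \<forall>j<r. \<forall>b1\<in>monomials. \<forall>b2\<in>monomials. \<forall>b\<in>monomials.
      small_cofactor b1 b \<and> b1 \<otimes> b \<in> monomials \<and> lt_F (j, b2) (i, b1) \<longrightarrow>
      b2 \<otimes> b = \<zero> \<or> lt_F (j, lm_alg (b2 \<otimes> b)) (i, b1 \<otimes> b))"

definition sig_monomials :: "nat \<Rightarrow> (nat \<times> ('v, 'e) path) set" where
  "sig_monomials m = {..<m} \<times> paths Q"

definition sig_ordering ::
  "nat \<Rightarrow> (nat \<times> ('v, 'e) path \<Rightarrow> nat \<times> ('v, 'e) path \<Rightarrow> bool) \<Rightarrow> bool" where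
  "sig_ordering m lt_E \<longleftrightarrow>
    strict_total_order_on (sig_monomials m) lt_E \<and>
    (\<forall>i<m. \<forall>b1\<in>paths Q. \<forall>b2\<in>paths Q. lt b2 b1 \<longrightarrow> lt_E (i, b2) (i, b1)) \<and>
    (\<forall>i<m. \<forall>j<m. \<forall>b1\<in>paths Q. \<forall>b2\<in>paths Q. \<forall>b\<in>paths Q.
      composable Q b1 b \<and> composable Q b2 b \<and> lt_E (j, b2) (i, b1) \<longrightarrow>
      lt_E (j, path_concat b2 b) (i, path_concat b1 b))"

end


section \<open>Signed elements and signed standard bases\<close>

definition generated_submodule ::
  "('a, 'c) ring_scheme \<Rightarrow> ('a, 'b, 'd) module_scheme \<Rightarrow> 'b set \<Rightarrow> 'b set" where
  "generated_submodule A F X = \<Inter>{N. submodule N A F \<and> X \<subseteq> N}"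

text \<open>
  The elements of \<open>E\<close> are represented as finitely supported functions on the monomials of \<open>E\<close>,
  where \<open>(i, b)\<close> stands for \<open>\<ee>\<^sub>i \<cdot> b\<close>.
\<close>

locale signature_setting = path_algebra_quotient_basis Q A psi lt
  for Q :: "('v, 'e) pre_digraph" and A :: "('a, 'c) ring_scheme" (structure)
    and psi :: "(('v, 'e) path \<Rightarrow>\<^sub>0 'k::field) \<Rightarrow> 'a"
    and lt :: "('v, 'e) path \<Rightarrow> ('v, 'e) path \<Rightarrow> bool" +
  fixes r :: nat
    and lt_F :: "nat \<times> 'a \<Rightarrow> nat \<times> 'a \<Rightarrow> bool"
    and M :: "(nat \<Rightarrow> 'a) set"
    and m :: nat
    and gen :: "nat \<Rightarrow> nat \<Rightarrow> 'a"
    and lt_E :: "nat \<times> ('v, 'e) path \<Rightarrow> nat \<times> ('v, 'e) path \<Rightarrow> bool"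
  assumes module_ordering: "module_ordering r lt_F"
    and submodule_M: "submodule M A (free_right_module A r)"
    and gen_in_M: "i < m \<Longrightarrow> gen i \<in> M"
    and gen_generates: "generated_submodule A (free_right_module A r) (gen ` {..<m}) = M"
    and sig_ordering: "sig_ordering m lt_E"
begin

abbreviation F :: "('a, nat \<Rightarrow> 'a) module" where
  "F \<equiv> free_right_module A r"

definition lm_F :: "(nat \<Rightarrow> 'a) \<Rightarrow> nat \<times> 'a" where
  "lm_F x = greatest_wrt lt_F {(i, b). i < r \<and> b \<in> support (x i)}"

definition E :: "(nat \<times> ('v, 'e) path \<Rightarrow>\<^sub>0 'k) set" where
  "E = {f. Poly_Mapping.keys f \<subseteq> sig_monomials m}"

definition lm_E :: "(nat \<times> ('v, 'e) path \<Rightarrow>\<^sub>0 'k) \<Rightarrow> nat \<times> ('v, 'e) path" where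
  "lm_E f = greatest_wrt lt_E (Poly_Mapping.keys f)"

definition ev :: "(nat \<times> ('v, 'e) path \<Rightarrow>\<^sub>0 'k) \<Rightarrow> nat \<Rightarrow> 'a" where
  "ev f = (\<Oplus>\<^bsub>F\<^esub>t\<in>Poly_Mapping.keys f. psi (Poly_Mapping.single (snd t) (Poly_Mapping.lookup f t)) \<odot>\<^bsub>F\<^esub> gen (fst t))"

definition negative_degree_ordering :: bool where
  "negative_degree_ordering \<longleftrightarrow>
    (\<forall>s\<in>sig_monomials m. \<forall>t\<in>sig_monomials m.
      path_deg (snd t) < path_deg (snd s) \<longrightarrow> lt_E s t)"

text \<open>For a signed element \<open>f\<close>, \<open>fst f\<close> is its unsigned element and \<open>snd f\<close> its signature.\<close>

definition signed_elements :: "((nat \<Rightarrow> 'a) \<times> (nat \<times> ('v, 'e) path)) set" where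
  "signed_elements =
    {(fu, s). fu \<in> M \<and> s \<in> sig_monomials m \<and> (\<exists>ft\<in>E. ft \<noteq> 0 \<and> lm_E ft = s \<and> ev ft = fu)}"

definition signed_nonzero :: "((nat \<Rightarrow> 'a) \<times> (nat \<times> ('v, 'e) path)) set" where
  "signed_nonzero = {f \<in> signed_elements. fst f \<noteq> \<zero>\<^bsub>F\<^esub>}"

text \<open>
  \<open>reduction_step x g c\<close>: \<open>c\<close> is a small cofactor of \<open>lm(g)\<close> with \<open>lm(g) \<cdot> c = lm(x)\<close>.
  A comparison of \<open>\<sigma>(g) \<cdot> \<lambda>(c)\<close> with a signature presupposes that this product is a
  monomial of \<open>E\<close>, that is, non-zero.
\<close>

definition reduction_step ::
  "(nat \<Rightarrow> 'a) \<Rightarrow> (nat \<Rightarrow> 'a) \<times> (nat \<times> ('v, 'e) path) \<Rightarrow> 'a \<Rightarrow> bool" where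
  "reduction_step x g c \<longleftrightarrow>
    x \<noteq> \<zero>\<^bsub>F\<^esub> \<and> small_cofactor (snd (lm_F (fst g))) c \<and>
    (fst (lm_F (fst g)), snd (lm_F (fst g)) \<otimes> c) = lm_F x"

definition sig_product_defined :: "nat \<times> ('v, 'e) path \<Rightarrow> 'a \<Rightarrow> bool" where
  "sig_product_defined s c \<longleftrightarrow> composable Q (snd s) (lam c)"

definition sig_product :: "nat \<times> ('v, 'e) path \<Rightarrow> 'a \<Rightarrow> nat \<times> ('v, 'e) path" where
  "sig_product s c = (fst s, path_concat (snd s) (lam c))"

definition s_reducible ::
  "nat \<times> ('v, 'e) path \<Rightarrow> ((nat \<Rightarrow> 'a) \<times> (nat \<times> ('v, 'e) path)) set
    \<Rightarrow> (nat \<Rightarrow> 'a) \<Rightarrow> bool" where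
  "s_reducible s G x \<longleftrightarrow>
    (\<exists>g\<in>G. \<exists>c. reduction_step x g c \<and> sig_product_defined (snd g) c \<and>
      lt_E (sig_product (snd g) c) s)"

definition weakly_s_reducible ::
  "nat \<times> ('v, 'e) path \<Rightarrow> ((nat \<Rightarrow> 'a) \<times> (nat \<times> ('v, 'e) path)) set
    \<Rightarrow> (nat \<Rightarrow> 'a) \<Rightarrow> bool" where
  "weakly_s_reducible s G x \<longleftrightarrow>
    (\<exists>g\<in>G. \<exists>c. reduction_step x g c \<and> sig_product_defined (snd g) c \<and>
      (lt_E (sig_product (snd g) c) s \<or> sig_product (snd g) c = s))"

definition s_irreducible ::
  "nat \<times> ('v, 'e) path \<Rightarrow> ((nat \<Rightarrow> 'a) \<times> (nat \<times> ('v, 'e) path)) set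
    \<Rightarrow> (nat \<Rightarrow> 'a) \<Rightarrow> bool" where
  "s_irreducible s G x \<longleftrightarrow> x = \<zero>\<^bsub>F\<^esub> \<or> \<not> s_reducible s G x"

definition interreduced :: "((nat \<Rightarrow> 'a) \<times> (nat \<times> ('v, 'e) path)) set \<Rightarrow> bool" where
  "interreduced G \<longleftrightarrow>
    finite G \<and> G \<subseteq> signed_nonzero \<and>
    (\<forall>g\<in>G. s_irreducible (snd g) G (fst g)) \<and>
    \<not> (\<exists>g\<in>G. \<exists>g'\<in>G. \<exists>c. g \<noteq> g' \<and> reduction_step (fst g) g' c \<and>
          sig_product_defined (snd g') c \<and> sig_product (snd g') c = snd g)"

definition signed_standard_basis :: "((nat \<Rightarrow> 'a) \<times> (nat \<times> ('v, 'e) path)) set \<Rightarrow> bool" where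
  "signed_standard_basis G \<longleftrightarrow>
    finite G \<and> G \<subseteq> signed_nonzero \<and>
    (\<forall>f\<in>signed_nonzero.
      s_irreducible (snd f) signed_nonzero (fst f) \<longrightarrow> weakly_s_reducible (snd f) G (fst f))"


section \<open>Radical, head and minimal generating sets\<close>

definition maximal_submodule :: "(nat \<Rightarrow> 'a) set \<Rightarrow> bool" where
  "maximal_submodule N \<longleftrightarrow>
    submodule N A F \<and> N \<subset> M \<and>
    (\<forall>N'. submodule N' A F \<and> N \<subseteq> N' \<and> N' \<subseteq> M \<longrightarrow> N' = N \<or> N' = M)"

definition Rad :: "(nat \<Rightarrow> 'a) set" where
  "Rad = {x \<in> M. \<forall>N. maximal_submodule N \<longrightarrow> x \<in> N}"

text \<open>
  \<open>X\<close> represents a \<open>'k\<close>-basis of \<open>M/Rad(M)\<close>: every coset of \<open>Rad(M)\<close> in \<open>M\<close> is the coset of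
  exactly one \<open>'k\<close>-linear combination of \<open>X\<close> (in particular, the elements of \<open>X\<close> lie in
  pairwise different cosets).
\<close>

definition head_basis :: "(nat \<Rightarrow> 'a) set \<Rightarrow> bool" where
  "head_basis X \<longleftrightarrow>
    finite X \<and> X \<subseteq> M \<and>
    (\<forall>y\<in>M. \<exists>!k. k \<in> X \<rightarrow>\<^sub>E (UNIV :: 'k set) \<and>
      Rad +>\<^bsub>F\<^esub> y = Rad +>\<^bsub>F\<^esub> (\<Oplus>\<^bsub>F\<^esub>x\<in>X. scalar (k x) \<odot>\<^bsub>F\<^esub> x))"

text \<open>
  Minimality is meant with respect to the dimension of the head over \<open>'k\<close>. If \<open>Q\<close> has several
  vertices, this differs from minimality with respect to inclusion.
\<close>

definition minimal_generating_set :: "(nat \<Rightarrow> 'a) set \<Rightarrow> bool" where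
  "minimal_generating_set X \<longleftrightarrow>
    X \<subseteq> M \<and> generated_submodule A F X = M \<and> head_basis X"

definition degree_zero_part ::
  "((nat \<Rightarrow> 'a) \<times> (nat \<times> ('v, 'e) path)) set \<Rightarrow> ((nat \<Rightarrow> 'a) \<times> (nat \<times> ('v, 'e) path)) set" where
  "degree_zero_part G = {g \<in> G. path_deg (snd (snd g)) = 0}"

end

end

theory Submission
  imports Defs
begin

text \<open>
  Write \<open>J\<close> for the ideal of the algebra generated by the arrows. In a negative degree ordering the
  monomials \<open>\<ee>\<^sub>i \<cdot> 1\<^sub>v\<close> of degree zero are the greatest monomials of \<open>E\<close>, and the remaining monomials
  span the elements whose values make up \<open>M \<cdot> J\<close>. So the head \<open>M / M \<cdot> J\<close> is the span of the
  degree-zero monomials modulo the syzygies, and by Gaussian elimination it has a basis indexed by the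
  set \<open>B\<close> of those degree-zero monomials that are not leading monomials of syzygies: the classes of any
  elements of \<open>M\<close> with these signatures, one for each, form such a basis. It remains to see that \<open>G\<close>
  contains exactly one element for each signature in \<open>B\<close> and none for any other signature of degree
  zero.

  All three points follow from a strengthening of the standard basis property: every non-zero signed
  element is weakly reducible with respect to \<open>G\<close>, not only an irreducible one
  (\<open>weakly_reducible\<close>). Interreducedness then says that no element of \<open>G\<close> shares its
  leading monomial with a signed element of smaller signature (\<open>no_smaller_signature\<close>). Hence a
  signature of \<open>G\<close> cannot be cancelled by a syzygy (\<open>signature_not_syzygy\<close>) or by another
  element of \<open>G\<close> (\<open>signature_inj\<close>). Conversely, for \<open>s \<in> B\<close> an element with signature \<open>s\<close> and least
  leading monomial can only be reduced by an element of \<open>G\<close> with signature \<open>s\<close>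
  (\<open>degree_zero_signature\<close>).

  These arguments minimise over signatures, although a negative degree ordering need not
  be a well-ordering. What makes them work is finiteness: since shorter paths are greater, a
  sufficiently long path cannot be congruent to a non-zero combination of the finitely many standard
  monomials, so it is zero in the algebra if \<open>m > 0\<close> (\<open>long_path_zero\<close>). Thus \<open>J\<close> acts nilpotently and only
  finitely many signatures occur (\<open>finite_signatures\<close>). The nilpotency also yields Nakayama's
  lemma (\<open>nakayama\<close>), hence that a basis of \<open>M / M \<cdot> J\<close> generates \<open>M\<close> and that \<open>M \<cdot> J\<close> lies in every
  maximal submodule; the converse inclusion \<open>Rad(M) \<subseteq> M \<cdot> J\<close> comes from coordinate hyperplanes
  (\<open>maximal_submodule_avoiding\<close>).
\<close>


section \<open>Extremal elements of finite sets\<close>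

lemma strict_total_order_onD:
  assumes "strict_total_order_on S lt" "x \<in> S" "y \<in> S"
  shows "\<not> lt x x" and "lt x y \<Longrightarrow> \<not> lt y x" and "x \<noteq> y \<Longrightarrow> lt x y \<or> lt y x"
    and "z \<in> S \<Longrightarrow> lt x y \<Longrightarrow> lt y z \<Longrightarrow> lt x z"
  using assms unfolding strict_total_order_on_def irreflp_on_def transp_on_def totalp_on_def
  by blast+

lemma finite_least_exists:
  assumes "strict_total_order_on S lt" "finite K" "K \<noteq> {}" "K \<subseteq> S"
  shows "\<exists>x\<in>K. \<forall>y\<in>K. y = x \<or> lt x y"
  using assms(2-4)
proof (induction K rule: finite_ne_induct)
  case (insert a K)
  then obtain x where x: "x \<in> K" "\<forall>y\<in>K. y = x \<or> lt x y" by auto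
  have S: "a \<in> S" "x \<in> S" using insert.prems x(1) by auto
  note ord = strict_total_order_onD[OF assms(1)]
  consider "lt a x" | "lt x a" | "a = x" using ord(3)[OF S] by blast
  then show ?case
  proof cases
    case 1
    then have "lt a y" if "y \<in> K" for y
    proof (cases "y = x")
      case False
      then have "lt x y" "y \<in> S" using that x(2) insert.prems by auto
      then show ?thesis using ord(4)[OF S, of y] 1 by simp
    qed (use 1 in simp)
    then show ?thesis by auto
  next
    case 2
    then show ?thesis using x by auto
  next
    case 3
    then show ?thesis using x by auto
  qed
qed auto

lemma strict_total_order_on_converse:
  "strict_total_order_on S lt \<Longrightarrow> strict_total_order_on S (\<lambda>x y. lt y x)"
  unfolding strict_total_order_on_def irreflp_on_def transp_on_def totalp_on_def by blast

lemma strict_total_order_on_pullback: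
  assumes "strict_total_order_on S lt" "inj_on f T" "\<And>x. x \<in> T \<Longrightarrow> f x \<in> S"
  shows "strict_total_order_on T (\<lambda>x y. lt (f x) (f y))"
  unfolding strict_total_order_on_def irreflp_on_def transp_on_def totalp_on_def
proof (intro conjI ballI impI)
  fix x assume x: "x \<in> T"
  then show "\<not> lt (f x) (f x)" using strict_total_order_onD(1)[OF assms(1), of "f x" "f x"] assms(3) by simp
  fix y assume y: "y \<in> T"
  show "lt (f x) (f y) \<or> lt (f y) (f x)" if "x \<noteq> y"
    using strict_total_order_onD(3)[OF assms(1), of "f x" "f y"] that x y assms(3)
      inj_onD[OF assms(2), of x y] by auto
  fix z assume "z \<in> T" "lt (f x) (f y)" "lt (f y) (f z)"
  then show "lt (f x) (f z)"
    using strict_total_order_onD(4)[OF assms(1), of "f x" "f y" "f z"] x y assms(3) by auto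
qed

lemma greatest_wrt_eqI:
  assumes "strict_total_order_on S lt" "K \<subseteq> S" "x \<in> K" "\<And>y. y \<in> K \<Longrightarrow> y = x \<or> lt y x"
  shows "greatest_wrt lt K = x"
  unfolding greatest_wrt_def
proof (rule the_equality)
  show "x \<in> K \<and> (\<forall>y\<in>K. y = x \<or> lt y x)" using assms(3,4) by auto
next
  fix z assume z: "z \<in> K \<and> (\<forall>y\<in>K. y = z \<or> lt y z)"
  show "z = x"
  proof (rule ccontr)
    assume "z \<noteq> x"
    then have "lt z x" "lt x z" using z assms(3,4) by auto
    then show False
      using strict_total_order_onD(2)[OF assms(1), of x z] z assms(2,3) by blast
  qed
qed

lemma greatest_wrt:
  assumes "strict_total_order_on S lt" "finite K" "K \<noteq> {}" "K \<subseteq> S"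
  shows "greatest_wrt lt K \<in> K" and "y \<in> K \<Longrightarrow> y = greatest_wrt lt K \<or> lt y (greatest_wrt lt K)"
proof -
  obtain x where x: "x \<in> K" "\<forall>y\<in>K. y = x \<or> lt y x"
    using finite_least_exists[OF strict_total_order_on_converse[OF assms(1)] assms(2-4)] by auto
  then have "greatest_wrt lt K = x" by (intro greatest_wrt_eqI[OF assms(1,4)]) auto
  then show "greatest_wrt lt K \<in> K" "y \<in> K \<Longrightarrow> y = greatest_wrt lt K \<or> lt y (greatest_wrt lt K)"
    using x by auto
qed


section \<open>Quotients of a path algebra in coordinates\<close>

definition scale :: "'k::field \<Rightarrow> ('x \<Rightarrow>\<^sub>0 'k) \<Rightarrow> ('x \<Rightarrow>\<^sub>0 'k)" where
  "scale k p = Poly_Mapping.map ((*) k) p"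

lemma lookup_scale [simp]: "Poly_Mapping.lookup (scale k p) x = k * Poly_Mapping.lookup p x"
  by (simp add: scale_def Poly_Mapping.map.rep_eq when_def)

lemma keys_scale: "Poly_Mapping.keys (scale k p) \<subseteq> Poly_Mapping.keys p"
  by (auto simp: in_keys_iff)

lemma scale_single: "scale k (Poly_Mapping.single x l) = Poly_Mapping.single x (k * l)"
  by (rule poly_mapping_eqI) (auto simp: lookup_single when_def)

lemma scale_eq_sum:
  "scale k p = (\<Sum>b\<in>Poly_Mapping.keys p. Poly_Mapping.single b (k * Poly_Mapping.lookup p b))"
  by (rule poly_mapping_eqI) (auto simp: lookup_sum lookup_single when_def in_keys_iff)

lemma keys_sum_subset:
  assumes "\<And>i. i \<in> I \<Longrightarrow> Poly_Mapping.keys (f i) \<subseteq> S"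
  shows "Poly_Mapping.keys (sum f I) \<subseteq> S"
  using assms
proof (induction I rule: infinite_finite_induct)
  case (insert x F)
  then show ?case using Poly_Mapping.keys_add[of "f x" "sum f F"] by auto
qed auto

lemma (in fin_digraph) trivial_path_iff: "(v, []) \<in> paths G \<longleftrightarrow> v \<in> verts G"
  by (auto simp: paths_def awalk_def)

lemma path_deg_concat: "path_deg (path_concat b c) = path_deg b + path_deg c"
  by (simp add: path_deg_def path_concat_def)

lemma path_concat_right_cancel:
  "path_concat b d = path_concat b' d \<Longrightarrow> b = b'"
  by (auto simp: path_concat_def prod_eq_iff)

lemma composable_trivial: "composable Q (v, []) b \<longleftrightarrow> v = fst b" "composable Q b (v, []) \<longleftrightarrow> path_end Q b = v"
  by (auto simp: composable_def path_end_def pre_digraph.awalk_verts.simps)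

lemma path_concat_trivial: "path_concat b (v, []) = b" "path_concat (fst b, []) b = b"
  by (auto simp: path_concat_def)

lemma path_deg_0_iff: "path_deg b = 0 \<longleftrightarrow> b = (fst b, [])"
  by (auto simp: path_deg_def prod_eq_iff)

context path_algebra_quotient
begin

abbreviation PA :: "(('v, 'e) path \<Rightarrow>\<^sub>0 'k) ring" where
  "PA \<equiv> path_algebra Q"

lemma ring_PA: "ring PA"
  by (rule ring_path_algebra) unfold_locales

lemma in_PA: "p \<in> carrier PA \<longleftrightarrow> Poly_Mapping.keys p \<subseteq> paths Q"
  by (simp add: path_algebra_def)

lemma psi_closed: "Poly_Mapping.keys p \<subseteq> paths Q \<Longrightarrow> psi p \<in> carrier A"
  using ring_hom_closed[OF psi_hom, of p] by (simp add: in_PA)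

lemma psi_mult:
  "Poly_Mapping.keys p \<subseteq> paths Q \<Longrightarrow> Poly_Mapping.keys q \<subseteq> paths Q
    \<Longrightarrow> psi (path_mult Q p q) = psi p \<otimes> psi q"
  using ring_hom_mult[OF psi_hom, of p q] by (simp add: path_algebra_def)

lemma psi_plus:
  "Poly_Mapping.keys p \<subseteq> paths Q \<Longrightarrow> Poly_Mapping.keys q \<subseteq> paths Q
    \<Longrightarrow> psi (p + q) = psi p \<oplus> psi q"
  by (rule psi_add) (simp_all add: in_PA)

lemma psi_zero [simp]: "psi 0 = \<zero>"
  using ring_hom_zero[OF psi_hom ring_PA alg.ring_axioms] by (simp add: path_algebra_def)

lemma psi_one: "psi (path_scalar Q 1) = \<one>"
  using ring_hom_one[OF psi_hom] by (simp add: path_algebra_def)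

lemma psi_sum:
  assumes "\<And>i. i \<in> I \<Longrightarrow> Poly_Mapping.keys (f i) \<subseteq> paths Q"
  shows "psi (sum f I) = (\<Oplus>i\<in>I. psi (f i))"
  using assms
proof (induction I rule: infinite_finite_induct)
  case (insert x F)
  then show ?case
    using keys_sum_subset[of F f "paths Q"]
    by (subst alg.finsum_insert) (auto simp: psi_plus psi_closed)
qed auto

lemma path_scalar_keys: "Poly_Mapping.keys (path_scalar Q (k::'k)) \<subseteq> paths Q"
  unfolding path_scalar_def
  by (rule keys_sum_subset) (auto simp: trivial_path_iff lookup_single in_keys_iff when_def split: if_splits)

lemma path_scalar_mult:
  assumes "Poly_Mapping.keys p \<subseteq> paths Q"
  shows "path_mult Q (path_scalar Q k) p = scale k p" "path_mult Q p (path_scalar Q k) = scale k p"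
proof -
  have "path_mult Q (path_scalar Q k) (Poly_Mapping.single b l) = Poly_Mapping.single b (k * l)"
    if "b \<in> paths Q" for b and l
  proof -
    have "fst b \<in> verts Q" using that by (auto simp: paths_def)
    then show ?thesis
      by (auto simp: path_scalar_def path_mult_sum_left path_mult_single composable_trivial
        path_concat_def sum.delta)
  qed
  then show "path_mult Q (path_scalar Q k) p = scale k p" using assms
    by (subst poly_eq[of p], subst scale_eq_sum) (auto simp: path_mult_sum_right intro!: sum.cong)
  have "path_mult Q (Poly_Mapping.single b l) (path_scalar Q k) = Poly_Mapping.single b (k * l)"
    if "b \<in> paths Q" for b and l
  proof -
    have "path_end Q b \<in> verts Q" using that by (auto simp: paths_def path_end_def)
    then show ?thesis
      by (auto simp: path_scalar_def path_mult_sum_right path_mult_single composable_trivial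
        path_concat_def sum.delta mult.commute)
  qed
  then show "path_mult Q p (path_scalar Q k) = scale k p" using assms
    by (subst poly_eq[of p], subst scale_eq_sum) (auto simp: path_mult_sum_left intro!: sum.cong)
qed

lemma scalar_closed [simp]: "scalar k \<in> carrier A"
  unfolding scalar_def by (intro psi_closed path_scalar_keys)

lemma psi_scale:
  assumes "Poly_Mapping.keys p \<subseteq> paths Q"
  shows "psi (scale k p) = scalar k \<otimes> psi p" "psi (scale k p) = psi p \<otimes> scalar k"
  using psi_mult[OF path_scalar_keys assms, of k] psi_mult[OF assms path_scalar_keys, of k]
  by (simp_all add: path_scalar_mult[OF assms] scalar_def)

lemma scalar_central:
  assumes "a \<in> carrier A" shows "scalar k \<otimes> a = a \<otimes> scalar k"
proof -
  obtain p where "Poly_Mapping.keys p \<subseteq> paths Q" "a = psi p"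
    using assms psi_surj in_PA by (metis imageE)
  then show ?thesis using psi_scale[of p k] by simp
qed

lemma path_scalar_add: "path_scalar Q (k + l) = path_scalar Q k + path_scalar Q (l::'k)"
  by (simp add: path_scalar_def single_add sum.distrib)

lemma path_scalar_scale: "path_scalar Q (k * l) = scale k (path_scalar Q (l::'k))"
  by (rule poly_mapping_eqI)
    (auto simp: path_scalar_def lookup_sum lookup_single when_def sum_distrib_left intro!: sum.cong)

lemma scalar_add: "scalar (k + l) = scalar k \<oplus> scalar l"
  by (simp add: scalar_def path_scalar_add psi_plus path_scalar_keys)

lemma scalar_mult: "scalar (k * l) = scalar k \<otimes> scalar l"
  unfolding scalar_def path_scalar_scale by (simp add: psi_scale path_scalar_keys scalar_def)

lemma scalar_zero [simp]: "scalar 0 = \<zero>"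
  by (simp add: scalar_def path_scalar_def)

lemma scalar_one [simp]: "scalar 1 = \<one>"
  by (simp add: scalar_def psi_one)

lemma single_keys_paths: "b \<in> paths Q \<Longrightarrow> Poly_Mapping.keys (Poly_Mapping.single b (k::'k)) \<subseteq> paths Q"
  by (auto simp: in_keys_iff lookup_single when_def split: if_splits)

lemma psi_single_closed [simp]: "b \<in> paths Q \<Longrightarrow> psi (Poly_Mapping.single b k) \<in> carrier A"
  by (intro psi_closed single_keys_paths)

lemma psi_single:
  assumes "b \<in> paths Q"
  shows "psi (Poly_Mapping.single b k) = path_image b \<otimes> scalar k"
  using psi_scale(2)[OF single_keys_paths[OF assms], of k 1] by (simp add: scale_single path_image_def)

lemma path_image_closed [simp]: "b \<in> paths Q \<Longrightarrow> path_image b \<in> carrier A"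
  by (simp add: path_image_def)

lemma path_image_mult:
  assumes "b \<in> paths Q" "c \<in> paths Q"
  shows "path_image b \<otimes> path_image c
    = (if composable Q b c then path_image (path_concat b c) else \<zero>)"
  unfolding path_image_def
  by (subst psi_mult[symmetric]) (auto simp: path_mult_single single_keys_paths assms)

lemma one_eq_sum: "\<one> = (\<Oplus>v\<in>verts Q. path_image (v, []))"
  using psi_sum[of "verts Q" "\<lambda>v. Poly_Mapping.single (v, []) 1"]
  by (simp add: psi_one[symmetric] path_scalar_def single_keys_paths trivial_path_iff path_image_def)

lemma std_mon_paths: "std_mon \<subseteq> paths Q"
  by (auto simp: std_mon_def)

lemma path_image_inj: "inj_on path_image std_mon"
proof
  fix b c assume "b \<in> std_mon" "c \<in> std_mon" "path_image b = path_image c"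
  then have "Poly_Mapping.single b (1::'k) = Poly_Mapping.single c 1"
    by (intro std_unique) (auto simp: path_image_def in_keys_iff lookup_single when_def split: if_splits)
  then have "Poly_Mapping.lookup (Poly_Mapping.single b (1::'k)) b = Poly_Mapping.lookup (Poly_Mapping.single c 1) b"
    by simp
  then show "b = c" by (simp add: lookup_single when_def split: if_splits)
qed

lemma lam_path_image [simp]: "b \<in> std_mon \<Longrightarrow> lam (path_image b) = b"
  unfolding lam_def by (rule the_inv_into_f_f[OF path_image_inj])

lemma lam_monomial:
  assumes "b \<in> monomials" shows "lam b \<in> std_mon" "lam b \<in> paths Q" "path_image (lam b) = b"
  using assms std_mon_paths by (auto simp: monomials_def)

lemma monomials_carrier: "b \<in> monomials \<Longrightarrow> b \<in> carrier A"
  using std_mon_paths by (auto simp: monomials_def)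

end

context path_algebra_quotient_basis
begin

lemma normal_form_ex1:
  assumes "a \<in> carrier A"
  shows "\<exists>!p. Poly_Mapping.keys p \<subseteq> std_mon \<and> psi p = a"
  using monomials_span[OF assms] std_unique by blast

lemma normal_form:
  assumes "a \<in> carrier A"
  shows "Poly_Mapping.keys (normal_form a) \<subseteq> std_mon" "psi (normal_form a) = a"
  using theI'[OF normal_form_ex1[OF assms]] unfolding normal_form_def by auto

lemma normal_form_eqI:
  assumes "Poly_Mapping.keys p \<subseteq> std_mon" "psi p = a" shows "normal_form a = p"
proof -
  have "a \<in> carrier A" using assms psi_closed std_mon_paths by blast
  then show ?thesis using assms normal_form std_unique by metis
qed

lemma normal_form_keys_paths: "a \<in> carrier A \<Longrightarrow> Poly_Mapping.keys (normal_form a) \<subseteq> paths Q"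
  using normal_form(1) std_mon_paths by blast

lemma normal_form_add:
  assumes "a \<in> carrier A" "b \<in> carrier A"
  shows "normal_form (a \<oplus> b) = normal_form a + normal_form b"
  using assms Poly_Mapping.keys_add[of "normal_form a" "normal_form b"]
  by (intro normal_form_eqI) (auto simp: psi_plus normal_form normal_form_keys_paths dest: subsetD[OF normal_form(1)])

lemma normal_form_scalar:
  assumes "a \<in> carrier A"
  shows "normal_form (a \<otimes> scalar k) = scale k (normal_form a)"
  using subset_trans[OF keys_scale normal_form(1)[OF assms]]
  by (intro normal_form_eqI) (simp_all add: psi_scale(2) normal_form normal_form_keys_paths assms)

lemma normal_form_zero [simp]: "normal_form \<zero> = 0"
  by (rule normal_form_eqI) auto

lemma normal_form_sum:
  assumes "\<And>i. i \<in> I \<Longrightarrow> f i \<in> carrier A"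
  shows "normal_form (\<Oplus>i\<in>I. f i) = (\<Sum>i\<in>I. normal_form (f i))"
  using assms
proof (induction I rule: infinite_finite_induct)
  case (insert x F)
  then show ?case
    by (subst alg.finsum_insert) (auto simp: normal_form_add)
qed auto

lemma normal_form_monomial:
  "b \<in> monomials \<Longrightarrow> normal_form b = Poly_Mapping.single (lam b) 1"
  using lam_monomial[of b]
  by (intro normal_form_eqI) (auto simp: path_image_def)

lemma carrier_sum:
  assumes "a \<in> carrier A"
  shows "a = (\<Oplus>p\<in>Poly_Mapping.keys (normal_form a). path_image p \<otimes> scalar (Poly_Mapping.lookup (normal_form a) p))"
proof -
  let ?N = "normal_form a"
  have "a = psi ?N" using normal_form[OF assms] by simp
  also have "\<dots> = psi (\<Sum>p\<in>Poly_Mapping.keys ?N. Poly_Mapping.single p (Poly_Mapping.lookup ?N p))"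
    using poly_eq[of ?N] by simp
  also have "\<dots> = (\<Oplus>p\<in>Poly_Mapping.keys ?N. psi (Poly_Mapping.single p (Poly_Mapping.lookup ?N p)))"
    using normal_form_keys_paths[OF assms] single_keys_paths by (intro psi_sum) blast
  also have "\<dots> = (\<Oplus>p\<in>Poly_Mapping.keys ?N. path_image p \<otimes> scalar (Poly_Mapping.lookup ?N p))"
    using normal_form_keys_paths[OF assms] by (intro alg.finsum_cong') (auto simp: psi_single)
  finally show ?thesis .
qed

lemma support_iff:
  assumes "a \<in> carrier A"
  shows "b \<in> support a \<longleftrightarrow> b \<in> monomials \<and> Poly_Mapping.lookup (normal_form a) (lam b) \<noteq> 0"
proof
  assume "b \<in> support a"
  then obtain p where p: "p \<in> Poly_Mapping.keys (normal_form a)" "b = path_image p"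
    by (auto simp: support_def)
  then have "p \<in> std_mon" using normal_form(1)[OF assms] by blast
  then show "b \<in> monomials \<and> Poly_Mapping.lookup (normal_form a) (lam b) \<noteq> 0"
    using p by (simp add: monomials_def in_keys_iff)
next
  assume b: "b \<in> monomials \<and> Poly_Mapping.lookup (normal_form a) (lam b) \<noteq> 0"
  then have "path_image (lam b) \<in> support a"
    unfolding support_def by (intro imageI) (simp add: in_keys_iff)
  then show "b \<in> support a" using lam_monomial(3) b by simp
qed

lemma finite_support: "finite (support a)"
  by (simp add: support_def)

text \<open>
  Taking normal forms is linear, so only the finitely many standard monomials that occur in the
  normal forms of a spanning family occur in normal forms at all; and a standard monomial is its
  own normal form.
\<close>

lemma finite_std_mon:
  assumes "alg.finite_dimension (range scalar) (carrier A)"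
  shows "finite std_mon"
proof -
  obtain n where n: "alg.dimension n (range scalar) (carrier A)"
    using assms by (auto simp: alg.finite_dimension_def)
  have fin: "V \<subseteq> carrier A \<and> (\<exists>T. finite T \<and> (\<forall>a\<in>V. Poly_Mapping.keys (normal_form a) \<subseteq> T))"
    if "alg.dimension n (range scalar) V" for n V
    using that
  proof (induction n "range scalar" V rule: alg.dimension.induct)
    case zero_dim
    then show ?case by auto
  next
    case (Suc_dim v V n)
    then obtain T where T: "finite T" "\<forall>a\<in>V. Poly_Mapping.keys (normal_form a) \<subseteq> T" and V: "V \<subseteq> carrier A" by auto
    have "Poly_Mapping.keys (normal_form a) \<subseteq> Poly_Mapping.keys (normal_form v) \<union> T \<and> a \<in> carrier A"
      if a: "a \<in> alg.line_extension (range scalar) v V" for a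
    proof -
      obtain k u where u: "u \<in> V" "a = scalar k \<otimes> v \<oplus> u"
        using a by (auto simp: alg.line_extension_mem_iff)
      then have nf: "normal_form a = scale k (normal_form v) + normal_form u"
        using Suc_dim(1) V by (simp add: scalar_central normal_form_add normal_form_scalar subsetD)
      have "Poly_Mapping.keys (normal_form u) \<subseteq> T" using T(2) u(1) by blast
      then have "Poly_Mapping.keys (normal_form a) \<subseteq> Poly_Mapping.keys (normal_form v) \<union> T"
        using Poly_Mapping.keys_add[of "scale k (normal_form v)" "normal_form u"]
          keys_scale[of k "normal_form v"] unfolding nf by blast
      then show ?thesis using u V Suc_dim(1) by auto
    qed
    then show ?case
      using T(1) by (intro conjI exI[of _ "Poly_Mapping.keys (normal_form v) \<union> T"]) auto
  qed
  then obtain T where T: "finite T" "\<forall>a\<in>carrier A. Poly_Mapping.keys (normal_form a) \<subseteq> T"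
    using fin[OF n] by auto
  have "b \<in> T" if "b \<in> std_mon" for b
  proof -
    have "b \<in> Poly_Mapping.keys (normal_form (path_image b))"
      using that by (simp add: normal_form_monomial monomials_def)
    moreover have "path_image b \<in> carrier A" using that std_mon_paths by auto
    ultimately show ?thesis using T(2) by auto
  qed
  then show ?thesis by (intro finite_subset[OF _ T(1)] subsetI)
qed

end

section \<open>The free right module\<close>

lemma (in ring) abelian_group_free_right_module: "abelian_group (free_right_module R r)"
proof (rule abelian_groupI)
  let ?F = "free_right_module R r"
  note simps = free_right_module_def fun_eq_iff PiE_iff extensional_def
  fix x assume x: "x \<in> carrier ?F"
  then show "\<exists>y\<in>carrier ?F. y \<oplus>\<^bsub>?F\<^esub> x = \<zero>\<^bsub>?F\<^esub>"
    by (intro bexI[of _ "\<lambda>i\<in>{..<r}. \<ominus> x i"]) (auto simp: simps l_neg)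
  show "\<zero>\<^bsub>?F\<^esub> \<oplus>\<^bsub>?F\<^esub> x = x" using x by (auto simp: simps)
  fix y assume y: "y \<in> carrier ?F"
  show "x \<oplus>\<^bsub>?F\<^esub> y \<in> carrier ?F" using x y by (auto simp: simps)
  show "x \<oplus>\<^bsub>?F\<^esub> y = y \<oplus>\<^bsub>?F\<^esub> x" using x y by (auto simp: simps a_comm)
  fix z assume z: "z \<in> carrier ?F"
  show "x \<oplus>\<^bsub>?F\<^esub> y \<oplus>\<^bsub>?F\<^esub> z = x \<oplus>\<^bsub>?F\<^esub> (y \<oplus>\<^bsub>?F\<^esub> z)"
    using x y z by (auto simp: simps a_assoc)
qed (auto simp: free_right_module_def)

context signature_setting
begin

interpretation F: abelian_group F
  by (rule alg.abelian_group_free_right_module)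

lemma carrier_F: "carrier F = {..<r} \<rightarrow>\<^sub>E carrier A"
  by (simp add: free_right_module_def)

lemma F_app_closed: "x \<in> carrier F \<Longrightarrow> i < r \<Longrightarrow> x i \<in> carrier A"
  by (auto simp: carrier_F)

lemma F_eqI: "x \<in> carrier F \<Longrightarrow> y \<in> carrier F \<Longrightarrow> (\<And>i. i < r \<Longrightarrow> x i = y i) \<Longrightarrow> x = y"
  unfolding carrier_F by (rule PiE_ext) auto

lemma F_app [simp]:
  assumes "i < r"
  shows "(x \<oplus>\<^bsub>F\<^esub> y) i = x i \<oplus> y i" "(a \<odot>\<^bsub>F\<^esub> x) i = x i \<otimes> a" "\<zero>\<^bsub>F\<^esub> i = \<zero>"
  using assms by (auto simp: free_right_module_def)

lemma smult_closed [simp]: "a \<in> carrier A \<Longrightarrow> x \<in> carrier F \<Longrightarrow> a \<odot>\<^bsub>F\<^esub> x \<in> carrier F"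
  by (auto simp: free_right_module_def)

lemma smult_smult:
  "a \<in> carrier A \<Longrightarrow> b \<in> carrier A \<Longrightarrow> x \<in> carrier F \<Longrightarrow> a \<odot>\<^bsub>F\<^esub> (b \<odot>\<^bsub>F\<^esub> x) = (b \<otimes> a) \<odot>\<^bsub>F\<^esub> x"
  by (rule F_eqI) (auto simp: F_app_closed alg.m_assoc)

lemma smult_add_right:
  "a \<in> carrier A \<Longrightarrow> x \<in> carrier F \<Longrightarrow> y \<in> carrier F
    \<Longrightarrow> a \<odot>\<^bsub>F\<^esub> (x \<oplus>\<^bsub>F\<^esub> y) = a \<odot>\<^bsub>F\<^esub> x \<oplus>\<^bsub>F\<^esub> a \<odot>\<^bsub>F\<^esub> y"
  by (rule F_eqI) (auto simp: F_app_closed alg.l_distr)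

lemma smult_add_left:
  "a \<in> carrier A \<Longrightarrow> b \<in> carrier A \<Longrightarrow> x \<in> carrier F
    \<Longrightarrow> (a \<oplus> b) \<odot>\<^bsub>F\<^esub> x = a \<odot>\<^bsub>F\<^esub> x \<oplus>\<^bsub>F\<^esub> b \<odot>\<^bsub>F\<^esub> x"
  by (rule F_eqI) (auto simp: F_app_closed alg.r_distr)

lemma smult_zero_left [simp]: "x \<in> carrier F \<Longrightarrow> \<zero> \<odot>\<^bsub>F\<^esub> x = \<zero>\<^bsub>F\<^esub>"
  by (rule F_eqI) (auto simp: F_app_closed)

lemma smult_zero_right [simp]: "a \<in> carrier A \<Longrightarrow> a \<odot>\<^bsub>F\<^esub> \<zero>\<^bsub>F\<^esub> = \<zero>\<^bsub>F\<^esub>"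
  by (rule F_eqI) auto

lemma smult_one_left [simp]: "x \<in> carrier F \<Longrightarrow> \<one> \<odot>\<^bsub>F\<^esub> x = x"
  by (rule F_eqI) (auto simp: F_app_closed)

lemma smult_finsum:
  assumes "a \<in> carrier A" "\<And>i. i \<in> I \<Longrightarrow> f i \<in> carrier F"
  shows "a \<odot>\<^bsub>F\<^esub> (\<Oplus>\<^bsub>F\<^esub>i\<in>I. f i) = (\<Oplus>\<^bsub>F\<^esub>i\<in>I. a \<odot>\<^bsub>F\<^esub> f i)"
  using assms(2)
proof (induction I rule: infinite_finite_induct)
  case (insert i I)
  then show ?case
    using assms(1) by (subst (1 2) F.finsum_insert) (auto simp: smult_add_right)
qed (simp_all add: assms(1))

lemma smult_finsum_left:
  assumes "x \<in> carrier F" "\<And>i. i \<in> I \<Longrightarrow> f i \<in> carrier A"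
  shows "(\<Oplus>i\<in>I. f i) \<odot>\<^bsub>F\<^esub> x = (\<Oplus>\<^bsub>F\<^esub>i\<in>I. f i \<odot>\<^bsub>F\<^esub> x)"
  using assms(2)
proof (induction I rule: infinite_finite_induct)
  case (insert i I)
  then show ?case
    using assms(1) by (simp add: smult_add_left Pi_def)
qed (simp_all add: assms(1))

text \<open>
  Differences are written below as \<open>x \<oplus> scalar k \<odot> y\<close>, which keeps them within reach of the closure of
  submodules under sums and under the action.
\<close>

lemma scalar_minus_one_cancel:
  "x \<in> carrier F \<Longrightarrow> x \<oplus>\<^bsub>F\<^esub> scalar (-1) \<odot>\<^bsub>F\<^esub> x = \<zero>\<^bsub>F\<^esub>"
  using smult_add_left[of "scalar 1" "scalar (-1)" x] scalar_add[of 1 "-1", symmetric] by simp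

lemma minus_F: "x \<in> carrier F \<Longrightarrow> \<ominus>\<^bsub>F\<^esub> x = scalar (-1) \<odot>\<^bsub>F\<^esub> x"
  using scalar_minus_one_cancel[of x] F.minus_equality[of "scalar (-1) \<odot>\<^bsub>F\<^esub> x" x]
  by (simp add: F.a_comm)


section \<open>Submodules\<close>

lemma submoduleI:
  assumes "N \<subseteq> carrier F" "\<zero>\<^bsub>F\<^esub> \<in> N"
    and "\<And>x y. x \<in> N \<Longrightarrow> y \<in> N \<Longrightarrow> x \<oplus>\<^bsub>F\<^esub> y \<in> N"
    and "\<And>a x. a \<in> carrier A \<Longrightarrow> x \<in> N \<Longrightarrow> a \<odot>\<^bsub>F\<^esub> x \<in> N"
  shows "submodule N A F"
proof (intro submodule.intro subgroup.intro)
  fix x assume x: "x \<in> N"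
  have "inv\<^bsub>add_monoid F\<^esub> x = \<ominus>\<^bsub>F\<^esub> x" by (simp add: a_inv_def)
  also have "\<dots> = scalar (-1) \<odot>\<^bsub>F\<^esub> x" using x assms(1) by (intro minus_F) auto
  finally show "inv\<^bsub>add_monoid F\<^esub> x \<in> N" using assms(4)[OF scalar_closed x] by simp
qed (use assms in \<open>auto simp: submodule_axioms_def\<close>)

lemma submoduleD:
  assumes "submodule N A F"
  shows "N \<subseteq> carrier F" "\<zero>\<^bsub>F\<^esub> \<in> N"
    and "x \<in> N \<Longrightarrow> y \<in> N \<Longrightarrow> x \<oplus>\<^bsub>F\<^esub> y \<in> N"
    and "a \<in> carrier A \<Longrightarrow> x \<in> N \<Longrightarrow> a \<odot>\<^bsub>F\<^esub> x \<in> N"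
proof -
  interpret submodule N A F by fact
  show "N \<subseteq> carrier F" "\<zero>\<^bsub>F\<^esub> \<in> N"
    and "x \<in> N \<Longrightarrow> y \<in> N \<Longrightarrow> x \<oplus>\<^bsub>F\<^esub> y \<in> N"
    and "a \<in> carrier A \<Longrightarrow> x \<in> N \<Longrightarrow> a \<odot>\<^bsub>F\<^esub> x \<in> N"
    using subset one_closed m_closed[of x y] smult_closed[of a x] by auto
qed

lemma finsum_in_additive:
  assumes "N \<subseteq> carrier F" "\<zero>\<^bsub>F\<^esub> \<in> N" "\<And>x y. x \<in> N \<Longrightarrow> y \<in> N \<Longrightarrow> x \<oplus>\<^bsub>F\<^esub> y \<in> N"
    and "\<And>i. i \<in> I \<Longrightarrow> f i \<in> N"
  shows "(\<Oplus>\<^bsub>F\<^esub>i\<in>I. f i) \<in> N"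
  using assms(4)
proof (induction I rule: infinite_finite_induct)
  case (insert i I)
  then show ?case
    using assms(1) by (subst F.finsum_insert) (auto intro: assms(3))
qed (simp_all add: assms(2))

lemma M_carrier: "M \<subseteq> carrier F"
  by (rule submoduleD[OF submodule_M])

lemma gen_closed [simp]: "i < m \<Longrightarrow> gen i \<in> carrier F"
  using gen_in_M M_carrier by auto

lemma coset_eq_iff:
  assumes "submodule N A F" "x \<in> carrier F" "y \<in> carrier F"
  shows "N +>\<^bsub>F\<^esub> x = N +>\<^bsub>F\<^esub> y \<longleftrightarrow> x \<oplus>\<^bsub>F\<^esub> scalar (-1) \<odot>\<^bsub>F\<^esub> y \<in> N"
proof -
  interpret N: abelian_subgroup N F
    by (rule abelian_subgroupI3)
      (auto intro: additive_subgroup.intro submodule.axioms(1)[OF assms(1)] F.abelian_group_axioms)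
  have "N +>\<^bsub>F\<^esub> x = N +>\<^bsub>F\<^esub> y \<longleftrightarrow> x \<in> N +>\<^bsub>F\<^esub> y"
    using N.a_rcos_self[OF assms(2)] N.a_repr_independence'[OF _ assms(3)] by auto
  also have "\<dots> \<longleftrightarrow> x \<oplus>\<^bsub>F\<^esub> \<ominus>\<^bsub>F\<^esub> y \<in> N"
    by (rule N.a_rcos_module[OF assms(3,2)])
  finally show ?thesis by (simp add: minus_F assms)
qed


section \<open>Leading monomials in the free module\<close>

text \<open>
  The coefficient of the monomial \<open>u\<close> in \<open>x\<close>. It has this meaning only for \<open>u \<in> module_monomials r\<close>,
  because \<open>lam\<close> inverts \<open>path_image\<close> only on standard monomials.
\<close>

definition coef :: "(nat \<Rightarrow> 'a) \<Rightarrow> nat \<times> 'a \<Rightarrow> 'k" where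
  "coef x u = Poly_Mapping.lookup (normal_form (x (fst u))) (lam (snd u))"

lemma coef_add:
  "x \<in> carrier F \<Longrightarrow> y \<in> carrier F \<Longrightarrow> fst u < r \<Longrightarrow> coef (x \<oplus>\<^bsub>F\<^esub> y) u = coef x u + coef y u"
  by (simp add: coef_def normal_form_add F_app_closed lookup_add)

lemma coef_scalar:
  "x \<in> carrier F \<Longrightarrow> fst u < r \<Longrightarrow> coef (scalar k \<odot>\<^bsub>F\<^esub> x) u = k * coef x u"
  by (simp add: coef_def normal_form_scalar F_app_closed)

lemma order_F: "strict_total_order_on (module_monomials r) lt_F"
  using module_ordering by (simp add: module_ordering_def)

lemma F_support_eq:
  assumes "x \<in> carrier F"
  shows "{(i, b). i < r \<and> b \<in> support (x i)} = {u \<in> module_monomials r. coef x u \<noteq> 0}"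
  using assms by (auto simp: support_iff F_app_closed coef_def module_monomials_def)

lemma finite_F_support:
  assumes "x \<in> carrier F" shows "finite {u \<in> module_monomials r. coef x u \<noteq> 0}"
proof -
  have "{(i, b). i < r \<and> b \<in> support (x i)} = (SIGMA i:{..<r}. support (x i))" by auto
  also have "finite \<dots>" by (intro finite_SigmaI finite_lessThan finite_support)
  finally show ?thesis unfolding F_support_eq[OF assms] .
qed

lemma F_nonzero_coef:
  assumes "x \<in> carrier F" "x \<noteq> \<zero>\<^bsub>F\<^esub>"
  shows "\<exists>u\<in>module_monomials r. coef x u \<noteq> 0"
proof (rule ccontr)
  assume c: "\<not> ?thesis"
  have "x i = \<zero>" if i: "i < r" for i
  proof -
    have "support (x i) = {}"
    proof (rule ccontr)
      assume "support (x i) \<noteq> {}"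
      then obtain b where "b \<in> support (x i)" by blast
      then have "(i, b) \<in> {u \<in> module_monomials r. coef x u \<noteq> 0}"
        using i F_support_eq[OF assms(1)] by blast
      then show False using c by blast
    qed
    then have "normal_form (x i) = 0" by (simp add: support_def)
    then show "x i = \<zero>" using normal_form(2)[OF F_app_closed[OF assms(1) i]] by simp
  qed
  then show False using assms F_eqI[OF assms(1) F.zero_closed] by simp
qed

lemma lm_F:
  assumes "x \<in> carrier F" "x \<noteq> \<zero>\<^bsub>F\<^esub>"
  shows "lm_F x \<in> module_monomials r" "coef x (lm_F x) \<noteq> 0"
    and "u \<in> module_monomials r \<Longrightarrow> coef x u \<noteq> 0 \<Longrightarrow> u = lm_F x \<or> lt_F u (lm_F x)"
proof -
  let ?K = "{u \<in> module_monomials r. coef x u \<noteq> 0}"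
  have lm: "lm_F x = greatest_wrt lt_F ?K" unfolding lm_F_def F_support_eq[OF assms(1)] ..
  have K: "?K \<noteq> {}" "?K \<subseteq> module_monomials r" using F_nonzero_coef[OF assms] by auto
  note g = greatest_wrt[OF order_F finite_F_support[OF assms(1)] K]
  show "lm_F x \<in> module_monomials r" "coef x (lm_F x) \<noteq> 0" using g(1) lm by auto
  show "u \<in> module_monomials r \<Longrightarrow> coef x u \<noteq> 0 \<Longrightarrow> u = lm_F x \<or> lt_F u (lm_F x)"
    using g(2)[of u] lm by auto
qed

lemma coef_zero: "fst u < r \<Longrightarrow> coef \<zero>\<^bsub>F\<^esub> u = 0"
  by (simp add: coef_def)

lemma module_monomials_fst: "u \<in> module_monomials r \<Longrightarrow> fst u < r"
  by (auto simp: module_monomials_def)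

lemma lm_F_eqI:
  assumes "x \<in> carrier F" "u \<in> module_monomials r" "coef x u \<noteq> 0"
    and "\<And>w. w \<in> module_monomials r \<Longrightarrow> coef x w \<noteq> 0 \<Longrightarrow> w = u \<or> lt_F w u"
  shows "lm_F x = u" "x \<noteq> \<zero>\<^bsub>F\<^esub>"
proof -
  show "x \<noteq> \<zero>\<^bsub>F\<^esub>" using assms(2,3) coef_zero[of u] module_monomials_fst[of u] by auto
  show "lm_F x = u" unfolding lm_F_def F_support_eq[OF assms(1)]
    using assms by (intro greatest_wrt_eqI[OF order_F]) auto
qed

lemma lm_F_cancel:
  assumes "x \<in> carrier F" "x \<noteq> \<zero>\<^bsub>F\<^esub>" "y \<in> carrier F" "y \<noteq> \<zero>\<^bsub>F\<^esub>" "lm_F x = lm_F y"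
  obtains k where "x \<oplus>\<^bsub>F\<^esub> scalar k \<odot>\<^bsub>F\<^esub> y = \<zero>\<^bsub>F\<^esub> \<or> lt_F (lm_F (x \<oplus>\<^bsub>F\<^esub> scalar k \<odot>\<^bsub>F\<^esub> y)) (lm_F x)"
proof -
  define u where "u = lm_F x"
  define k where "k = - (coef x u / coef y u)"
  define z where "z = x \<oplus>\<^bsub>F\<^esub> scalar k \<odot>\<^bsub>F\<^esub> y"
  have zc: "z \<in> carrier F" by (simp add: z_def assms)
  have co: "coef z w = coef x w + k * coef y w" if "w \<in> module_monomials r" for w
    using that by (simp add: z_def coef_add coef_scalar assms module_monomials_fst)
  have u: "u \<in> module_monomials r" "coef y u \<noteq> 0" using lm_F[OF assms(1,2)] lm_F[OF assms(3,4)] assms(5) by (auto simp: u_def)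
  then have zu: "coef z u = 0" using co[of u] by (simp add: k_def)
  have "lt_F (lm_F z) u" if "z \<noteq> \<zero>\<^bsub>F\<^esub>"
  proof -
    note l = lm_F[OF zc that]
    have "coef x (lm_F z) \<noteq> 0 \<or> coef y (lm_F z) \<noteq> 0" using l(2) co[OF l(1)] by auto
    then have "lm_F z = u \<or> lt_F (lm_F z) u"
      using lm_F(3)[OF assms(1,2) l(1)] lm_F(3)[OF assms(3,4) l(1)] assms(5) u_def by auto
    then show ?thesis using l(2) zu by auto
  qed
  then show ?thesis using that[of k] by (auto simp: z_def u_def)
qed

lemma lm_F_add_smaller:
  assumes "x \<in> carrier F" "x \<noteq> \<zero>\<^bsub>F\<^esub>" "y \<in> carrier F" "y \<noteq> \<zero>\<^bsub>F\<^esub>" "lt_F (lm_F y) (lm_F x)"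
  shows "lm_F (x \<oplus>\<^bsub>F\<^esub> scalar k \<odot>\<^bsub>F\<^esub> y) = lm_F x" "x \<oplus>\<^bsub>F\<^esub> scalar k \<odot>\<^bsub>F\<^esub> y \<noteq> \<zero>\<^bsub>F\<^esub>"
proof -
  let ?z = "x \<oplus>\<^bsub>F\<^esub> scalar k \<odot>\<^bsub>F\<^esub> y"
  note lx = lm_F[OF assms(1,2)] and ly = lm_F[OF assms(3,4)]
  note ord = strict_total_order_onD[OF order_F]
  have co: "coef ?z w = coef x w + k * coef y w" if "w \<in> module_monomials r" for w
    using that by (simp add: coef_add coef_scalar assms module_monomials_fst)
  have below: "w = lm_F x \<or> lt_F w (lm_F x)" if w: "w \<in> module_monomials r" "coef ?z w \<noteq> 0" for w
  proof (cases "coef x w = 0")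
    case True
    then have "coef y w \<noteq> 0" using co[OF w(1)] w(2) by auto
    then show ?thesis using ly(3)[OF w(1)] assms(5) ord(4)[OF w(1) ly(1) lx(1)] by auto
  qed (use lx(3) w in auto)
  have "coef y (lm_F x) = 0"
    using ly(3)[OF lx(1)] assms(5) ord(1,2)[OF lx(1) ly(1)] by metis
  then have "coef ?z (lm_F x) \<noteq> 0" using co[OF lx(1)] lx(2) by simp
  then show "lm_F ?z = lm_F x" "?z \<noteq> \<zero>\<^bsub>F\<^esub>"
    using lm_F_eqI[of ?z "lm_F x"] below lx(1) assms by auto
qed

lemma lookup_normal_form_mult:
  assumes "a \<in> carrier A" "c \<in> carrier A"
  shows "Poly_Mapping.lookup (normal_form (a \<otimes> c)) q
    = (\<Sum>p\<in>Poly_Mapping.keys (normal_form a).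
        Poly_Mapping.lookup (normal_form a) p * Poly_Mapping.lookup (normal_form (path_image p \<otimes> c)) q)"
proof -
  let ?N = "normal_form a"
  have pc: "p \<in> Poly_Mapping.keys ?N \<Longrightarrow> p \<in> paths Q" for p
    using normal_form_keys_paths[OF assms(1)] by auto
  have "a \<otimes> c = (\<Oplus>p\<in>Poly_Mapping.keys ?N. path_image p \<otimes> scalar (Poly_Mapping.lookup ?N p)) \<otimes> c"
    using carrier_sum[OF assms(1)] by simp
  also have "\<dots> = (\<Oplus>p\<in>Poly_Mapping.keys ?N. path_image p \<otimes> scalar (Poly_Mapping.lookup ?N p) \<otimes> c)"
    using assms pc by (intro alg.finsum_ldistr) auto
  also have "\<dots> = (\<Oplus>p\<in>Poly_Mapping.keys ?N. (path_image p \<otimes> c) \<otimes> scalar (Poly_Mapping.lookup ?N p))"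
    using assms pc by (intro alg.finsum_cong') (auto simp: alg.m_assoc scalar_central)
  finally show ?thesis
    using assms pc by (simp add: normal_form_sum normal_form_scalar lookup_sum)
qed

lemma lm_alg:
  assumes "a \<in> carrier A" "b \<in> support a"
  shows "lm_alg a \<in> monomials" "b = lm_alg a \<or> lt_alg b (lm_alg a)"
proof -
  have ord: "strict_total_order_on (paths Q) lt"
    using monomial_ordering by (simp add: monomial_ordering_def)
  have alg_ord: "strict_total_order_on monomials lt_alg"
    unfolding lt_alg_def
    by (rule strict_total_order_on_pullback[OF ord])
      (auto intro: inj_on_inverseI[of _ path_image] simp: lam_monomial)
  have sub: "support a \<subseteq> monomials" using support_iff[OF assms(1)] by blast
  have ne: "support a \<noteq> {}" using assms(2) by auto
  note g = greatest_wrt[OF alg_ord finite_support ne sub]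
  show "lm_alg a \<in> monomials" "b = lm_alg a \<or> lt_alg b (lm_alg a)"
    using g(1) g(2)[OF assms(2)] sub by (auto simp: lm_alg_def)
qed

text \<open>
  Compatibility of the module ordering with a small cofactor sends each non-leading monomial of \<open>g\<close> to
  zero or strictly below the product of the leading one with \<open>c\<close>. That product is itself a monomial,
  so it receives a contribution from the leading term only and keeps its non-zero coefficient.
\<close>

lemma lm_F_smult:
  assumes g: "g \<in> carrier F" "g \<noteq> \<zero>\<^bsub>F\<^esub>"
    and c: "small_cofactor (snd (lm_F g)) c" and mon: "snd (lm_F g) \<otimes> c \<in> monomials"
  shows "lm_F (c \<odot>\<^bsub>F\<^esub> g) = (fst (lm_F g), snd (lm_F g) \<otimes> c)" "c \<odot>\<^bsub>F\<^esub> g \<noteq> \<zero>\<^bsub>F\<^esub>"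
proof -
  obtain i b1 where ib: "lm_F g = (i, b1)" by fastforce
  note l = lm_F[OF g]
  have i: "i < r" and b1: "b1 \<in> monomials" using l(1) ib by (auto simp: module_monomials_def)
  have cm: "c \<in> monomials" "small_cofactor b1 c" "b1 \<otimes> c \<in> monomials"
    using c mon ib by (auto simp: small_cofactor_def)
  have cc: "c \<in> carrier A" using cm monomials_carrier by blast
  let ?u = "(i, b1 \<otimes> c)"
  have u: "?u \<in> module_monomials r" using i cm by (auto simp: module_monomials_def)
  \<comment> \<open>The compatibility condition bounds only the leading monomial of \<open>b2 \<otimes> c\<close>; the remaining
    monomials of that product lie below it because \<open>lt_F\<close> refines \<open>lt_alg\<close> in each component.\<close>
  have small: "lt_F (j, q) ?u"
    if b2: "(j, b2) \<in> module_monomials r" "coef g (j, b2) \<noteq> 0" "(j, b2) \<noteq> (i, b1)"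
      and q: "q \<in> support (b2 \<otimes> c)" for j b2 q
  proof -
    have j: "j < r" and b2m: "b2 \<in> monomials" using b2(1) by (auto simp: module_monomials_def)
    have b2c: "b2 \<otimes> c \<in> carrier A" using b2m cc monomials_carrier by auto
    have "b2 \<otimes> c \<noteq> \<zero>" using q by (auto simp: support_def)
    moreover have "lt_F (j, b2) (i, b1)" using l(3)[OF b2(1,2)] b2(3) ib by auto
    ultimately have lt1: "lt_F (j, lm_alg (b2 \<otimes> c)) ?u"
      using module_ordering i j b1 b2m cm unfolding module_ordering_def by blast
    have qm: "q \<in> monomials" using support_iff[OF b2c] q by blast
    note la = lm_alg[OF b2c q]
    have "q = lm_alg (b2 \<otimes> c) \<or> lt_F (j, q) (j, lm_alg (b2 \<otimes> c))"
      using la qm j module_ordering unfolding module_ordering_def by blast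
    then show ?thesis
      using lt1 strict_total_order_onD(4)[OF order_F, of "(j, q)" "(j, lm_alg (b2 \<otimes> c))" ?u] u la(1) qm j
      by (auto simp: module_monomials_def)
  qed
  have co: "coef (c \<odot>\<^bsub>F\<^esub> g) (j, q) = (\<Sum>p\<in>Poly_Mapping.keys (normal_form (g j)).
      coef g (j, path_image p) * Poly_Mapping.lookup (normal_form (path_image p \<otimes> c)) (lam q))"
    if "j < r" for j q
    using that lookup_normal_form_mult[OF F_app_closed[OF g(1) that] cc, of "lam q"]
      normal_form(1)[OF F_app_closed[OF g(1) that]]
    by (auto simp: coef_def intro!: sum.cong)
  have keys: "(j, path_image p) \<in> module_monomials r \<and> coef g (j, path_image p) \<noteq> 0 \<and> p \<in> std_mon"
    if "j < r" "p \<in> Poly_Mapping.keys (normal_form (g j))" for j p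
  proof -
    have "p \<in> std_mon" using normal_form(1)[OF F_app_closed[OF g(1) that(1)]] that(2) by blast
    then show ?thesis using that by (auto simp: module_monomials_def monomials_def coef_def in_keys_iff)
  qed
  have sup: "q \<in> support (path_image p \<otimes> c)"
    if "q \<in> monomials" "p \<in> std_mon" "Poly_Mapping.lookup (normal_form (path_image p \<otimes> c)) (lam q) \<noteq> 0" for p q
    using that cc std_mon_paths by (subst support_iff) auto
  have coef_u: "coef (c \<odot>\<^bsub>F\<^esub> g) ?u = coef g (i, b1)"
  proof -
    let ?N = "normal_form (g i)"
    have "coef g (i, path_image p) * Poly_Mapping.lookup (normal_form (path_image p \<otimes> c)) (lam (b1 \<otimes> c))
      = (if p = lam b1 then coef g (i, b1) else 0)" if p: "p \<in> Poly_Mapping.keys ?N" for p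
    proof (cases "p = lam b1")
      case True
      then show ?thesis
        using lam_monomial(3)[OF b1] normal_form_monomial[OF cm(3)] by (simp add: lookup_single)
    next
      case False
      note k = keys[OF i p]
      have "path_image p \<noteq> b1" using False k by auto
      then have "Poly_Mapping.lookup (normal_form (path_image p \<otimes> c)) (lam (b1 \<otimes> c)) = 0"
        using small[of i "path_image p" "b1 \<otimes> c"] k sup[OF cm(3), of p]
          strict_total_order_onD(1)[OF order_F u u] by auto
      then show ?thesis using False by simp
    qed
    moreover have "lam b1 \<in> Poly_Mapping.keys ?N" using l(2) ib by (simp add: coef_def in_keys_iff)
    ultimately show ?thesis by (simp add: co[OF i] cong: sum.cong)
  qed
  have below: "w = ?u \<or> lt_F w ?u" if w: "w \<in> module_monomials r" "coef (c \<odot>\<^bsub>F\<^esub> g) w \<noteq> 0" for w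
  proof -
    obtain j q where jq: "w = (j, q)" by fastforce
    have j: "j < r" and q: "q \<in> monomials" using w(1) jq by (auto simp: module_monomials_def)
    obtain p where p: "p \<in> Poly_Mapping.keys (normal_form (g j))"
      "coef g (j, path_image p) * Poly_Mapping.lookup (normal_form (path_image p \<otimes> c)) (lam q) \<noteq> 0"
      using w(2)[unfolded jq co[OF j]] by (rule sum.not_neutral_contains_not_neutral)
    note k = keys[OF j p(1)]
    have s: "q \<in> support (path_image p \<otimes> c)" using sup[OF q] k p(2) by auto
    show ?thesis
    proof (cases "(j, path_image p) = (i, b1)")
      case True
      then have "q = b1 \<otimes> c"
        using s normal_form_monomial[OF cm(3)] lam_monomial(3)[OF cm(3)] by (auto simp: support_def)
      then show ?thesis using True jq by simp
    next
      case False
      then show ?thesis using small[OF _ _ False s] k jq by simp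
    qed
  qed
  have "coef (c \<odot>\<^bsub>F\<^esub> g) ?u \<noteq> 0" using coef_u l(2) ib by simp
  then have "lm_F (c \<odot>\<^bsub>F\<^esub> g) = ?u" "c \<odot>\<^bsub>F\<^esub> g \<noteq> \<zero>\<^bsub>F\<^esub>"
    using lm_F_eqI[of "c \<odot>\<^bsub>F\<^esub> g" ?u] u below g(1) cc by auto
  then show "lm_F (c \<odot>\<^bsub>F\<^esub> g) = (fst (lm_F g), snd (lm_F g) \<otimes> c)" "c \<odot>\<^bsub>F\<^esub> g \<noteq> \<zero>\<^bsub>F\<^esub>"
    using ib by auto
qed

section \<open>Evaluating elements of the free path module\<close>

lemma order_E: "strict_total_order_on (sig_monomials m) lt_E"
  using sig_ordering by (simp add: sig_ordering_def)

lemma sig_monomialsD: "t \<in> sig_monomials m \<Longrightarrow> fst t < m \<and> snd t \<in> paths Q"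
  by (auto simp: sig_monomials_def)

lemma E_zero: "0 \<in> E" by (simp add: E_def)

lemma E_add: "f \<in> E \<Longrightarrow> g \<in> E \<Longrightarrow> f + g \<in> E"
  using Poly_Mapping.keys_add[of f g] unfolding E_def by blast

lemma E_scale: "f \<in> E \<Longrightarrow> scale k f \<in> E"
  using keys_scale[of k f] unfolding E_def by blast

lemma E_sum: "(\<And>i. i \<in> I \<Longrightarrow> f i \<in> E) \<Longrightarrow> sum f I \<in> E"
  using keys_sum_subset[of I f] unfolding E_def by blast

lemma E_single: "t \<in> sig_monomials m \<Longrightarrow> Poly_Mapping.single t k \<in> E"
  by (simp add: E_def)

lemma E_keys: "f \<in> E \<Longrightarrow> t \<in> Poly_Mapping.keys f \<Longrightarrow> t \<in> sig_monomials m"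
  unfolding E_def by blast

abbreviation ev_term :: "nat \<times> ('v, 'e) path \<Rightarrow> 'k \<Rightarrow> nat \<Rightarrow> 'a" where
  "ev_term t k \<equiv> psi (Poly_Mapping.single (snd t) k) \<odot>\<^bsub>F\<^esub> gen (fst t)"

lemma ev_term_M: "t \<in> sig_monomials m \<Longrightarrow> ev_term t k \<in> M"
  by (rule submoduleD(4)[OF submodule_M]) (auto simp: gen_in_M dest: sig_monomialsD)

lemma ev_term_closed: "t \<in> sig_monomials m \<Longrightarrow> ev_term t k \<in> carrier F"
  using ev_term_M M_carrier by blast

lemma ev_term_zero: "t \<in> sig_monomials m \<Longrightarrow> ev_term t 0 = \<zero>\<^bsub>F\<^esub>"
  by (auto dest: sig_monomialsD)

lemma ev_term_add:
  assumes "t \<in> sig_monomials m"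
  shows "ev_term t (k + l) = ev_term t k \<oplus>\<^bsub>F\<^esub> ev_term t l"
proof -
  have "psi (Poly_Mapping.single (snd t) (k + l))
    = psi (Poly_Mapping.single (snd t) k) \<oplus> psi (Poly_Mapping.single (snd t) l)"
    using sig_monomialsD[OF assms] by (simp add: single_add psi_plus single_keys_paths)
  then show ?thesis using sig_monomialsD[OF assms] by (simp add: smult_add_left)
qed

lemma ev_term_scalar:
  assumes "t \<in> sig_monomials m"
  shows "ev_term t (k * l) = scalar k \<odot>\<^bsub>F\<^esub> ev_term t l"
proof -
  have "psi (Poly_Mapping.single (snd t) (k * l)) = psi (Poly_Mapping.single (snd t) l) \<otimes> scalar k"
    using sig_monomialsD[OF assms] psi_scale(2)[OF single_keys_paths, of "snd t" k l]
    by (simp add: scale_single)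
  then show ?thesis using sig_monomialsD[OF assms] by (simp add: smult_smult)
qed

lemma ev_superset:
  assumes "finite S" "Poly_Mapping.keys f \<subseteq> S" "S \<subseteq> sig_monomials m"
  shows "ev f = (\<Oplus>\<^bsub>F\<^esub>t\<in>S. ev_term t (Poly_Mapping.lookup f t))"
  unfolding ev_def
proof (rule F.add.finprod_mono_neutral_cong_left[OF assms(1,2)])
  fix t assume "t \<in> S - Poly_Mapping.keys f"
  then show "ev_term t (Poly_Mapping.lookup f t) = \<zero>\<^bsub>F\<^esub>"
    using assms(3) ev_term_zero[of t] by (auto simp: in_keys_iff)
qed (use assms(3) ev_term_closed in \<open>auto simp del: smult_closed\<close>)

lemma ev_add:
  assumes "f \<in> E" "g \<in> E" shows "ev (f + g) = ev f \<oplus>\<^bsub>F\<^esub> ev g"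
proof -
  let ?S = "Poly_Mapping.keys f \<union> Poly_Mapping.keys g"
  have S: "finite ?S" "?S \<subseteq> sig_monomials m" using assms by (auto simp: E_def)
  have c: "t \<in> ?S \<Longrightarrow> ev_term t k \<in> carrier F" for t k
    using S(2) ev_term_closed by blast
  have "ev (f + g) = (\<Oplus>\<^bsub>F\<^esub>t\<in>?S. ev_term t (Poly_Mapping.lookup (f + g) t))"
    by (rule ev_superset[OF S(1) Poly_Mapping.keys_add S(2)])
  also have "\<dots> = (\<Oplus>\<^bsub>F\<^esub>t\<in>?S. ev_term t (Poly_Mapping.lookup f t) \<oplus>\<^bsub>F\<^esub> ev_term t (Poly_Mapping.lookup g t))"
  proof (intro F.finsum_cong')
    fix t assume "t \<in> ?S"
    then have "t \<in> sig_monomials m" using S(2) by blast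
    then show "ev_term t (Poly_Mapping.lookup (f + g) t)
      = ev_term t (Poly_Mapping.lookup f t) \<oplus>\<^bsub>F\<^esub> ev_term t (Poly_Mapping.lookup g t)"
      unfolding lookup_add by (rule ev_term_add)
  qed (use c in auto)
  also have "\<dots> = (\<Oplus>\<^bsub>F\<^esub>t\<in>?S. ev_term t (Poly_Mapping.lookup f t)) \<oplus>\<^bsub>F\<^esub> (\<Oplus>\<^bsub>F\<^esub>t\<in>?S. ev_term t (Poly_Mapping.lookup g t))"
    using c by (intro F.finsum_addf) auto
  also have "\<dots> = ev f \<oplus>\<^bsub>F\<^esub> ev g"
    by (simp add: ev_superset[OF S(1) _ S(2)])
  finally show ?thesis .
qed

lemma ev_zero [simp]: "ev 0 = \<zero>\<^bsub>F\<^esub>"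
  by (simp add: ev_def)

lemma ev_M: "f \<in> E \<Longrightarrow> ev f \<in> M"
  unfolding ev_def using submoduleD[OF submodule_M]
  by (intro finsum_in_additive) (auto intro: ev_term_M E_keys)

lemma ev_closed: "f \<in> E \<Longrightarrow> ev f \<in> carrier F"
  using ev_M M_carrier by blast

lemma ev_scale:
  assumes "f \<in> E" shows "ev (scale k f) = scalar k \<odot>\<^bsub>F\<^esub> ev f"
proof -
  let ?S = "Poly_Mapping.keys f"
  have S: "finite ?S" "?S \<subseteq> sig_monomials m" using assms by (auto simp: E_def)
  have "ev (scale k f) = (\<Oplus>\<^bsub>F\<^esub>t\<in>?S. ev_term t (Poly_Mapping.lookup (scale k f) t))"
    by (rule ev_superset[OF S(1) keys_scale S(2)])
  also have "\<dots> = (\<Oplus>\<^bsub>F\<^esub>t\<in>?S. scalar k \<odot>\<^bsub>F\<^esub> ev_term t (Poly_Mapping.lookup f t))"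
  proof (intro F.finsum_cong')
    fix t assume "t \<in> ?S"
    then have "t \<in> sig_monomials m" using S(2) by blast
    then show "ev_term t (Poly_Mapping.lookup (scale k f) t) = scalar k \<odot>\<^bsub>F\<^esub> ev_term t (Poly_Mapping.lookup f t)"
      unfolding lookup_scale by (rule ev_term_scalar)
  qed (use S(2) ev_term_closed in auto)
  also have "\<dots> = scalar k \<odot>\<^bsub>F\<^esub> ev f"
    unfolding ev_def using S(2) ev_term_closed by (intro smult_finsum[symmetric]) auto
  finally show ?thesis .
qed

lemma ev_single: "t \<in> sig_monomials m \<Longrightarrow> ev (Poly_Mapping.single t k) = ev_term t k"
  using ev_term_closed[of t]
  by (subst ev_superset[of "{t}"]) (auto simp: F.add.finprod_insert)

lemma ev_eq_sum:
  "f \<in> E \<Longrightarrow> ev f = (\<Oplus>\<^bsub>F\<^esub>t\<in>Poly_Mapping.keys f. ev (Poly_Mapping.single t (Poly_Mapping.lookup f t)))"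
  by (subst ev_def, intro F.finsum_cong') (auto simp: ev_single E_keys intro!: ev_closed E_single)

lemma ev_in_additive:
  assumes "N \<subseteq> carrier F" "\<zero>\<^bsub>F\<^esub> \<in> N" "\<And>x y. x \<in> N \<Longrightarrow> y \<in> N \<Longrightarrow> x \<oplus>\<^bsub>F\<^esub> y \<in> N"
    and "f \<in> E"
    and "\<And>t. t \<in> Poly_Mapping.keys f \<Longrightarrow> ev (Poly_Mapping.single t (Poly_Mapping.lookup f t)) \<in> N"
  shows "ev f \<in> N"
  unfolding ev_eq_sum[OF assms(4)] using assms(1-3,5) by (rule finsum_in_additive)

lemma ev_sum:
  assumes "\<And>i. i \<in> I \<Longrightarrow> f i \<in> E"
  shows "ev (sum f I) = (\<Oplus>\<^bsub>F\<^esub>i\<in>I. ev (f i))"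
  using assms
proof (induction I rule: infinite_finite_induct)
  case (insert i I)
  then show ?case by (simp add: ev_add E_sum ev_closed Pi_def)
qed auto


subsection \<open>Multiplying by a path\<close>

definition times_path :: "(nat \<times> ('v, 'e) path \<Rightarrow>\<^sub>0 'k) \<Rightarrow> ('v, 'e) path \<Rightarrow> (nat \<times> ('v, 'e) path \<Rightarrow>\<^sub>0 'k)" where
  "times_path f d = (\<Sum>t\<in>Poly_Mapping.keys f.
    if composable Q (snd t) d then Poly_Mapping.single (fst t, path_concat (snd t) d) (Poly_Mapping.lookup f t) else 0)"

lemma sig_monomials_concat:
  "t \<in> sig_monomials m \<Longrightarrow> d \<in> paths Q \<Longrightarrow> composable Q (snd t) d
    \<Longrightarrow> (fst t, path_concat (snd t) d) \<in> sig_monomials m"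
  by (auto simp: sig_monomials_def intro: path_concat_paths[OF wf_digraph])

lemma times_path_summand_E:
  "t \<in> sig_monomials m \<Longrightarrow> d \<in> paths Q \<Longrightarrow>
    (if composable Q (snd t) d then Poly_Mapping.single (fst t, path_concat (snd t) d) k else 0) \<in> E"
  using sig_monomials_concat[of t d] by (simp add: E_single E_zero)

lemma times_path_E: "f \<in> E \<Longrightarrow> d \<in> paths Q \<Longrightarrow> times_path f d \<in> E"
  unfolding times_path_def by (intro E_sum times_path_summand_E E_keys)

lemma path_image_smult_single:
  assumes "t \<in> sig_monomials m" "d \<in> paths Q"
  shows "path_image d \<odot>\<^bsub>F\<^esub> ev (Poly_Mapping.single t k)
    = ev (if composable Q (snd t) d then Poly_Mapping.single (fst t, path_concat (snd t) d) k else 0)"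
proof -
  note t = sig_monomialsD[OF assms(1)]
  have "path_image d \<odot>\<^bsub>F\<^esub> ev (Poly_Mapping.single t k)
    = (psi (Poly_Mapping.single (snd t) k) \<otimes> path_image d) \<odot>\<^bsub>F\<^esub> gen (fst t)"
    using t assms by (simp add: ev_single smult_smult)
  also have "psi (Poly_Mapping.single (snd t) k) \<otimes> path_image d
    = psi (if composable Q (snd t) d then Poly_Mapping.single (path_concat (snd t) d) k else 0)"
    using t assms unfolding path_image_def
    by (subst psi_mult[symmetric]) (auto simp: single_keys_paths path_mult_single)
  finally show ?thesis
    using t sig_monomials_concat[OF assms] by (auto simp: ev_single)
qed

lemma ev_times_path:
  assumes "f \<in> E" "d \<in> paths Q" shows "ev (times_path f d) = path_image d \<odot>\<^bsub>F\<^esub> ev f"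
proof -
  have "path_image d \<odot>\<^bsub>F\<^esub> ev f
    = (\<Oplus>\<^bsub>F\<^esub>t\<in>Poly_Mapping.keys f. path_image d \<odot>\<^bsub>F\<^esub> ev (Poly_Mapping.single t (Poly_Mapping.lookup f t)))"
    unfolding ev_eq_sum[OF assms(1)] using assms by (intro smult_finsum) (auto intro!: ev_closed E_single E_keys)
  also have "\<dots> = (\<Oplus>\<^bsub>F\<^esub>t\<in>Poly_Mapping.keys f. ev (if composable Q (snd t) d
      then Poly_Mapping.single (fst t, path_concat (snd t) d) (Poly_Mapping.lookup f t) else 0))"
    using path_image_smult_single[OF E_keys[OF assms(1)] assms(2)] times_path_summand_E[OF E_keys[OF assms(1)] assms(2)]
    by (intro F.finsum_cong') (auto intro!: ev_closed)
  also have "\<dots> = ev (times_path f d)"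
    unfolding times_path_def using times_path_summand_E[OF E_keys[OF assms(1)] assms(2)]
    by (intro ev_sum[symmetric]) auto
  finally show ?thesis by simp
qed

lemma lookup_times_path:
  assumes "composable Q (snd t) d"
  shows "Poly_Mapping.lookup (times_path f d) (fst t, path_concat (snd t) d) = Poly_Mapping.lookup f t"
proof -
  have "Poly_Mapping.lookup (if composable Q (snd u) d
      then Poly_Mapping.single (fst u, path_concat (snd u) d) (Poly_Mapping.lookup f u) else 0)
      (fst t, path_concat (snd t) d) = (if u = t then Poly_Mapping.lookup f t else 0)" for u
  proof (cases "u = t")
    case False
    then have "(fst u, path_concat (snd u) d) \<noteq> (fst t, path_concat (snd t) d)"
      using path_concat_right_cancel[of "snd u" d "snd t"] by (metis fst_conv prod.collapse snd_conv)
    then show ?thesis using False by (auto simp: lookup_single when_def)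
  qed (simp add: assms lookup_single)
  then show ?thesis by (simp add: times_path_def lookup_sum in_keys_iff)
qed

lemma keys_times_path:
  assumes "u \<in> Poly_Mapping.keys (times_path f d)"
  obtains t where "t \<in> Poly_Mapping.keys f" "composable Q (snd t) d" "u = (fst t, path_concat (snd t) d)"
proof -
  have "Poly_Mapping.lookup (times_path f d) u \<noteq> 0" using assms by (simp add: in_keys_iff)
  then obtain t where "t \<in> Poly_Mapping.keys f"
    "Poly_Mapping.lookup (if composable Q (snd t) d
      then Poly_Mapping.single (fst t, path_concat (snd t) d) (Poly_Mapping.lookup f t) else 0) u \<noteq> 0"
    unfolding times_path_def lookup_sum by (rule sum.not_neutral_contains_not_neutral)
  then show ?thesis using that[of t] by (auto simp: lookup_single when_def split: if_splits)
qed


subsection \<open>Leading monomials\<close>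

lemma lm_E:
  assumes "f \<in> E" "f \<noteq> 0"
  shows "lm_E f \<in> Poly_Mapping.keys f" "lm_E f \<in> sig_monomials m"
    and "t \<in> Poly_Mapping.keys f \<Longrightarrow> t = lm_E f \<or> lt_E t (lm_E f)"
proof -
  have k: "Poly_Mapping.keys f \<noteq> {}" "Poly_Mapping.keys f \<subseteq> sig_monomials m"
    using assms by (auto simp: E_def)
  note g = greatest_wrt[OF order_E finite_keys k]
  show "lm_E f \<in> Poly_Mapping.keys f" "lm_E f \<in> sig_monomials m"
    and "t \<in> Poly_Mapping.keys f \<Longrightarrow> t = lm_E f \<or> lt_E t (lm_E f)"
    using g(1) g(2)[of t] k(2) by (auto simp: lm_E_def)
qed

lemma lm_E_eqI:
  assumes "f \<in> E" "t \<in> Poly_Mapping.keys f" "\<And>u. u \<in> Poly_Mapping.keys f \<Longrightarrow> u = t \<or> lt_E u t"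
  shows "lm_E f = t"
  unfolding lm_E_def using assms(1) by (intro greatest_wrt_eqI[OF order_E _ assms(2,3)]) (auto simp: E_def)

lemma lm_E_cancel:
  assumes "f \<in> E" "f \<noteq> 0" "g \<in> E" "g \<noteq> 0" "lm_E f = lm_E g"
  obtains k where "f + scale k g = 0 \<or> lt_E (lm_E (f + scale k g)) (lm_E f)"
proof -
  define s where "s = lm_E f"
  define k where "k = - (Poly_Mapping.lookup f s / Poly_Mapping.lookup g s)"
  define h where "h = f + scale k g"
  have h: "h \<in> E" by (simp add: h_def E_add E_scale assms)
  have "Poly_Mapping.lookup g s \<noteq> 0" using lm_E(1)[OF assms(3,4)] assms(5) by (simp add: s_def in_keys_iff)
  then have hs: "s \<notin> Poly_Mapping.keys h" by (simp add: h_def k_def lookup_add in_keys_iff)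
  have "lt_E (lm_E h) s" if "h \<noteq> 0"
  proof -
    note l = lm_E(1)[OF h that]
    have "lm_E h \<in> Poly_Mapping.keys f \<or> lm_E h \<in> Poly_Mapping.keys g"
      using l by (auto simp: h_def lookup_add in_keys_iff)
    then have "lm_E h = s \<or> lt_E (lm_E h) s"
      using lm_E(3)[OF assms(1,2), of "lm_E h"] lm_E(3)[OF assms(3,4), of "lm_E h"] assms(5)
      unfolding s_def by argo
    then show ?thesis using l hs by auto
  qed
  then show ?thesis using that[of k] by (auto simp: h_def s_def)
qed

lemma sig_ordering_concat:
  assumes "t \<in> sig_monomials m" "u \<in> sig_monomials m" "d \<in> paths Q"
    "composable Q (snd t) d" "composable Q (snd u) d" "lt_E t u"
  shows "lt_E (fst t, path_concat (snd t) d) (fst u, path_concat (snd u) d)"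
  using sig_ordering assms sig_monomialsD[OF assms(1)] sig_monomialsD[OF assms(2)]
  unfolding sig_ordering_def by (metis prod.collapse)

lemma lm_E_times_path:
  assumes "f \<in> E" "f \<noteq> 0" "d \<in> paths Q" "composable Q (snd (lm_E f)) d"
  shows "times_path f d \<noteq> 0" "lm_E (times_path f d) = (fst (lm_E f), path_concat (snd (lm_E f)) d)"
proof -
  let ?s = "(fst (lm_E f), path_concat (snd (lm_E f)) d)"
  note l = lm_E[OF assms(1,2)]
  have s: "?s \<in> Poly_Mapping.keys (times_path f d)"
    using lookup_times_path[OF assms(4), of f] l(1) by (simp add: in_keys_iff)
  then show "times_path f d \<noteq> 0" by auto
  show "lm_E (times_path f d) = ?s"
  proof (rule lm_E_eqI[OF times_path_E[OF assms(1,3)] s])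
    fix u assume "u \<in> Poly_Mapping.keys (times_path f d)"
    then obtain t where t: "t \<in> Poly_Mapping.keys f" "composable Q (snd t) d" "u = (fst t, path_concat (snd t) d)"
      by (rule keys_times_path)
    show "u = ?s \<or> lt_E u ?s"
      using l(3)[OF t(1)] sig_ordering_concat[OF E_keys[OF assms(1) t(1)] l(2) assms(3) t(2) assms(4)] t(3)
      by auto
  qed
qed

lemma signed_nonzero_iff:
  "(x, s) \<in> signed_nonzero \<longleftrightarrow> x \<noteq> \<zero>\<^bsub>F\<^esub> \<and> (\<exists>f\<in>E. f \<noteq> 0 \<and> lm_E f = s \<and> ev f = x)"
  unfolding signed_nonzero_def signed_elements_def using lm_E(2) ev_M by auto


subsection \<open>The submodule as an image\<close>

lemma smult_psi:
  assumes "Poly_Mapping.keys p \<subseteq> paths Q" "x \<in> carrier F"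
  shows "psi p \<odot>\<^bsub>F\<^esub> x = (\<Oplus>\<^bsub>F\<^esub>b\<in>Poly_Mapping.keys p.
    scalar (Poly_Mapping.lookup p b) \<odot>\<^bsub>F\<^esub> (path_image b \<odot>\<^bsub>F\<^esub> x))"
proof -
  let ?s = "\<lambda>b. Poly_Mapping.single b (Poly_Mapping.lookup p b)"
  have pp: "b \<in> Poly_Mapping.keys p \<Longrightarrow> b \<in> paths Q" for b using assms(1) by auto
  have "psi p = (\<Oplus>b\<in>Poly_Mapping.keys p. psi (?s b))"
    using psi_sum[of "Poly_Mapping.keys p" ?s] pp poly_eq[of p] by (auto simp: single_keys_paths)
  then have "psi p \<odot>\<^bsub>F\<^esub> x = (\<Oplus>\<^bsub>F\<^esub>b\<in>Poly_Mapping.keys p. psi (?s b) \<odot>\<^bsub>F\<^esub> x)"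
    using pp assms(2) by (simp add: smult_finsum_left)
  also have "\<dots> = (\<Oplus>\<^bsub>F\<^esub>b\<in>Poly_Mapping.keys p.
    scalar (Poly_Mapping.lookup p b) \<odot>\<^bsub>F\<^esub> (path_image b \<odot>\<^bsub>F\<^esub> x))"
    using pp assms(2) by (intro F.finsum_cong') (auto simp: psi_single smult_smult)
  finally show ?thesis .
qed

text \<open>
  The algebra is spanned by images of paths, so closure under the action can be tested on paths and
  scalars.
\<close>

lemma submoduleI_paths:
  assumes N: "N \<subseteq> carrier F" "\<zero>\<^bsub>F\<^esub> \<in> N" "\<And>x y. x \<in> N \<Longrightarrow> y \<in> N \<Longrightarrow> x \<oplus>\<^bsub>F\<^esub> y \<in> N"
    and scal: "\<And>k x. x \<in> N \<Longrightarrow> scalar k \<odot>\<^bsub>F\<^esub> x \<in> N"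
    and path: "\<And>b x. b \<in> paths Q \<Longrightarrow> x \<in> N \<Longrightarrow> path_image b \<odot>\<^bsub>F\<^esub> x \<in> N"
  shows "submodule N A F"
proof (rule submoduleI[OF N])
  fix a x assume a: "a \<in> carrier A" and x: "x \<in> N"
  have "psi (normal_form a) \<odot>\<^bsub>F\<^esub> x \<in> N"
    using x N(1) normal_form_keys_paths[OF a]
    by (subst smult_psi) (auto intro!: finsum_in_additive[OF N] scal path)
  then show "a \<odot>\<^bsub>F\<^esub> x \<in> N" using normal_form(2)[OF a] by simp
qed

lemma smult_one_sum:
  "x \<in> carrier F \<Longrightarrow> x = (\<Oplus>\<^bsub>F\<^esub>v\<in>verts Q. path_image (v, []) \<odot>\<^bsub>F\<^esub> x)"
  using smult_finsum_left[of x "verts Q" "\<lambda>v. path_image (v, [])"]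
  by (simp add: one_eq_sum[symmetric] trivial_path_iff)

lemma submodule_ev_E: "submodule (ev ` E) A F"
proof (rule submoduleI_paths)
  show "\<zero>\<^bsub>F\<^esub> \<in> ev ` E" using E_zero by (intro image_eqI[of _ _ 0]) auto
  show "scalar k \<odot>\<^bsub>F\<^esub> x \<in> ev ` E" if "x \<in> ev ` E" for k x
    using that by (auto simp: ev_scale[symmetric] intro!: imageI E_scale)
  show "x \<oplus>\<^bsub>F\<^esub> y \<in> ev ` E" if "x \<in> ev ` E" "y \<in> ev ` E" for x y
    using that by (auto simp: ev_add[symmetric] intro!: imageI E_add)
  show "path_image b \<odot>\<^bsub>F\<^esub> x \<in> ev ` E" if "b \<in> paths Q" "x \<in> ev ` E" for b x
    using that by (auto simp: ev_times_path[symmetric] intro!: imageI times_path_E)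
qed (auto intro: ev_closed)

lemma generated_submodule_subset: "submodule N A F \<Longrightarrow> X \<subseteq> N \<Longrightarrow> generated_submodule A F X \<subseteq> N"
  unfolding generated_submodule_def by auto

lemma ev_E: "ev ` E = M"
proof
  show "ev ` E \<subseteq> M" using ev_M by auto
  have "gen i \<in> ev ` E" if i: "i < m" for i
  proof -
    have v: "v \<in> verts Q \<Longrightarrow> (i, v, []) \<in> sig_monomials m" for v
      using i by (simp add: sig_monomials_def trivial_path_iff)
    have "gen i = (\<Oplus>\<^bsub>F\<^esub>v\<in>verts Q. path_image (v, []) \<odot>\<^bsub>F\<^esub> gen i)"
      using i by (intro smult_one_sum) simp
    also have "\<dots> = (\<Oplus>\<^bsub>F\<^esub>v\<in>verts Q. ev (Poly_Mapping.single (i, v, []) 1))"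
      using i by (intro F.finsum_cong') (auto simp: ev_single v path_image_def intro!: smult_closed psi_single_closed simp: trivial_path_iff)
    also have "\<dots> = ev (\<Sum>v\<in>verts Q. Poly_Mapping.single (i, v, []) 1)"
      by (intro ev_sum[symmetric] E_single v)
    finally show ?thesis using v by (auto intro!: imageI E_sum E_single)
  qed
  then show "M \<subseteq> ev ` E"
    using generated_submodule_subset[OF submodule_ev_E, of "gen ` {..<m}"] gen_generates by auto
qed


subsection \<open>The arrow part\<close>

text \<open>
  The submodule \<open>M \<cdot> J\<close>, where \<open>J\<close> is the ideal of the algebra generated by the arrows. It is given by
  lifts to \<open>E\<close>, since it is with leading monomials in \<open>E\<close> that it has to be compared.
\<close>

definition arrow_part :: "(nat \<Rightarrow> 'a) set" where
  "arrow_part = ev ` {h \<in> E. \<forall>t\<in>Poly_Mapping.keys h. 0 < path_deg (snd t)}"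

lemma arrow_part_M: "arrow_part \<subseteq> M"
  unfolding arrow_part_def using ev_M by auto

lemma arrow_part_times_path:
  assumes "h \<in> E" "b \<in> paths Q" "0 < path_deg b \<or> (\<forall>t\<in>Poly_Mapping.keys h. 0 < path_deg (snd t))"
  shows "path_image b \<odot>\<^bsub>F\<^esub> ev h \<in> arrow_part"
proof -
  have "0 < path_deg (snd u)" if "u \<in> Poly_Mapping.keys (times_path h b)" for u
    using that by (rule keys_times_path) (use assms(3) in \<open>auto simp: path_deg_concat\<close>)
  then show ?thesis unfolding arrow_part_def
    using assms by (auto simp: ev_times_path[symmetric] intro!: imageI times_path_E)
qed

lemma submodule_arrow_part: "submodule arrow_part A F"
proof (rule submoduleI_paths)
  show "arrow_part \<subseteq> carrier F" using arrow_part_M M_carrier by auto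
  show "\<zero>\<^bsub>F\<^esub> \<in> arrow_part"
    unfolding arrow_part_def using E_zero by (intro image_eqI[of _ _ 0]) auto
  show "scalar k \<odot>\<^bsub>F\<^esub> x \<in> arrow_part" if "x \<in> arrow_part" for k x
    using that unfolding arrow_part_def
    by (auto simp: ev_scale[symmetric] intro!: imageI E_scale dest!: subsetD[OF keys_scale])
  show "x \<oplus>\<^bsub>F\<^esub> y \<in> arrow_part" if "x \<in> arrow_part" "y \<in> arrow_part" for x y
    using that unfolding arrow_part_def
    by (auto simp: ev_add[symmetric] intro!: imageI E_add dest!: subsetD[OF Poly_Mapping.keys_add])
  show "path_image b \<odot>\<^bsub>F\<^esub> x \<in> arrow_part" if "b \<in> paths Q" "x \<in> arrow_part" for b x
    using that arrow_part_times_path[of _ b] by (auto simp: arrow_part_def)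
qed

lemma arrow_smult_arrow_part:
  assumes "y \<in> M" "b \<in> paths Q" "0 < path_deg b"
  shows "path_image b \<odot>\<^bsub>F\<^esub> y \<in> arrow_part"
  using assms arrow_part_times_path[of _ b] ev_E by (metis imageE)

lemma ev_single_arrow_part:
  "t \<in> sig_monomials m \<Longrightarrow> 0 < path_deg (snd t) \<Longrightarrow> ev (Poly_Mapping.single t k) \<in> arrow_part"
  unfolding arrow_part_def by (intro imageI) (auto simp: E_single in_keys_iff lookup_single when_def split: if_splits)

end

section \<open>Finiteness from a negative degree ordering\<close>

lemma (in fin_digraph) finite_paths_bounded: "finite {b \<in> paths G. path_deg b < n}"
proof (rule finite_subset)
  show "{b \<in> paths G. path_deg b < n} \<subseteq> verts G \<times> {p. set p \<subseteq> arcs G \<and> length p \<le> n}"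
    by (auto simp: paths_def path_deg_def awalk_def)
  show "finite (verts G \<times> {p. set p \<subseteq> arcs G \<and> length p \<le> n})"
    by (intro finite_cartesian_product finite_lists_length_le) auto
qed

locale basic_signature_setting = signature_setting Q A psi lt r lt_F M m gen lt_E
  for Q :: "('v, 'e) pre_digraph" and A :: "('a, 'c) ring_scheme" (structure)
    and psi :: "(('v, 'e) path \<Rightarrow>\<^sub>0 'k::field) \<Rightarrow> 'a" and lt r lt_F M m gen lt_E +
  assumes basic: basic_algebra
    and negative_degree: negative_degree_ordering
begin

interpretation F: abelian_group F
  by (rule alg.abelian_group_free_right_module)

lemma std_mon_finite: "finite std_mon"
  using finite_std_mon basic by (simp add: basic_algebra_def)

lemma finite_module_monomials: "finite (module_monomials r)"
  using std_mon_finite by (simp add: module_monomials_def monomials_def)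

lemma smaller_degree_greater:
  "s \<in> sig_monomials m \<Longrightarrow> t \<in> sig_monomials m \<Longrightarrow> path_deg (snd t) < path_deg (snd s) \<Longrightarrow> lt_E s t"
  using negative_degree by (simp add: negative_degree_ordering_def)

text \<open>
  The normal form \<open>p\<close> of the image of \<open>b\<close> consists of paths shorter than \<open>b\<close>, which are greater than
  \<open>b\<close>. If \<open>p\<close> were non-zero, the leading monomial of the relation \<open>b - p\<close> would thus be one of the
  standard monomials in \<open>p\<close>, which is absurd. The generator index \<open>i\<close> is what transports the comparison
  by degree from \<open>lt_E\<close> to \<open>lt\<close>.
\<close>

lemma long_path_zero:
  assumes i: "i < m" and b: "b \<in> paths Q" and deg: "\<And>p. p \<in> std_mon \<Longrightarrow> path_deg p < path_deg b"
  shows "path_image b = \<zero>"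
proof -
  define p where "p = normal_form (path_image b)"
  have pc: "path_image b \<in> carrier A" using b by simp
  have p: "Poly_Mapping.keys p \<subseteq> std_mon" "psi p = path_image b"
    using normal_form[OF pc] by (simp_all add: p_def)
  have pP: "Poly_Mapping.keys p \<subseteq> paths Q" using p(1) std_mon_paths by blast
  define q where "q = Poly_Mapping.single b 1 + scale (-1) p"
  have "Poly_Mapping.keys (scale (-1) p) \<subseteq> paths Q" using keys_scale[of "-1" p] pP by blast
  then have "psi q = path_image b \<oplus> scalar (-1) \<otimes> path_image b"
    unfolding q_def using b pP
    by (simp add: psi_plus single_keys_paths psi_scale(1) p(2) path_image_def[symmetric])
  also have "\<dots> = (scalar 1 \<oplus> scalar (-1)) \<otimes> path_image b"
    using b by (simp add: alg.l_distr del: scalar_one) simp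
  also have "\<dots> = \<zero>" using b scalar_add[of 1 "-1", symmetric] by simp
  finally have q0: "psi q = \<zero>" .
  have bp: "b \<notin> Poly_Mapping.keys p" using p(1) deg by blast
  have lq: "Poly_Mapping.lookup q x = (if x = b then 1 else - Poly_Mapping.lookup p x)" for x
    using bp by (auto simp: q_def lookup_add lookup_single when_def in_keys_iff)
  have kq: "Poly_Mapping.keys q = insert b (Poly_Mapping.keys p)"
    by (rule Set.set_eqI) (simp add: in_keys_iff lq)
  have qP: "Poly_Mapping.keys q \<subseteq> paths Q" using kq b pP by simp
  have ord: "strict_total_order_on (paths Q) lt"
    using monomial_ordering by (simp add: monomial_ordering_def)
  have ne: "Poly_Mapping.keys q \<noteq> {}" using kq by simp
  note g = greatest_wrt[OF ord finite_keys ne qP]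
  have "q \<in> Ker" "q \<noteq> 0" using q0 qP ne by (auto simp: a_kernel_def' in_PA)
  then have nstd: "lm_path q \<notin> std_mon" by (auto simp: std_mon_def)
  have "Poly_Mapping.keys p = {}"
  proof (rule ccontr)
    assume "Poly_Mapping.keys p \<noteq> {}"
    then obtain v where v: "v \<in> Poly_Mapping.keys p" by blast
    have lmb: "lm_path q = b"
      using g(1) nstd p(1) unfolding lm_path_def kq by blast
    have "lt v b"
      using g(2)[of v] v bp lmb unfolding lm_path_def kq by auto
    then have "lt_E (i, v) (i, b)"
      using sig_ordering i b subsetD[OF pP v] unfolding sig_ordering_def by simp
    moreover have "(i, v) \<in> sig_monomials m" "(i, b) \<in> sig_monomials m"
      using i b v pP by (auto simp: sig_monomials_def)
    moreover have "path_deg v < path_deg b" using deg v p(1) by blast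
    ultimately show False
      using smaller_degree_greater[of "(i, b)" "(i, v)"] strict_total_order_onD(2)[OF order_E, of "(i, v)" "(i, b)"]
      by simp
  qed
  then show ?thesis using p(2) by simp
qed

text \<open>
  The index \<open>i\<close> makes the bound hold vacuously for \<open>m = 0\<close>, where \<open>lt\<close> is not tied to degrees at all.
\<close>

lemma nilpotency_bound:
  obtains n where "\<And>i b. i < m \<Longrightarrow> b \<in> paths Q \<Longrightarrow> n \<le> path_deg b \<Longrightarrow> path_image b = \<zero>"
proof -
  obtain n where "\<And>p. p \<in> std_mon \<Longrightarrow> path_deg p < n"
    using std_mon_finite finite_nat_set_iff_bounded[of "path_deg ` std_mon"] by auto
  then show ?thesis using that[of n] long_path_zero by (meson less_le_trans)
qed

text \<open>
  A negative degree ordering may have infinite descending chains. They are harmless because a signature of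
  large degree forces all terms of a lift to have large degree, and then the lift evaluates to zero.
  So every minimisation over signatures of non-zero elements takes place in a finite set.
\<close>

lemma finite_signatures: "finite (snd ` signed_nonzero)"
proof -
  obtain n where n: "\<And>i b. i < m \<Longrightarrow> b \<in> paths Q \<Longrightarrow> n \<le> path_deg b \<Longrightarrow> path_image b = \<zero>"
    by (rule nilpotency_bound) blast
  have "s \<in> {..<m} \<times> {b \<in> paths Q. path_deg b < n}" if xs: "(x, s) \<in> signed_nonzero" for x s
  proof -
    obtain f where f: "f \<in> E" "f \<noteq> 0" "lm_E f = s" "ev f = x" and x: "x \<noteq> \<zero>\<^bsub>F\<^esub>"
      using xs by (auto simp: signed_nonzero_iff)
    have s: "s \<in> sig_monomials m" using lm_E(2)[OF f(1,2)] f(3) by simp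
    have "path_deg (snd s) < n"
    proof (rule ccontr)
      assume "\<not> path_deg (snd s) < n"
      have "ev (Poly_Mapping.single t k) = \<zero>\<^bsub>F\<^esub>" if t: "t \<in> Poly_Mapping.keys f" for t k
      proof -
        have tm: "t \<in> sig_monomials m" by (rule E_keys[OF f(1) t])
        have "\<not> path_deg (snd t) < path_deg (snd s)"
          using lm_E(3)[OF f(1,2) t] f(3) smaller_degree_greater[OF s tm]
            strict_total_order_onD(2)[OF order_E s tm] by auto
        then have "path_image (snd t) = \<zero>"
          using n[of "fst t" "snd t"] sig_monomialsD[OF tm] \<open>\<not> path_deg (snd s) < n\<close> by simp
        then show ?thesis using sig_monomialsD[OF tm] by (simp add: ev_single[OF tm] psi_single)
      qed
      then have "ev f = \<zero>\<^bsub>F\<^esub>"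
        using ev_in_additive[of "{\<zero>\<^bsub>F\<^esub>}" f] f(1) by simp
      then show False using x f(4) by simp
    qed
    then show ?thesis using sig_monomialsD[OF s] by (cases s) auto
  qed
  then have "snd ` signed_nonzero \<subseteq> {..<m} \<times> {b \<in> paths Q. path_deg b < n}" by force
  then show ?thesis
    by (rule finite_subset) (intro finite_cartesian_product finite_paths_bounded finite_lessThan)
qed

lemma signed_nonzeroD:
  assumes "f \<in> signed_nonzero"
  shows "fst f \<in> carrier F" "fst f \<noteq> \<zero>\<^bsub>F\<^esub>" "snd f \<in> sig_monomials m" "fst f \<in> M"
  using assms M_carrier by (auto simp: signed_nonzero_def signed_elements_def)

text \<open>
  A reducer, multiplied by its cofactor, is again a signed element and has the leading monomial of the
  element that it reduces. This turns reducibility into a comparison of signatures among elements with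
  a common leading monomial.
\<close>

lemma reduction_step_signed:
  assumes x: "x \<in> carrier F" and g: "g \<in> signed_nonzero"
    and red: "reduction_step x g c" and comp: "sig_product_defined (snd g) c"
  shows "(c \<odot>\<^bsub>F\<^esub> fst g, sig_product (snd g) c) \<in> signed_nonzero" "lm_F (c \<odot>\<^bsub>F\<^esub> fst g) = lm_F x"
proof -
  note gD = signed_nonzeroD[OF g]
  have small: "small_cofactor (snd (lm_F (fst g))) c"
    and lmx: "(fst (lm_F (fst g)), snd (lm_F (fst g)) \<otimes> c) = lm_F x" and x0: "x \<noteq> \<zero>\<^bsub>F\<^esub>"
    using red by (auto simp: reduction_step_def)
  have "snd (lm_F (fst g)) \<otimes> c \<in> monomials"
    using lm_F(1)[OF x x0] lmx[symmetric] by (simp add: module_monomials_def)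
  note l = lm_F_smult[OF gD(1,2) small this]
  show "lm_F (c \<odot>\<^bsub>F\<^esub> fst g) = lm_F x" using l(1) lmx by simp
  have cm: "c \<in> monomials" using small by (simp add: small_cofactor_def)
  note lamc = lam_monomial[OF cm]
  obtain f where f: "f \<in> E" "f \<noteq> 0" "lm_E f = snd g" "ev f = fst g"
    using g signed_nonzero_iff[of "fst g" "snd g"] by auto
  have co: "composable Q (snd (lm_E f)) (lam c)" using comp f(3) by (simp add: sig_product_defined_def)
  show "(c \<odot>\<^bsub>F\<^esub> fst g, sig_product (snd g) c) \<in> signed_nonzero"
    unfolding signed_nonzero_iff
  proof (intro conjI bexI)
    show "times_path f (lam c) \<in> E" by (rule times_path_E[OF f(1) lamc(2)])
    show "times_path f (lam c) \<noteq> 0" "lm_E (times_path f (lam c)) = sig_product (snd g) c"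
      using lm_E_times_path[OF f(1,2) lamc(2) co] f(3) by (auto simp: sig_product_def)
    show "ev (times_path f (lam c)) = c \<odot>\<^bsub>F\<^esub> fst g"
      using ev_times_path[OF f(1) lamc(2)] f(4) lamc(3) by simp
  qed (rule l(2))
qed

lemma reduction_step_cong:
  "x \<noteq> \<zero>\<^bsub>F\<^esub> \<Longrightarrow> y \<noteq> \<zero>\<^bsub>F\<^esub> \<Longrightarrow> lm_F x = lm_F y \<Longrightarrow> reduction_step x g c \<longleftrightarrow> reduction_step y g c"
  by (simp add: reduction_step_def)

section \<open>Nakayama's lemma\<close>

lemma scalar_scalar: "x \<in> carrier F \<Longrightarrow> scalar k \<odot>\<^bsub>F\<^esub> (scalar l \<odot>\<^bsub>F\<^esub> x) = scalar (k * l) \<odot>\<^bsub>F\<^esub> x"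
  by (simp add: smult_smult scalar_mult[symmetric] mult.commute)

lemma ev_single_scalar:
  "t \<in> sig_monomials m \<Longrightarrow>
    ev (Poly_Mapping.single t k) = scalar k \<odot>\<^bsub>F\<^esub> (path_image (snd t) \<odot>\<^bsub>F\<^esub> gen (fst t))"
  using sig_monomialsD[of t] by (simp add: ev_single psi_single smult_smult)

text \<open>
  By descending induction on the degree of \<open>b\<close>, all \<open>gen i \<cdot> b\<close> lie in \<open>N\<close>. Long paths act as zero;
  otherwise \<open>gen i = x + z\<close> with \<open>x\<close> in \<open>N\<close> and \<open>z\<close> in the arrow part, and \<open>z \<cdot> b\<close> is a combination of
  products \<open>gen j \<cdot> b'\<close> with \<open>b'\<close> longer than \<open>b\<close>.
\<close>

lemma nakayama:
  assumes N: "submodule N A F"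
    and cover: "\<And>y. y \<in> M \<Longrightarrow> \<exists>x\<in>N. \<exists>z\<in>arrow_part. y = x \<oplus>\<^bsub>F\<^esub> z"
  shows "M \<subseteq> N"
proof -
  note ND = submoduleD[OF N]
  obtain n where n: "\<And>i b. i < m \<Longrightarrow> b \<in> paths Q \<Longrightarrow> n \<le> path_deg b \<Longrightarrow> path_image b = \<zero>"
    by (rule nilpotency_bound) blast
  have path: "path_image b \<odot>\<^bsub>F\<^esub> gen i \<in> N" if "i < m" "b \<in> paths Q" for i b
    using that
  proof (induction "n - path_deg b" arbitrary: i b rule: less_induct)
    case less
    show ?case
    proof (cases "n \<le> path_deg b")
      case True
      then show ?thesis using n[OF less.prems True] less.prems ND(2) by simp
    next
      case False
      obtain x z where xz: "x \<in> N" "z \<in> arrow_part" "gen i = x \<oplus>\<^bsub>F\<^esub> z"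
        using cover[OF gen_in_M[OF less.prems(1)]] by blast
      obtain h where h: "h \<in> E" "\<forall>t\<in>Poly_Mapping.keys h. 0 < path_deg (snd t)" "z = ev h"
        using xz(2) by (auto simp: arrow_part_def)
      have "ev (times_path h b) \<in> N"
      proof (rule ev_in_additive[OF ND(1-3) times_path_E[OF h(1) less.prems(2)]])
        fix u assume u: "u \<in> Poly_Mapping.keys (times_path h b)"
        then obtain t where t: "t \<in> Poly_Mapping.keys h" "u = (fst t, path_concat (snd t) b)"
          by (rule keys_times_path)
        have um: "u \<in> sig_monomials m" by (rule E_keys[OF times_path_E[OF h(1) less.prems(2)] u])
        have "path_deg b < path_deg (snd u)" using h(2) t by (simp add: path_deg_concat)
        then have "n - path_deg (snd u) < n - path_deg b" using False by simp
        then have "path_image (snd u) \<odot>\<^bsub>F\<^esub> gen (fst u) \<in> N"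
          using less.hyps[of "snd u" "fst u"] sig_monomialsD[OF um] by simp
        then show "ev (Poly_Mapping.single u (Poly_Mapping.lookup (times_path h b) u)) \<in> N"
          unfolding ev_single_scalar[OF um] by (rule ND(4)[OF scalar_closed])
      qed
      then have "path_image b \<odot>\<^bsub>F\<^esub> z \<in> N" using ev_times_path[OF h(1) less.prems(2)] h(3) by simp
      moreover have "path_image b \<odot>\<^bsub>F\<^esub> gen i = path_image b \<odot>\<^bsub>F\<^esub> x \<oplus>\<^bsub>F\<^esub> path_image b \<odot>\<^bsub>F\<^esub> z"
        unfolding xz(3) using xz ND(1) submoduleD(1)[OF submodule_arrow_part] less.prems(2)
        by (intro smult_add_right) auto
      ultimately show ?thesis using xz(1) less.prems(2) by (auto intro!: ND)
    qed
  qed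
  show ?thesis
  proof
    fix y assume "y \<in> M"
    then obtain f where f: "f \<in> E" "y = ev f" using ev_E by blast
    show "y \<in> N" unfolding f(2)
    proof (rule ev_in_additive[OF ND(1-3) f(1)])
      fix t assume "t \<in> Poly_Mapping.keys f"
      then have t: "t \<in> sig_monomials m" by (rule E_keys[OF f(1)])
      show "ev (Poly_Mapping.single t (Poly_Mapping.lookup f t)) \<in> N"
        unfolding ev_single_scalar[OF t] using sig_monomialsD[OF t] by (intro ND(4) scalar_closed path) auto
    qed
  qed
qed

text \<open>
  Otherwise maximality gives \<open>N + arrow_part = M\<close>, and then \<open>N = M\<close> by Nakayama's lemma.
\<close>

lemma arrow_part_subset_maximal:
  assumes "maximal_submodule N" shows "arrow_part \<subseteq> N"
proof -
  have N: "submodule N A F" "N \<subset> M" using assms by (auto simp: maximal_submodule_def)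
  have max: "N' = N \<or> N' = M" if "submodule N' A F" "N \<subseteq> N'" "N' \<subseteq> M" for N'
    using assms that by (simp add: maximal_submodule_def)
  note ND = submoduleD[OF N(1)] and AD = submoduleD[OF submodule_arrow_part]
  define S where "S = {x \<oplus>\<^bsub>F\<^esub> z |x z. x \<in> N \<and> z \<in> arrow_part}"
  have SI: "x \<in> N \<Longrightarrow> z \<in> arrow_part \<Longrightarrow> x \<oplus>\<^bsub>F\<^esub> z \<in> S" for x z by (auto simp: S_def)
  have SE: "\<exists>x\<in>N. \<exists>z\<in>arrow_part. y = x \<oplus>\<^bsub>F\<^esub> z" if "y \<in> S" for y using that by (auto simp: S_def)
  have "submodule S A F"
  proof (rule submoduleI)
    show "S \<subseteq> carrier F" using ND(1) AD(1) by (auto simp: S_def)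
    show "\<zero>\<^bsub>F\<^esub> \<in> S" using SI[OF ND(2) AD(2)] by simp
  next
    fix y y' assume "y \<in> S" "y' \<in> S"
    then obtain x z x' z' where *: "x \<in> N" "z \<in> arrow_part" "y = x \<oplus>\<^bsub>F\<^esub> z"
      "x' \<in> N" "z' \<in> arrow_part" "y' = x' \<oplus>\<^bsub>F\<^esub> z'" using SE by meson
    then have "y \<oplus>\<^bsub>F\<^esub> y' = (x \<oplus>\<^bsub>F\<^esub> x') \<oplus>\<^bsub>F\<^esub> (z \<oplus>\<^bsub>F\<^esub> z')"
      using ND(1) AD(1) by (simp add: F.a_ac subset_iff)
    then show "y \<oplus>\<^bsub>F\<^esub> y' \<in> S" using SI[OF ND(3) AD(3)] * by simp
  next
    fix a y assume a: "a \<in> carrier A" and "y \<in> S"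
    then obtain x z where *: "x \<in> N" "z \<in> arrow_part" "y = x \<oplus>\<^bsub>F\<^esub> z" using SE by meson
    then have "a \<odot>\<^bsub>F\<^esub> y = a \<odot>\<^bsub>F\<^esub> x \<oplus>\<^bsub>F\<^esub> a \<odot>\<^bsub>F\<^esub> z"
      using ND(1) AD(1) a by (simp add: smult_add_right subset_iff)
    then show "a \<odot>\<^bsub>F\<^esub> y \<in> S" using SI[OF ND(4)[OF a] AD(4)[OF a]] * by simp
  qed
  moreover have "N \<subseteq> S"
  proof
    fix x assume "x \<in> N"
    then show "x \<in> S" using SI[of x "\<zero>\<^bsub>F\<^esub>"] AD(2) ND(1) by auto
  qed
  moreover have "S \<subseteq> M"
    using N(2) arrow_part_M submoduleD(3)[OF submodule_M] by (auto simp: S_def)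
  moreover have "S \<noteq> M"
  proof
    assume "S = M"
    then have "M \<subseteq> N" using SE by (intro nakayama[OF N(1)]) simp
    then show False using N(2) by auto
  qed
  ultimately have "S = N" using max[of S] by auto
  moreover have "arrow_part \<subseteq> S"
  proof
    fix z assume "z \<in> arrow_part"
    then show "z \<in> S" using SI[of "\<zero>\<^bsub>F\<^esub>" z] ND(2) AD(1) by auto
  qed
  ultimately show ?thesis by simp
qed

end


section \<open>Interreduced signed standard bases\<close>

locale interreduced_signed_basis = basic_signature_setting Q A psi lt r lt_F M m gen lt_E
  for Q :: "('v, 'e) pre_digraph" and A :: "('a, 'c) ring_scheme" (structure)
    and psi :: "(('v, 'e) path \<Rightarrow>\<^sub>0 'k::field) \<Rightarrow> 'a" and lt r lt_F M m gen lt_E +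
  fixes G :: "((nat \<Rightarrow> 'a) \<times> (nat \<times> ('v, 'e) path)) set"
  assumes interreduced: "interreduced G"
    and standard_basis: "signed_standard_basis G"
begin

interpretation F: abelian_group F
  by (rule alg.abelian_group_free_right_module)

lemma G_signed: "g \<in> G \<Longrightarrow> g \<in> signed_nonzero"
  using standard_basis by (auto simp: signed_standard_basis_def)

lemma G_finite: "finite G"
  using standard_basis by (simp add: signed_standard_basis_def)

text \<open>
  The definition of a signed standard basis grants this for irreducible elements only. Among the signed
  elements with the leading monomial of \<open>f\<close> and signature at most that of \<open>f\<close>, one of least signature
  is irreducible. Its reducer in \<open>G\<close> also reduces \<open>f\<close>, as being a reduction step depends on
  the leading monomial alone.
\<close>

lemma weakly_reducible:
  assumes "f \<in> signed_nonzero"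
  shows "weakly_s_reducible (snd f) G (fst f)"
proof -
  note fD = signed_nonzeroD[OF assms]
  \<comment> \<open>The candidate signatures: those of elements that compete with \<open>f\<close> for its leading monomial.\<close>
  define T where "T = {t. \<exists>x. (x, t) \<in> signed_nonzero \<and> lm_F x = lm_F (fst f) \<and> (t = snd f \<or> lt_E t (snd f))}"
  have Tsig: "T \<subseteq> sig_monomials m" by (auto simp: T_def dest!: signed_nonzeroD(3))
  have "T \<subseteq> snd ` signed_nonzero"
  proof
    fix u assume "u \<in> T"
    then obtain x where "(x, u) \<in> signed_nonzero" by (auto simp: T_def)
    then have "snd (x, u) \<in> snd ` signed_nonzero" by (rule imageI)
    then show "u \<in> snd ` signed_nonzero" by simp
  qed
  then have fin: "finite T" using finite_signatures by (rule finite_subset)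
  have "snd f \<in> T" unfolding T_def using assms by (auto intro!: exI[of _ "fst f"])
  then have ne: "T \<noteq> {}" by auto
  obtain t where t: "t \<in> T" "\<forall>u\<in>T. u = t \<or> lt_E t u"
    using finite_least_exists[OF order_E fin ne Tsig] by auto
  have tsig: "t \<in> sig_monomials m" using t(1) Tsig by auto
  note ord = strict_total_order_onD[OF order_E]
  obtain x where x: "(x, t) \<in> signed_nonzero" "lm_F x = lm_F (fst f)" "t = snd f \<or> lt_E t (snd f)"
    using t(1) by (auto simp: T_def)
  have xc: "x \<in> carrier F" "x \<noteq> \<zero>\<^bsub>F\<^esub>" using signed_nonzeroD[OF x(1)] by auto
  have "\<not> s_reducible t signed_nonzero x"
  proof
    assume "s_reducible t signed_nonzero x"
    then obtain g c where g: "g \<in> signed_nonzero" "reduction_step x g c" "sig_product_defined (snd g) c"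
      "lt_E (sig_product (snd g) c) t"
      unfolding s_reducible_def by blast
    note s = reduction_step_signed[OF xc(1) g(1-3)]
    have u: "sig_product (snd g) c \<in> sig_monomials m" using signed_nonzeroD(3)[OF s(1)] by simp
    have "sig_product (snd g) c = snd f \<or> lt_E (sig_product (snd g) c) (snd f)"
      using x(3) g(4) ord(4)[OF u tsig fD(3)] by auto
    then have uT: "sig_product (snd g) c \<in> T" unfolding T_def using s x(2) by auto
    show False
      using t(2)[rule_format, OF uT] g(4) ord(1)[OF tsig tsig] ord(2)[OF u tsig] by auto
  qed
  then have "weakly_s_reducible t G x"
    using standard_basis x(1) unfolding signed_standard_basis_def s_irreducible_def by force
  then obtain g c where g: "g \<in> G" "reduction_step x g c" "sig_product_defined (snd g) c"
    "lt_E (sig_product (snd g) c) t \<or> sig_product (snd g) c = t"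
    unfolding weakly_s_reducible_def by blast
  have u: "sig_product (snd g) c \<in> sig_monomials m"
    using signed_nonzeroD(3)[OF reduction_step_signed(1)[OF xc(1) G_signed[OF g(1)] g(2,3)]] by simp
  have "lt_E (sig_product (snd g) c) (snd f) \<or> sig_product (snd g) c = snd f"
    using g(4) x(3) ord(4)[OF u tsig fD(3)] by auto
  moreover have "reduction_step (fst f) g c"
    using g(2) reduction_step_cong[OF fD(2) xc(2)] x(2) by simp
  ultimately show ?thesis unfolding weakly_s_reducible_def using g(1,3) by blast
qed

text \<open>
  By weak reducibility, an element with a smaller signature and the same leading monomial would provide
  a reducer of \<open>g\<close> in \<open>G\<close>, against interreducedness.
\<close>

lemma no_smaller_signature:
  assumes g: "g \<in> G" and x: "(x, t) \<in> signed_nonzero" "lm_F x = lm_F (fst g)"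
  shows "\<not> lt_E t (snd g)"
proof
  assume lt: "lt_E t (snd g)"
  note gD = signed_nonzeroD[OF G_signed[OF g]]
  have xc: "x \<in> carrier F" "x \<noteq> \<zero>\<^bsub>F\<^esub>" "t \<in> sig_monomials m" using signed_nonzeroD[OF x(1)] by auto
  obtain h c where h: "h \<in> G" "reduction_step x h c" "sig_product_defined (snd h) c"
    "lt_E (sig_product (snd h) c) t \<or> sig_product (snd h) c = t"
    using weakly_reducible[OF x(1)] unfolding weakly_s_reducible_def by auto
  have u: "sig_product (snd h) c \<in> sig_monomials m"
    using signed_nonzeroD(3)[OF reduction_step_signed(1)[OF xc(1) G_signed[OF h(1)] h(2,3)]] by simp
  have "lt_E (sig_product (snd h) c) (snd g)"
    using h(4) lt strict_total_order_onD(4)[OF order_E u xc(3) gD(3)] by auto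
  moreover have "reduction_step (fst g) h c"
    using h(2) reduction_step_cong[OF gD(2) xc(2)] x(2) by simp
  ultimately have "s_reducible (snd g) G (fst g)"
    unfolding s_reducible_def using h(1,3) by blast
  then show False
    using interreduced g gD(2) unfolding interreduced_def s_irreducible_def by blast
qed

lemma G_lift:
  assumes "g \<in> G"
  obtains f where "f \<in> E" "f \<noteq> 0" "lm_E f = snd g" "ev f = fst g"
  using G_signed[OF assms] signed_nonzero_iff[of "fst g" "snd g"] by auto

text \<open>
  Cancelling the signature of \<open>g\<close> by means of a syzygy \<open>f\<close> would exhibit the unsigned element of \<open>g\<close>
  with a smaller signature.
\<close>

lemma signature_not_syzygy:
  assumes g: "g \<in> G" and f: "f \<in> E" "f \<noteq> 0" "lm_E f = snd g"
  shows "ev f \<noteq> \<zero>\<^bsub>F\<^esub>"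
proof
  assume ev0: "ev f = \<zero>\<^bsub>F\<^esub>"
  obtain h where h: "h \<in> E" "h \<noteq> 0" "lm_E h = snd g" "ev h = fst g" by (rule G_lift[OF g])
  note gD = signed_nonzeroD[OF G_signed[OF g]]
  obtain k where k: "h + scale k f = 0 \<or> lt_E (lm_E (h + scale k f)) (lm_E h)"
    using lm_E_cancel[OF h(1,2) f(1,2)] h(3) f(3) by auto
  have e: "ev (h + scale k f) = fst g"
    using gD(1) by (simp add: ev_add ev_scale E_scale h(1,4) f(1) ev0)
  then have ne: "h + scale k f \<noteq> 0" using gD(2) by auto
  have "(fst g, lm_E (h + scale k f)) \<in> signed_nonzero"
    unfolding signed_nonzero_iff using gD(2) e ne E_add[OF h(1) E_scale[OF f(1)]] by blast
  then show False using no_smaller_signature[OF g] k ne h(3) by auto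
qed

lemma no_equal_signature_reducer:
  assumes g: "g \<in> G" "g' \<in> G" and red: "reduction_step (fst g) g' c"
    "sig_product_defined (snd g') c" "sig_product (snd g') c = snd g"
  shows "g' = g"
proof (rule ccontr)
  assume "g' \<noteq> g"
  then have "\<exists>g\<in>G. \<exists>g'\<in>G. \<exists>c. g \<noteq> g' \<and> reduction_step (fst g) g' c \<and>
      sig_product_defined (snd g') c \<and> sig_product (snd g') c = snd g"
    by (intro bexI[OF _ g(1)] bexI[OF _ g(2)] exI[of _ c] conjI red) simp
  then show False using interreduced unfolding interreduced_def by (elim conjE notE)
qed

text \<open>
  This is not a triviality: if the leading monomial of \<open>g\<close> ended at another vertex than its signature,
  then no trivial path could serve as the cofactor \<open>c\<close>. That the two end vertices agree comes from the
  standard basis property: \<open>g\<close> is weakly reducible, and interreducedness leaves \<open>g\<close> itself as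
  the only possible reducer.
\<close>

lemma self_reduction:
  assumes g: "g \<in> G"
  obtains c where "reduction_step (fst g) g c" "sig_product_defined (snd g) c" "sig_product (snd g) c = snd g"
proof -
  note gD = signed_nonzeroD[OF G_signed[OF g]]
  obtain h c where h: "h \<in> G" "reduction_step (fst g) h c" "sig_product_defined (snd h) c"
    "lt_E (sig_product (snd h) c) (snd g) \<or> sig_product (snd h) c = snd g"
    using weakly_reducible[OF G_signed[OF g]] unfolding weakly_s_reducible_def by auto
  have "\<not> lt_E (sig_product (snd h) c) (snd g)"
    using reduction_step_signed[OF gD(1) G_signed[OF h(1)] h(2,3)] no_smaller_signature[OF g] by blast
  then have eq: "sig_product (snd h) c = snd g" using h(4) by simp
  have "h = g" by (rule no_equal_signature_reducer[OF g h(1-3) eq])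
  then show ?thesis using that[of c] h(2,3) eq by simp
qed

text \<open>
  Let two elements share a signature. If their leading monomials differ, then cancelling the signature
  leaves an element with the greater leading monomial and a smaller signature, contrary to
  \<open>no_smaller_signature\<close>. If they agree, then the cofactor from \<open>self_reduction\<close> lets each element
  reduce the other one at equal signature, which interreducedness excludes.
\<close>

lemma signature_inj: "inj_on snd G"
proof -
  have wlog: False
    if g: "g1 \<in> G" "g2 \<in> G" "g1 \<noteq> g2" "snd g1 = snd g2"
      and le: "lm_F (fst g1) = lm_F (fst g2) \<or> lt_F (lm_F (fst g2)) (lm_F (fst g1))" for g1 g2
  proof (cases "lm_F (fst g1) = lm_F (fst g2)")
    case True
    note D1 = signed_nonzeroD[OF G_signed[OF g(1)]] and D2 = signed_nonzeroD[OF G_signed[OF g(2)]]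
    obtain c where "reduction_step (fst g2) g2 c" "sig_product_defined (snd g2) c" "sig_product (snd g2) c = snd g2"
      by (rule self_reduction[OF g(2)])
    then have "reduction_step (fst g1) g2 c" "sig_product_defined (snd g2) c" "sig_product (snd g2) c = snd g1"
      using reduction_step_cong[OF D1(2) D2(2) True] g(4) by auto
    then show False using no_equal_signature_reducer[OF g(1,2)] g(3) by simp
  next
    case False
    then have lt: "lt_F (lm_F (fst g2)) (lm_F (fst g1))" using le by simp
    note D1 = signed_nonzeroD[OF G_signed[OF g(1)]] and D2 = signed_nonzeroD[OF G_signed[OF g(2)]]
    obtain f1 where f1: "f1 \<in> E" "f1 \<noteq> 0" "lm_E f1 = snd g1" "ev f1 = fst g1" by (rule G_lift[OF g(1)])
    obtain f2 where f2: "f2 \<in> E" "f2 \<noteq> 0" "lm_E f2 = snd g2" "ev f2 = fst g2" by (rule G_lift[OF g(2)])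
    obtain k where k: "f1 + scale k f2 = 0 \<or> lt_E (lm_E (f1 + scale k f2)) (lm_E f1)"
      using lm_E_cancel[OF f1(1,2) f2(1,2)] f1(3) f2(3) g(4) by auto
    let ?x = "fst g1 \<oplus>\<^bsub>F\<^esub> scalar k \<odot>\<^bsub>F\<^esub> fst g2"
    have e: "ev (f1 + scale k f2) = ?x"
      by (simp add: ev_add ev_scale E_scale f1(1,4) f2(1,4))
    note l = lm_F_add_smaller[OF D1(1,2) D2(1,2) lt, of k]
    have ne: "f1 + scale k f2 \<noteq> 0" using l(2) e by auto
    have "(?x, lm_E (f1 + scale k f2)) \<in> signed_nonzero"
      unfolding signed_nonzero_iff using l(2) e ne E_add[OF f1(1) E_scale[OF f2(1)]] by blast
    then show False using no_smaller_signature[OF g(1) _ l(1)] k ne f1(3) by auto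
  qed
  show ?thesis
  proof (rule inj_onI, rule ccontr)
    fix g1 g2 assume g: "g1 \<in> G" "g2 \<in> G" "snd g1 = snd g2" "g1 \<noteq> g2"
    have "lm_F (fst g1) \<in> module_monomials r" "lm_F (fst g2) \<in> module_monomials r"
      using lm_F(1) signed_nonzeroD[OF G_signed[OF g(1)]] signed_nonzeroD[OF G_signed[OF g(2)]] by auto
    then have "lm_F (fst g1) = lm_F (fst g2) \<or> lt_F (lm_F (fst g2)) (lm_F (fst g1)) \<or> lt_F (lm_F (fst g1)) (lm_F (fst g2))"
      using strict_total_order_onD(3)[OF order_F] by blast
    then show False using wlog[of g1 g2] wlog[of g2 g1] g by metis
  qed
qed

text \<open>
  Choose \<open>x\<close> with signature \<open>s\<close> and least leading monomial. A reducer of smaller signature could be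
  subtracted without changing the signature, and the result, non-zero by assumption, would have a
  smaller leading monomial. So the reducer of \<open>x\<close> in \<open>G\<close> attains the signature \<open>s\<close>; as \<open>s\<close> has degree
  zero, the cofactor is a trivial path and the signature of the reducer itself is \<open>s\<close>.
\<close>

lemma degree_zero_signature:
  assumes s: "s \<in> sig_monomials m" "path_deg (snd s) = 0"
    and nonsyz: "\<And>f. f \<in> E \<Longrightarrow> f \<noteq> 0 \<Longrightarrow> lm_E f = s \<Longrightarrow> ev f \<noteq> \<zero>\<^bsub>F\<^esub>"
  shows "\<exists>g\<in>G. snd g = s"
proof -
  define L where "L = lm_F ` {x. (x, s) \<in> signed_nonzero}"
  have LF: "L \<subseteq> module_monomials r"
    unfolding L_def
  proof (rule image_subsetI)
    fix x assume "x \<in> {x. (x, s) \<in> signed_nonzero}"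
    then have "(x, s) \<in> signed_nonzero" by simp
    then show "lm_F x \<in> module_monomials r" using lm_F(1)[of x] signed_nonzeroD(1,2)[of "(x, s)"] by simp
  qed
  have fin: "finite L" using LF finite_module_monomials by (rule finite_subset)
  let ?f = "Poly_Mapping.single s (1::'k)"
  have keys_f: "Poly_Mapping.keys ?f = {s}" by simp
  have "?f \<noteq> 0"
  proof
    assume "?f = 0"
    then show False using keys_f by (metis empty_not_insert keys_zero)
  qed
  then have f: "?f \<in> E" "?f \<noteq> 0" "lm_E ?f = s"
    using E_single[OF s(1), of 1] lm_E_eqI[of ?f s] by auto
  then have "(ev ?f, s) \<in> signed_nonzero" unfolding signed_nonzero_iff using nonsyz[OF f] by blast
  then have ne: "L \<noteq> {}" by (auto simp: L_def)
  obtain l where l: "l \<in> L" "\<forall>u\<in>L. u = l \<or> lt_F l u"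
    using finite_least_exists[OF order_F fin ne LF] by auto
  then obtain x where x: "(x, s) \<in> signed_nonzero" "lm_F x = l" by (auto simp: L_def)
  have xc: "x \<in> carrier F" "x \<noteq> \<zero>\<^bsub>F\<^esub>" using signed_nonzeroD[OF x(1)] by auto
  obtain fx where fx: "fx \<in> E" "fx \<noteq> 0" "lm_E fx = s" "ev fx = x"
    using x(1) by (auto simp: signed_nonzero_iff)
  obtain g c where g: "g \<in> G" "reduction_step x g c" "sig_product_defined (snd g) c"
    "lt_E (sig_product (snd g) c) s \<or> sig_product (snd g) c = s"
    using weakly_reducible[OF x(1)] unfolding weakly_s_reducible_def by auto
  note y = reduction_step_signed[OF xc(1) G_signed[OF g(1)] g(2,3)]
  let ?y = "c \<odot>\<^bsub>F\<^esub> fst g"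
  have yc: "?y \<in> carrier F" "?y \<noteq> \<zero>\<^bsub>F\<^esub>" using signed_nonzeroD[OF y(1)] by auto
  obtain fy where fy: "fy \<in> E" "fy \<noteq> 0" "lm_E fy = sig_product (snd g) c" "ev fy = ?y"
    using y(1) by (auto simp: signed_nonzero_iff)
  note ord = strict_total_order_onD[OF order_E]
  have u: "sig_product (snd g) c \<in> sig_monomials m" using lm_E(2)[OF fy(1,2)] fy(3) by simp
  have "\<not> lt_E (sig_product (snd g) c) s"
  proof
    assume lt: "lt_E (sig_product (snd g) c) s"
    obtain k where k: "x \<oplus>\<^bsub>F\<^esub> scalar k \<odot>\<^bsub>F\<^esub> ?y = \<zero>\<^bsub>F\<^esub> \<or>
        lt_F (lm_F (x \<oplus>\<^bsub>F\<^esub> scalar k \<odot>\<^bsub>F\<^esub> ?y)) (lm_F x)"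
      using lm_F_cancel[OF xc yc y(2)[symmetric]] by blast
    let ?h = "fx + scale k fy"
    have hE: "?h \<in> E" by (simp add: E_add E_scale fx(1) fy(1))
    have hev: "ev ?h = x \<oplus>\<^bsub>F\<^esub> scalar k \<odot>\<^bsub>F\<^esub> ?y"
      by (simp add: ev_add ev_scale E_scale fx fy)
    have below: "t = s \<or> lt_E t s" if t: "t \<in> Poly_Mapping.keys ?h" for t
    proof (cases "t \<in> Poly_Mapping.keys fx")
      case True
      then show ?thesis using lm_E(3)[OF fx(1,2) True] fx(3) by simp
    next
      case False
      then have ty: "t \<in> Poly_Mapping.keys fy" using t by (auto simp: in_keys_iff lookup_add)
      have "t = sig_product (snd g) c \<or> lt_E t (sig_product (snd g) c)"
        using lm_E(3)[OF fy(1,2) ty] fy(3) by simp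
      then show ?thesis
        using lt ord(4)[OF E_keys[OF fy(1) ty] u s(1)] by auto
    qed
    have "s \<notin> Poly_Mapping.keys fy"
      using lm_E(3)[OF fy(1,2), of s] fy(3) lt ord(1)[OF s(1) s(1)] ord(2)[OF s(1) u] by auto
    then have "s \<in> Poly_Mapping.keys ?h"
      using lm_E(1)[OF fx(1,2)] fx(3) by (simp add: in_keys_iff lookup_add)
    then have h: "?h \<noteq> 0" "lm_E ?h = s" using lm_E_eqI[OF hE _ below] by auto
    then have "ev ?h \<noteq> \<zero>\<^bsub>F\<^esub>" using nonsyz[OF hE] by simp
    then have "(ev ?h, s) \<in> signed_nonzero" unfolding signed_nonzero_iff using hE h by blast
    then have hL: "lm_F (ev ?h) \<in> L" by (auto simp: L_def)
    have "lt_F (lm_F (ev ?h)) l" using k hev \<open>ev ?h \<noteq> \<zero>\<^bsub>F\<^esub>\<close> x(2) by auto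
    moreover have "lm_F (ev ?h) \<in> module_monomials r" "l \<in> module_monomials r" using hL l(1) LF by auto
    ultimately show False
      using l(2)[rule_format, OF hL] strict_total_order_onD(1,2)[OF order_F, of "lm_F (ev ?h)" l] by auto
  qed
  then have eq: "sig_product (snd g) c = s" using g(4) by simp
  then have "path_deg (snd (snd g)) + path_deg (lam c) = 0"
    using s(2) by (auto simp: sig_product_def path_deg_concat)
  then have "snd (lam c) = []" by (simp add: path_deg_def)
  then have "snd g = s" using eq by (auto simp: sig_product_def path_concat_def)
  then show ?thesis using g(1) by blast
qed

section \<open>The head and the radical\<close>

abbreviation head_generators :: "(nat \<Rightarrow> 'a) set" where
  "head_generators \<equiv> fst ` degree_zero_part G"

lemma degree_zero_partD: "g \<in> degree_zero_part G \<Longrightarrow> g \<in> G \<and> path_deg (snd (snd g)) = 0"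
  by (simp add: degree_zero_part_def)

lemma finite_head_generators: "finite head_generators"
  using G_finite by (simp add: degree_zero_part_def)

lemma head_generators_M: "head_generators \<subseteq> M"
  using degree_zero_partD G_signed signed_nonzeroD(4) by blast

lemma head_generators_closed: "x \<in> head_generators \<Longrightarrow> x \<in> carrier F"
  using head_generators_M M_carrier by blast

definition comb :: "((nat \<Rightarrow> 'a) \<Rightarrow> 'k) \<Rightarrow> nat \<Rightarrow> 'a" where
  "comb k = (\<Oplus>\<^bsub>F\<^esub>x\<in>head_generators. scalar (k x) \<odot>\<^bsub>F\<^esub> x)"

lemma comb_M: "comb k \<in> M"
  unfolding comb_def using submoduleD[OF submodule_M] M_carrier head_generators_M
  by (intro finsum_in_additive) auto

lemma comb_closed: "comb k \<in> carrier F"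
  using comb_M M_carrier by blast

lemma comb_add: "comb (\<lambda>x. k x + l x) = comb k \<oplus>\<^bsub>F\<^esub> comb l"
proof -
  have "comb (\<lambda>x. k x + l x) = (\<Oplus>\<^bsub>F\<^esub>x\<in>head_generators. scalar (k x) \<odot>\<^bsub>F\<^esub> x \<oplus>\<^bsub>F\<^esub> scalar (l x) \<odot>\<^bsub>F\<^esub> x)"
    unfolding comb_def using head_generators_closed
    by (intro F.finsum_cong') (simp_all add: scalar_add smult_add_left)
  also have "\<dots> = comb k \<oplus>\<^bsub>F\<^esub> comb l"
    unfolding comb_def using head_generators_closed by (intro F.finsum_addf) auto
  finally show ?thesis .
qed

lemma comb_scalar: "comb (\<lambda>x. c * k x) = scalar c \<odot>\<^bsub>F\<^esub> comb k"
proof -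
  have "comb (\<lambda>x. c * k x) = (\<Oplus>\<^bsub>F\<^esub>x\<in>head_generators. scalar c \<odot>\<^bsub>F\<^esub> (scalar (k x) \<odot>\<^bsub>F\<^esub> x))"
    unfolding comb_def using head_generators_closed
    by (intro F.finsum_cong') (simp_all add: scalar_scalar)
  also have "\<dots> = scalar c \<odot>\<^bsub>F\<^esub> comb k"
    unfolding comb_def using head_generators_closed by (intro smult_finsum[symmetric]) simp_all
  finally show ?thesis .
qed

lemma comb_zero: "comb (\<lambda>x. 0) = \<zero>\<^bsub>F\<^esub>"
  using comb_scalar[of 0 "\<lambda>x. 0"] comb_closed by simp

lemma comb_single:
  assumes "x \<in> head_generators" shows "comb (\<lambda>y. if y = x then 1 else 0) = x"
proof -
  have "comb (\<lambda>y. if y = x then 1 else 0) = (\<Oplus>\<^bsub>F\<^esub>y\<in>head_generators. if x = y then y else \<zero>\<^bsub>F\<^esub>)"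
    unfolding comb_def using head_generators_closed
    by (intro F.finsum_cong') auto
  also have "\<dots> = x"
    using F.add.finprod_singleton[OF assms finite_head_generators, of "\<lambda>y. y"] head_generators_closed
    by auto
  finally show ?thesis .
qed

text \<open>
  That \<open>k\<close> is a coordinate vector of the class of \<open>y\<close> in the head, once \<open>Rad_eq\<close> has identified the
  arrow part with the radical.
\<close>

definition represents :: "((nat \<Rightarrow> 'a) \<Rightarrow> 'k) \<Rightarrow> (nat \<Rightarrow> 'a) \<Rightarrow> bool" where
  "represents k y \<longleftrightarrow> y \<oplus>\<^bsub>F\<^esub> scalar (-1) \<odot>\<^bsub>F\<^esub> comb k \<in> arrow_part"

lemma represents_add:
  assumes "represents k y" "represents l z" "y \<in> carrier F" "z \<in> carrier F"
  shows "represents (\<lambda>x. k x + l x) (y \<oplus>\<^bsub>F\<^esub> z)"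
proof -
  have "y \<oplus>\<^bsub>F\<^esub> z \<oplus>\<^bsub>F\<^esub> scalar (-1) \<odot>\<^bsub>F\<^esub> comb (\<lambda>x. k x + l x)
    = (y \<oplus>\<^bsub>F\<^esub> scalar (-1) \<odot>\<^bsub>F\<^esub> comb k) \<oplus>\<^bsub>F\<^esub> (z \<oplus>\<^bsub>F\<^esub> scalar (-1) \<odot>\<^bsub>F\<^esub> comb l)"
    using assms(3,4) by (simp add: comb_add comb_closed smult_add_right F.a_ac)
  then show ?thesis
    using submoduleD(3)[OF submodule_arrow_part] assms(1,2) by (simp add: represents_def)
qed

lemma represents_scalar:
  assumes "represents k y" "y \<in> carrier F"
  shows "represents (\<lambda>x. c * k x) (scalar c \<odot>\<^bsub>F\<^esub> y)"
proof -
  have "scalar c \<odot>\<^bsub>F\<^esub> y \<oplus>\<^bsub>F\<^esub> scalar (-1) \<odot>\<^bsub>F\<^esub> comb (\<lambda>x. c * k x)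
    = scalar c \<odot>\<^bsub>F\<^esub> (y \<oplus>\<^bsub>F\<^esub> scalar (-1) \<odot>\<^bsub>F\<^esub> comb k)"
    using assms(2) by (simp add: comb_scalar comb_closed smult_add_right scalar_scalar)
  then show ?thesis
    using submoduleD(4)[OF submodule_arrow_part scalar_closed] assms(1) by (simp add: represents_def)
qed

lemma represents_arrow_part: "y \<in> arrow_part \<Longrightarrow> represents (\<lambda>x. 0) y"
  using submoduleD(1)[OF submodule_arrow_part] by (auto simp: represents_def comb_zero)

lemma represents_generator:
  "x \<in> head_generators \<Longrightarrow> represents (\<lambda>y. if y = x then 1 else 0) x"
  unfolding represents_def
  by (simp add: comb_single scalar_minus_one_cancel head_generators_closed submoduleD(2)[OF submodule_arrow_part])

text \<open>
  Gaussian elimination along the finitely many monomials of degree zero. Each of them is the leading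
  monomial of an element of \<open>E\<close> whose value is zero or a head generator; hence it equals, up to
  a scalar factor and modulo the arrow part, such a value plus a combination of smaller monomials of
  degree zero.
\<close>

lemma represents_ex:
  assumes "y \<in> M" shows "\<exists>k. represents k y"
proof -
  define W where "W = {y \<in> M. \<exists>k. represents k y}"
  note MD = submoduleD[OF submodule_M]
  have Wc: "W \<subseteq> carrier F" using M_carrier by (auto simp: W_def)
  have W0: "\<zero>\<^bsub>F\<^esub> \<in> W"
    using represents_arrow_part submoduleD(2)[OF submodule_arrow_part] MD(2) by (auto simp: W_def)
  have Wadd: "x \<oplus>\<^bsub>F\<^esub> y \<in> W" if "x \<in> W" "y \<in> W" for x y
    using that represents_add[of _ x _ y] M_carrier MD(3) unfolding W_def by blast
  have Wscal: "scalar k \<odot>\<^bsub>F\<^esub> x \<in> W" if "x \<in> W" for k x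
    using that represents_scalar[of _ x k] M_carrier MD(4) by (auto simp: W_def)
  have Warrow: "x \<in> W" if "x \<in> arrow_part" for x
    using that represents_arrow_part arrow_part_M by (auto simp: W_def)
  define D where "D = {s \<in> sig_monomials m. path_deg (snd s) = 0}"
  have "D \<subseteq> {..<m} \<times> {b \<in> paths Q. path_deg b < 1}" by (auto simp: D_def sig_monomials_def)
  then have finD: "finite D"
    by (rule finite_subset) (intro finite_cartesian_product finite_paths_bounded finite_lessThan)
  have lead: "\<exists>f\<in>E. f \<noteq> 0 \<and> lm_E f = s \<and> ev f \<in> W" if s: "s \<in> D" for s
  proof (cases "\<exists>f\<in>E. f \<noteq> 0 \<and> lm_E f = s \<and> ev f = \<zero>\<^bsub>F\<^esub>")
    case True
    then show ?thesis using W0 by auto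
  next
    case False
    have sD: "s \<in> sig_monomials m" "path_deg (snd s) = 0" using s by (auto simp: D_def)
    have "\<exists>g\<in>G. snd g = s" by (rule degree_zero_signature[OF sD]) (use False in blast)
    then obtain g where g: "g \<in> G" "snd g = s" by blast
    then have "fst g \<in> head_generators" using s by (auto simp: D_def degree_zero_part_def)
    then have "fst g \<in> W" using represents_generator head_generators_M by (auto simp: W_def)
    then show ?thesis using G_lift[OF g(1)] g(2) by metis
  qed
  have single1: "ev (Poly_Mapping.single t k) \<in> W"
    if "ev (Poly_Mapping.single t 1) \<in> W" "t \<in> sig_monomials m" for t k
    using Wscal[OF that(1), of k] ev_scale[OF E_single[OF that(2)], of k 1] by (simp add: scale_single)
  have DW: "ev (Poly_Mapping.single s 1) \<in> W" if "s \<in> D" for s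
  proof (rule ccontr)
    assume neg: "ev (Poly_Mapping.single s 1) \<notin> W"
    define B where "B = {s \<in> D. ev (Poly_Mapping.single s 1) \<notin> W}"
    have "s \<in> B" "B \<subseteq> D" using that neg by (auto simp: B_def)
    moreover have "D \<subseteq> sig_monomials m" by (auto simp: D_def)
    ultimately have B: "finite B" "B \<noteq> {}" "B \<subseteq> sig_monomials m"
      using finite_subset[OF _ finD, of B] by auto
    obtain t where t: "t \<in> B" "\<forall>u\<in>B. u = t \<or> lt_E t u"
      using finite_least_exists[OF order_E B] by auto
    have tD: "t \<in> D" "t \<in> sig_monomials m" using t(1) by (auto simp: B_def D_def)
    obtain f where f: "f \<in> E" "f \<noteq> 0" "lm_E f = t" "ev f \<in> W" using lead[OF tD(1)] by blast
    define c where "c = Poly_Mapping.lookup f t"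
    have c: "c \<noteq> 0" using lm_E(1)[OF f(1,2)] f(3) by (simp add: c_def in_keys_iff)
    \<comment> \<open>\<open>f + h\<close> is the leading term of \<open>f\<close>, and \<open>h\<close> involves only monomials below \<open>t\<close>.\<close>
    define h where "h = Poly_Mapping.single t c + scale (-1) f"
    have hE: "h \<in> E" by (simp add: h_def E_add E_single E_scale f(1) tD(2))
    have "ev h \<in> W"
    proof (rule ev_in_additive[OF Wc W0 Wadd hE])
      fix u assume u: "u \<in> Poly_Mapping.keys h"
      have um: "u \<in> sig_monomials m" by (rule E_keys[OF hE u])
      have "u \<noteq> t" "u \<in> Poly_Mapping.keys f"
        using u by (auto simp: h_def c_def in_keys_iff lookup_add lookup_single when_def split: if_splits)
      then have lt: "lt_E u t" using lm_E(3)[OF f(1,2)] f(3) by blast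
      show "ev (Poly_Mapping.single u (Poly_Mapping.lookup h u)) \<in> W"
      proof (cases "path_deg (snd u) = 0")
        case True
        have "u \<notin> B" using t(2) \<open>u \<noteq> t\<close> lt strict_total_order_onD(2)[OF order_E um tD(2)] by auto
        then have "ev (Poly_Mapping.single u 1) \<in> W" using True um by (simp add: B_def D_def)
        then show ?thesis by (rule single1[OF _ um])
      qed (use ev_single_arrow_part[OF um] Warrow in auto)
    qed
    then have "scalar (1 / c) \<odot>\<^bsub>F\<^esub> (ev f \<oplus>\<^bsub>F\<^esub> ev h) \<in> W" by (intro Wscal Wadd f(4))
    also have "scalar (1 / c) \<odot>\<^bsub>F\<^esub> (ev f \<oplus>\<^bsub>F\<^esub> ev h) = ev (scale (1 / c) (f + h))"
      by (simp add: ev_scale ev_add E_add f(1) hE)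
    also have "scale (1 / c) (f + h) = Poly_Mapping.single t 1"
      using c by (intro poly_mapping_eqI) (simp add: h_def lookup_add lookup_single when_def)
    finally show False using t(1) by (simp add: B_def)
  qed
  obtain f where f: "f \<in> E" "y = ev f" using assms ev_E by blast
  have "ev f \<in> W"
  proof (rule ev_in_additive[OF Wc W0 Wadd f(1)])
    fix t assume "t \<in> Poly_Mapping.keys f"
    then have t: "t \<in> sig_monomials m" by (rule E_keys[OF f(1)])
    show "ev (Poly_Mapping.single t (Poly_Mapping.lookup f t)) \<in> W"
    proof (cases "path_deg (snd t) = 0")
      case True
      then have "t \<in> D" using t by (simp add: D_def)
      then show ?thesis by (rule single1[OF DW t])
    qed (use ev_single_arrow_part[OF t] Warrow in auto)
  qed
  then show ?thesis using f(2) by (simp add: W_def)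
qed

text \<open>
  A linear relation modulo the arrow part lifts to a syzygy in \<open>E\<close>. The monomials of degree zero are the
  greatest ones and the signatures of the head generators are distinct, so the leading monomial of this
  syzygy is one of these signatures, contrary to \<open>signature_not_syzygy\<close>.
\<close>

lemma comb_independent:
  assumes arrow: "comb k \<in> arrow_part" and x: "x \<in> head_generators"
  shows "k x = 0"
proof (rule ccontr)
  assume kx: "k x \<noteq> 0"
  have "\<forall>x\<in>head_generators. \<exists>f. f \<in> E \<and> f \<noteq> 0 \<and> ev f = x \<and> (x, lm_E f) \<in> degree_zero_part G"
  proof
    fix x assume "x \<in> head_generators"
    then obtain g where g: "g \<in> degree_zero_part G" "x = fst g" by blast
    obtain f where "f \<in> E" "f \<noteq> 0" "lm_E f = snd g" "ev f = fst g"
      using G_lift degree_zero_partD[OF g(1)] by blast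
    then show "\<exists>f. f \<in> E \<and> f \<noteq> 0 \<and> ev f = x \<and> (x, lm_E f) \<in> degree_zero_part G"
      using g by (intro exI[of _ f]) simp
  qed
  then obtain L where L: "\<And>x. x \<in> head_generators \<Longrightarrow> L x \<in> E" "\<And>x. x \<in> head_generators \<Longrightarrow> L x \<noteq> 0"
    "\<And>x. x \<in> head_generators \<Longrightarrow> ev (L x) = x"
    "\<And>x. x \<in> head_generators \<Longrightarrow> (x, lm_E (L x)) \<in> degree_zero_part G"
    by metis
  define P where "P = {x \<in> head_generators. k x \<noteq> 0}"
  let ?S = "(\<lambda>x. lm_E (L x)) ` P"
  have S: "finite ?S" "?S \<noteq> {}" "?S \<subseteq> sig_monomials m"
  proof -
    show "finite ?S" using finite_head_generators by (simp add: P_def)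
    show "?S \<noteq> {}" using x kx by (auto simp: P_def)
    show "?S \<subseteq> sig_monomials m"
      by (rule image_subsetI) (simp add: P_def lm_E(2) L(1,2))
  qed
  \<comment> \<open>The leading monomial of the relation: the greatest signature with a non-zero coefficient.\<close>
  define s where "s = greatest_wrt lt_E ?S"
  have sS: "s \<in> ?S" and smax: "\<And>u. u \<in> ?S \<Longrightarrow> u = s \<or> lt_E u s"
    using greatest_wrt[OF order_E S] by (auto simp: s_def)
  then obtain z where z: "z \<in> head_generators" "k z \<noteq> 0" "lm_E (L z) = s" by (auto simp: P_def)
  have sm: "s \<in> sig_monomials m" using sS S(3) by blast
  have deg_s: "path_deg (snd s) = 0" using degree_zero_partD[OF L(4)[OF z(1)]] z(3) by simp
  obtain h where h: "h \<in> E" "\<forall>t\<in>Poly_Mapping.keys h. 0 < path_deg (snd t)" "comb k = ev h"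
    using arrow by (auto simp: arrow_part_def)
  define f where "f = (\<Sum>x\<in>head_generators. scale (k x) (L x)) + scale (-1) h"
  have sumE: "(\<Sum>x\<in>head_generators. scale (k x) (L x)) \<in> E" by (intro E_sum E_scale L(1))
  have fE: "f \<in> E" by (simp add: f_def E_add E_scale h(1) sumE)
  have "ev (\<Sum>x\<in>head_generators. scale (k x) (L x)) = comb k"
  proof -
    have "ev (\<Sum>x\<in>head_generators. scale (k x) (L x)) = (\<Oplus>\<^bsub>F\<^esub>x\<in>head_generators. ev (scale (k x) (L x)))"
      by (intro ev_sum E_scale L(1))
    also have "\<dots> = comb k"
      unfolding comb_def
      by (rule F.finsum_cong') (simp_all add: L(1,3) ev_scale head_generators_closed)
    finally show ?thesis .
  qed
  then have ev0: "ev f = \<zero>\<^bsub>F\<^esub>"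
    by (simp add: f_def ev_add ev_scale E_scale h sumE scalar_minus_one_cancel ev_closed)
  note ord = strict_total_order_onD[OF order_E]
  have below: "t = s \<or> lt_E t s" if t: "t \<in> Poly_Mapping.keys f" for t
  proof -
    have tm: "t \<in> sig_monomials m" by (rule E_keys[OF fE t])
    have "Poly_Mapping.lookup f t \<noteq> 0" using t by (simp add: in_keys_iff)
    then have "(\<Sum>x\<in>head_generators. k x * Poly_Mapping.lookup (L x) t) \<noteq> 0 \<or> Poly_Mapping.lookup h t \<noteq> 0"
      by (auto simp: f_def lookup_add lookup_sum)
    then show ?thesis
    proof
      assume "(\<Sum>x\<in>head_generators. k x * Poly_Mapping.lookup (L x) t) \<noteq> 0"
      then obtain w where w: "w \<in> head_generators" "k w * Poly_Mapping.lookup (L w) t \<noteq> 0"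
        by (rule sum.not_neutral_contains_not_neutral)
      have tw: "t = lm_E (L w) \<or> lt_E t (lm_E (L w))"
        using lm_E(3)[OF L(1,2)[OF w(1)], of t] w(2) by (auto simp: in_keys_iff)
      have "lm_E (L w) = s \<or> lt_E (lm_E (L w)) s" using w by (intro smax imageI) (simp add: P_def)
      then show ?thesis using tw ord(4)[OF tm lm_E(2)[OF L(1,2)[OF w(1)]] sm] by metis
    next
      assume "Poly_Mapping.lookup h t \<noteq> 0"
      then have "0 < path_deg (snd t)" using h(2) by (simp add: in_keys_iff)
      then show ?thesis using smaller_degree_greater[OF tm sm] deg_s by simp
    qed
  qed
  have "Poly_Mapping.lookup (L w) s = 0" if w: "w \<in> head_generators" "k w \<noteq> 0" "w \<noteq> z" for w
  proof (rule ccontr)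
    assume "Poly_Mapping.lookup (L w) s \<noteq> 0"
    then have "s = lm_E (L w) \<or> lt_E s (lm_E (L w))"
      using lm_E(3)[OF L(1,2)[OF w(1)], of s] by (simp add: in_keys_iff)
    moreover have lw: "lm_E (L w) = s \<or> lt_E (lm_E (L w)) s" using w by (intro smax imageI) (simp add: P_def)
    ultimately have "lm_E (L w) = s"
      using ord(2)[OF sm lm_E(2)[OF L(1,2)[OF w(1)]]] by auto
    then have "(w, s) \<in> G" "(z, s) \<in> G"
      using degree_zero_partD[OF L(4)[OF w(1)]] degree_zero_partD[OF L(4)[OF z(1)]] z(3) by simp_all
    then show False using inj_onD[OF signature_inj, of "(w, s)" "(z, s)"] w(3) by simp
  qed
  then have "(\<Sum>x\<in>head_generators. k x * Poly_Mapping.lookup (L x) s)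
    = (\<Sum>x\<in>head_generators. if x = z then k z * Poly_Mapping.lookup (L z) s else 0)"
    by (intro sum.cong) auto
  also have "\<dots> = k z * Poly_Mapping.lookup (L z) s"
    using z(1) finite_head_generators by simp
  finally have sum_s: "(\<Sum>x\<in>head_generators. k x * Poly_Mapping.lookup (L x) s) = k z * Poly_Mapping.lookup (L z) s" .
  have "s \<notin> Poly_Mapping.keys h" using h(2) deg_s by auto
  then have "Poly_Mapping.lookup f s = k z * Poly_Mapping.lookup (L z) s"
    by (simp add: f_def lookup_add lookup_sum sum_s in_keys_iff)
  then have sk: "s \<in> Poly_Mapping.keys f"
    using z lm_E(1)[OF L(1,2)[OF z(1)]] by (simp add: in_keys_iff)
  then have "f \<noteq> 0" by auto
  moreover have "lm_E f = s" by (rule lm_E_eqI[OF fE sk below])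
  ultimately show False
    using signature_not_syzygy[of "(z, s)" f] degree_zero_partD[OF L(4)[OF z(1)]] z(3) fE ev0 by simp
qed

lemma represents_unique:
  assumes "represents k y" "represents l y" "y \<in> carrier F" "x \<in> head_generators"
  shows "k x = l x"
proof -
  have "represents (\<lambda>x. k x + -1 * l x) (y \<oplus>\<^bsub>F\<^esub> scalar (-1) \<odot>\<^bsub>F\<^esub> y)"
    using assms by (intro represents_add represents_scalar) auto
  then have "scalar (-1) \<odot>\<^bsub>F\<^esub> comb (\<lambda>x. k x + -1 * l x) \<in> arrow_part"
    using assms(3) by (simp add: represents_def scalar_minus_one_cancel comb_closed)
  then have "comb (\<lambda>x. -1 * (k x + -1 * l x)) \<in> arrow_part" unfolding comb_scalar .
  then show ?thesis using comb_independent[OF _ assms(4)] by fastforce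
qed

text \<open>
  Of two elements with the same unsigned part, the one with the greater signature would violate
  \<open>no_smaller_signature\<close>.
\<close>

lemma inj_on_degree_zero_part: "inj_on fst (degree_zero_part G)"
proof -
  have wlog: False if g: "g1 \<in> G" "g2 \<in> G" "fst g1 = fst g2" and lt: "lt_E (snd g2) (snd g1)" for g1 g2
    using no_smaller_signature[OF g(1), of "fst g2" "snd g2"] G_signed[OF g(2)] g(3) lt by simp
  show ?thesis
  proof (rule inj_onI, rule ccontr)
    fix g1 g2 assume g: "g1 \<in> degree_zero_part G" "g2 \<in> degree_zero_part G" "fst g1 = fst g2" "g1 \<noteq> g2"
    have G: "g1 \<in> G" "g2 \<in> G" using g degree_zero_partD by auto
    have "snd g1 \<noteq> snd g2" using g(3,4) by (simp add: prod_eq_iff)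
    then have "lt_E (snd g2) (snd g1) \<or> lt_E (snd g1) (snd g2)"
      using strict_total_order_onD(3)[OF order_E signed_nonzeroD(3)[OF G_signed[OF G(2)]] signed_nonzeroD(3)[OF G_signed[OF G(1)]]]
      by auto
    then show False using wlog G g(3) by metis
  qed
qed

definition coord :: "(nat \<Rightarrow> 'a) \<Rightarrow> (nat \<Rightarrow> 'a) \<Rightarrow> 'k" where
  "coord y = (SOME k. represents k y)"

lemma represents_coord: "y \<in> M \<Longrightarrow> represents (coord y) y"
  unfolding coord_def by (rule someI_ex[OF represents_ex])

lemma coord_eqI: "represents k y \<Longrightarrow> y \<in> M \<Longrightarrow> x \<in> head_generators \<Longrightarrow> coord y x = k x"
  using represents_unique[OF represents_coord] M_carrier by blast

lemma coord_add:
  assumes "y \<in> M" "z \<in> M" "x \<in> head_generators"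
  shows "coord (y \<oplus>\<^bsub>F\<^esub> z) x = coord y x + coord z x"
  using assms represents_add[OF represents_coord represents_coord] M_carrier submoduleD(3)[OF submodule_M]
  by (intro coord_eqI) auto

lemma coord_scalar:
  assumes "y \<in> M" "x \<in> head_generators"
  shows "coord (scalar c \<odot>\<^bsub>F\<^esub> y) x = c * coord y x"
  using assms represents_scalar[OF represents_coord] M_carrier submoduleD(4)[OF submodule_M]
  by (intro coord_eqI) auto

lemma coord_arrow_part:
  "y \<in> arrow_part \<Longrightarrow> x \<in> head_generators \<Longrightarrow> coord y x = 0"
  using coord_eqI[OF represents_arrow_part] arrow_part_M by auto

lemma arrow_part_if_coord_zero:
  assumes "y \<in> M" "\<And>x. x \<in> head_generators \<Longrightarrow> coord y x = 0"
  shows "y \<in> arrow_part"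
proof -
  have "comb (coord y) = comb (\<lambda>x. 0)"
    unfolding comb_def using assms(2) head_generators_closed by (intro F.finsum_cong') auto
  then show ?thesis
    using represents_coord[OF assms(1)] assms(1) M_carrier by (auto simp: represents_def comb_zero)
qed

text \<open>
  If \<open>y\<close> is not in the arrow part, then neither is \<open>y \<cdot> 1\<^sub>v\<close> for some vertex \<open>v\<close>, and some coordinate of
  \<open>y \<cdot> 1\<^sub>v\<close> is non-zero. The same coordinate of \<open>z \<cdot> 1\<^sub>v\<close> is a linear functional of \<open>z\<close> whose kernel
  \<open>N\<close> is a hyperplane. This kernel is a submodule, because paths of positive degree map into the arrow
  part, while \<open>z \<cdot> 1\<^sub>w \<cdot> 1\<^sub>v\<close> is either \<open>z \<cdot> 1\<^sub>v\<close> or zero.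
\<close>

lemma maximal_submodule_avoiding:
  assumes y: "y \<in> M" "y \<notin> arrow_part"
  obtains N where "maximal_submodule N" "y \<notin> N"
proof -
  note MD = submoduleD[OF submodule_M] and AD = submoduleD[OF submodule_arrow_part]
  have triv: "v \<in> verts Q \<Longrightarrow> (v, []) \<in> paths Q" for v by (simp add: trivial_path_iff)
  have "\<exists>v\<in>verts Q. path_image (v, []) \<odot>\<^bsub>F\<^esub> y \<notin> arrow_part"
  proof (rule ccontr)
    assume "\<not> ?thesis"
    then have "(\<Oplus>\<^bsub>F\<^esub>v\<in>verts Q. path_image (v, []) \<odot>\<^bsub>F\<^esub> y) \<in> arrow_part"
      by (intro finsum_in_additive[OF AD(1-3)]) auto
    then show False using smult_one_sum[of y] y M_carrier by auto
  qed
  then obtain v where v: "v \<in> verts Q" "path_image (v, []) \<odot>\<^bsub>F\<^esub> y \<notin> arrow_part" by blast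
  let ?e = "path_image (v, [])"
  have eM: "?e \<odot>\<^bsub>F\<^esub> z \<in> M" if "z \<in> M" for z using MD(4)[OF path_image_closed[OF triv[OF v(1)]] that] .
  obtain x where x: "x \<in> head_generators" "coord (?e \<odot>\<^bsub>F\<^esub> y) x \<noteq> 0"
    using arrow_part_if_coord_zero[OF eM[OF y(1)]] v(2) by blast
  define phi where "phi z = coord (?e \<odot>\<^bsub>F\<^esub> z) x" for z
  have ec: "?e \<in> carrier A" using triv[OF v(1)] by simp
  have phi_add: "phi (z \<oplus>\<^bsub>F\<^esub> w) = phi z + phi w" if "z \<in> M" "w \<in> M" for z w
    using that M_carrier ec x(1) eM by (simp add: phi_def smult_add_right subset_iff coord_add)
  have phi_scalar: "phi (scalar c \<odot>\<^bsub>F\<^esub> z) = c * phi z" if "z \<in> M" for z c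
  proof -
    have "?e \<odot>\<^bsub>F\<^esub> (scalar c \<odot>\<^bsub>F\<^esub> z) = scalar c \<odot>\<^bsub>F\<^esub> (?e \<odot>\<^bsub>F\<^esub> z)"
      using that M_carrier ec by (simp add: smult_smult subset_iff scalar_central)
    then show ?thesis using that x(1) eM by (simp add: phi_def coord_scalar)
  qed
  have phi_arrow: "phi z = 0" if "z \<in> arrow_part" for z
    unfolding phi_def using AD(4)[OF ec that] x(1) by (rule coord_arrow_part)
  define N where "N = {z \<in> M. phi z = 0}"
  have yN: "y \<notin> N" using x(2) by (simp add: N_def phi_def)
  have N: "submodule N A F"
  proof (rule submoduleI_paths)
    show "N \<subseteq> carrier F" using M_carrier by (auto simp: N_def)
    show "\<zero>\<^bsub>F\<^esub> \<in> N" using MD(2) phi_arrow[OF AD(2)] by (simp add: N_def)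
    show "z \<oplus>\<^bsub>F\<^esub> w \<in> N" if "z \<in> N" "w \<in> N" for z w
      using that phi_add MD(3) by (simp add: N_def)
    show "scalar k \<odot>\<^bsub>F\<^esub> z \<in> N" if "z \<in> N" for k z
      using that phi_scalar MD(4) by (simp add: N_def)
  next
    fix b z assume b: "b \<in> paths Q" and z: "z \<in> N"
    have zM: "z \<in> M" and zF: "z \<in> carrier F" and z0: "phi z = 0" using z M_carrier by (auto simp: N_def)
    have "phi (path_image b \<odot>\<^bsub>F\<^esub> z) = 0"
    proof (cases "path_deg b = 0")
      case False
      then show ?thesis using phi_arrow arrow_smult_arrow_part[OF zM b] by simp
    next
      case True
      then obtain w where w: "b = (w, [])" "w \<in> verts Q"
        using b path_deg_0_iff[of b] trivial_path_iff[of "fst b"] by auto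
      have "?e \<odot>\<^bsub>F\<^esub> (path_image b \<odot>\<^bsub>F\<^esub> z) = (path_image b \<otimes> ?e) \<odot>\<^bsub>F\<^esub> z"
        using zF ec b by (simp add: smult_smult)
      also have "path_image b \<otimes> ?e = (if w = v then ?e else \<zero>)"
        unfolding w(1) using w(2) v(1) by (simp add: path_image_mult triv composable_trivial(1) path_concat_trivial)
      finally show ?thesis
        using z0 zF coord_arrow_part[OF AD(2) x(1)] by (auto simp: phi_def)
    qed
    then show "path_image b \<odot>\<^bsub>F\<^esub> z \<in> N" using MD(4)[OF path_image_closed[OF b] zM] by (simp add: N_def)
  qed
  have "maximal_submodule N"
    unfolding maximal_submodule_def
  proof (intro conjI allI impI)
    show "submodule N A F" by (rule N)
    show "N \<subset> M" using yN y(1) by (auto simp: N_def)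
    fix N' assume N': "submodule N' A F \<and> N \<subseteq> N' \<and> N' \<subseteq> M"
    show "N' = N \<or> N' = M"
    proof (rule disjCI)
      assume "N' \<noteq> M"
      show "N' = N"
      proof (rule ccontr)
        assume "N' \<noteq> N"
        then obtain z where z: "z \<in> N'" "z \<notin> N" using N' by blast
        have zM: "z \<in> M" "phi z \<noteq> 0" using z N' by (auto simp: N_def)
        note N'D = submoduleD[OF conjunct1[OF N']]
        have "w \<in> N'" if w: "w \<in> M" for w
        proof -
          let ?c = "phi w / phi z"
          have cz: "scalar c \<odot>\<^bsub>F\<^esub> z \<in> M" for c using MD(4) zM(1) by simp
          have "phi (w \<oplus>\<^bsub>F\<^esub> scalar (- ?c) \<odot>\<^bsub>F\<^esub> z) = 0"
            using zM by (simp add: phi_add[OF w cz] phi_scalar)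
          then have "w \<oplus>\<^bsub>F\<^esub> scalar (- ?c) \<odot>\<^bsub>F\<^esub> z \<in> N'"
            using N' MD(3)[OF w cz] by (auto simp: N_def)
          then have "(w \<oplus>\<^bsub>F\<^esub> scalar (- ?c) \<odot>\<^bsub>F\<^esub> z) \<oplus>\<^bsub>F\<^esub> scalar ?c \<odot>\<^bsub>F\<^esub> z \<in> N'"
            using N'D(3) N'D(4)[OF scalar_closed z(1)] by blast
          moreover have "scalar (- ?c) \<odot>\<^bsub>F\<^esub> z \<oplus>\<^bsub>F\<^esub> scalar ?c \<odot>\<^bsub>F\<^esub> z = \<zero>\<^bsub>F\<^esub>"
            using zM(1) M_carrier smult_add_left[of "scalar (- ?c)" "scalar ?c" z] scalar_add[of "- ?c" ?c, symmetric]
            by auto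
          ultimately show "w \<in> N'"
            using w cz M_carrier by (auto simp: F.a_assoc subset_iff)
        qed
        then show False using N' \<open>N' \<noteq> M\<close> by blast
      qed
    qed
  qed
  then show ?thesis using that yN by blast
qed

lemma Rad_eq: "Rad = arrow_part"
proof
  show "Rad \<subseteq> arrow_part"
  proof
    fix y assume y: "y \<in> Rad"
    show "y \<in> arrow_part"
    proof (rule ccontr)
      assume "y \<notin> arrow_part"
      then show False using maximal_submodule_avoiding[of y] y by (auto simp: Rad_def)
    qed
  qed
  show "arrow_part \<subseteq> Rad"
    using arrow_part_subset_maximal arrow_part_M by (auto simp: Rad_def)
qed

lemma submodule_generated:
  assumes "X \<subseteq> carrier F" shows "submodule (generated_submodule A F X) A F"
proof (rule submoduleI)
  have c: "submodule (carrier F) A F" by (rule submoduleI) auto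
  show "generated_submodule A F X \<subseteq> carrier F" by (rule generated_submodule_subset[OF c assms])
qed (auto simp: generated_submodule_def intro: submoduleD)

lemma head_generators_generate: "generated_submodule A F head_generators = M"
proof
  show "generated_submodule A F head_generators \<subseteq> M"
    by (rule generated_submodule_subset[OF submodule_M head_generators_M])
  let ?N = "generated_submodule A F head_generators"
  have N: "submodule ?N A F" using head_generators_M M_carrier by (intro submodule_generated) auto
  note ND = submoduleD[OF N]
  have sub: "head_generators \<subseteq> ?N" by (auto simp: generated_submodule_def)
  show "M \<subseteq> ?N"
  proof (rule nakayama[OF N])
    fix y assume y: "y \<in> M"
    obtain k where k: "represents k y" using represents_ex[OF y] by blast
    have "comb k \<in> ?N" unfolding comb_def
      using sub by (intro finsum_in_additive[OF ND(1-3)] ND(4)) auto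
    moreover have "y \<in> carrier F" using y M_carrier by auto
    then have "y = comb k \<oplus>\<^bsub>F\<^esub> (y \<oplus>\<^bsub>F\<^esub> scalar (-1) \<odot>\<^bsub>F\<^esub> comb k)"
      using comb_closed[of k] scalar_minus_one_cancel[OF comb_closed[of k]]
      by (simp add: F.a_lcomm[of "comb k" y])
    ultimately show "\<exists>x\<in>?N. \<exists>z\<in>arrow_part. y = x \<oplus>\<^bsub>F\<^esub> z"
      using k unfolding represents_def by blast
  qed
qed

lemma head_basis: "head_basis head_generators"
  unfolding head_basis_def
proof (intro conjI ballI)
  show "finite head_generators" by (rule finite_head_generators)
  show "head_generators \<subseteq> M" by (rule head_generators_M)
  fix y assume y: "y \<in> M"
  have yF: "y \<in> carrier F" using y M_carrier by auto
  have eq: "Rad +>\<^bsub>F\<^esub> y = Rad +>\<^bsub>F\<^esub> (\<Oplus>\<^bsub>F\<^esub>x\<in>head_generators. scalar (k x) \<odot>\<^bsub>F\<^esub> x) \<longleftrightarrow> represents k y" for k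
    using coset_eq_iff[OF submodule_arrow_part yF comb_closed[of k]]
    by (simp add: Rad_eq represents_def comb_def)
  obtain k where k: "represents k y" using represents_ex[OF y] by blast
  let ?k = "restrict k head_generators"
  have "comb ?k = comb k"
    unfolding comb_def using head_generators_closed by (intro F.finsum_cong') auto
  then have rk: "represents ?k y" using k by (simp add: represents_def)
  show "\<exists>!k. k \<in> head_generators \<rightarrow>\<^sub>E (UNIV :: 'k set) \<and>
      Rad +>\<^bsub>F\<^esub> y = Rad +>\<^bsub>F\<^esub> (\<Oplus>\<^bsub>F\<^esub>x\<in>head_generators. scalar (k x) \<odot>\<^bsub>F\<^esub> x)"
    unfolding eq
  proof (rule ex1I[of _ ?k])
    show "?k \<in> head_generators \<rightarrow>\<^sub>E UNIV \<and> represents ?k y" using rk by simp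
  next
    fix l assume l: "l \<in> head_generators \<rightarrow>\<^sub>E (UNIV :: 'k set) \<and> represents l y"
    show "l = ?k"
      using l represents_unique[OF _ rk yF, of l]
      by (intro PiE_ext[of l head_generators "\<lambda>_. UNIV"]) auto
  qed
qed

lemma minimal_generating_set_degree_zero_part:
  "minimal_generating_set head_generators"
  unfolding minimal_generating_set_def
  using head_generators_M head_generators_generate head_basis by blast

end

theorem corollary3:
  fixes Q :: "('v, 'e) pre_digraph" and A :: "('a, 'c) ring_scheme"
    and psi :: "(('v, 'e) path \<Rightarrow>\<^sub>0 'k::field) \<Rightarrow> 'a"
    and lt :: "('v, 'e) path \<Rightarrow> ('v, 'e) path \<Rightarrow> bool"
    and r m :: nat
    and lt_F :: "nat \<times> 'a \<Rightarrow> nat \<times> 'a \<Rightarrow> bool"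
    and M :: "(nat \<Rightarrow> 'a) set"
    and gen :: "nat \<Rightarrow> nat \<Rightarrow> 'a"
    and lt_E :: "nat \<times> ('v, 'e) path \<Rightarrow> nat \<times> ('v, 'e) path \<Rightarrow> bool"
    and G :: "((nat \<Rightarrow> 'a) \<times> (nat \<times> ('v, 'e) path)) set"
  assumes "signature_setting Q A psi lt r lt_F M m gen lt_E"
    and "path_algebra_quotient.basic_algebra Q A psi"
    and "signature_setting.negative_degree_ordering Q m lt_E"
    and "signature_setting.interreduced Q A psi lt r lt_F M m gen lt_E G"
    and "signature_setting.signed_standard_basis Q A psi lt r lt_F M m gen lt_E G"
  shows "inj_on fst (signature_setting.degree_zero_part G) \<and>
    signature_setting.minimal_generating_set Q A psi r M
      (fst ` signature_setting.degree_zero_part G)"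
proof -
  interpret interreduced_signed_basis Q A psi lt r lt_F M m gen lt_E G
    using assms by (intro interreduced_signed_basis.intro basic_signature_setting.intro
      basic_signature_setting_axioms.intro interreduced_signed_basis_axioms.intro)
  show ?thesis
    using inj_on_degree_zero_part minimal_generating_set_degree_zero_part by blast
qed

end
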